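(* Assume (A0) and (A1), and let $T>0$. Then there exists a unique viscosity solution $u:[0,T)\times J\to\mathbb{R}$ of $u_t+H(x,u_x)=0$ on $J_T$ with initial condition $u(0,\cdot)=u_0$ (in the sense of the definition below) that satisfies, for some constant $C_T>0$, $$|u(t,x)-u_0(x)|\le C_T\quad\text{for all }(t,x)\in J_T.$$ Moreover this $u$ is Lipschitz continuous with respect to $(t,x)$ on $J_T$.
   Context: Junction: fix an integer $N\ge1$ and $N$ distinct unit vectors $e_1,\dots,e_N\in\mathbb{R}^2$. Set $J_i=[0,\infty)e_i$, $J_i^*=J_i\setminus\{0\}$, $J=\bigcup_{i=1}^NJ_i$, $J^*=J\setminus\{0\}$, $I_N=\{1,\dots,N\}$. Each $x\in J_i$ is written $x=x_ie_i$ with $x_i\ge0$. $J$ carries the geodesic distance $d(x,y)=|x-y|$ if $x,y$ lie in a common branch $J_i$, and $d(x,y)=|x|+|y|$ otherwise. For $T>0$, $J_T=(0,T)\times J$; balls $B((t,x),r)$ are taken in $(0,\infty)\times J$. For $u$ defined on $J_T$, $u^i$ is its restriction to $(0,T)\times J_i$, viewed as a function of $(t,x_i)\in(0,T)\times[0,\infty)$. $C^1_*(J_T)$ is the set of continuous $u$ on $J_T$ with each $u^i\in C^1((0,T)\times[0,\infty))$ (one-sided derivative at $x_i=0$); for such $u$, $u_t$ is the time derivative, $u^i_x=\partial u^i/\partial x_i$, $u_x(t,x)=u^i_x(t,x)$ if $x\in J_i^*$, and $u_x(t,0)=(u^1_x(t,0),\dots,u^N_x(t,0))$. (A0): $u_0:J\to\mathbb{R}$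 is Lipschitz continuous with respect to $d$. (A1): there is $\gamma>0$ such that for each $i\in I_N$, $L_i\in C^2(\mathbb{R})$ with $L_i''\ge\gamma$; $H_i(p)=\sup_{q\in\mathbb{R}}(pq-L_i(q))$ and $H_i^-(p)=\sup_{q\le0}(pq-L_i(q))$. Hamiltonian: $H(x,p)=H_i(p)$ for $x\in J_i^*$, $p\in\mathbb{R}$; $H(0,p)=\max_{i\in I_N}H_i^-(p_i)$ for $p=(p_1,\dots,p_N)\in\mathbb{R}^N$. So the equation reads $u^i_t+H_i(u^i_x)=0$ on $(0,T)\times J_i^*$ and $u_t+\max_iH_i^-(u^i_x)=0$ on $(0,T)\times\{0\}$. Viscosity solutions: $u:[0,T)\times J\to\mathbb{R}$ is a sub-solution (resp. super-solution) of $u_t+H(x,u_x)=0$ on $J_T$ if it is upper (resp. lower) semicontinuous and for every $\phi\in C^1_*(J_T)$, every $P=(t,x)\in J_T$ and $r>0$ with $u\le\phi$ (resp. $u\ge\phi$) on $B(P,r)$ and $u(P)=\phi(P)$: if $x\in J_i^*$ then $\phi_t(t,x)+H_i(\phi_x(t,x))\le0$ (resp. $\ge0$); if $x=0$ then $\phi_t(t,0)+\max_{i\in I_N}H_i^-(\phi^i_x(t,0))\le0$ (resp. $\ge0$). It is a sub-solution (resp. super-solution) of the problem with initial condition $u_0$ if in addition $u(0,\cdot)\le u_0$ (resp. $\ge u_0$). A function $u$ is a (viscosity) solution if its upper semicontinuous envelope $u^*$ is a sub-solution and its lower semicontinuous envelope $u_*$ is a super-solution. *)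

theory Defs
  imports "HOL-Analysis.Analysis"
begin

type_synonym pt = "real \<times> real"

definition branch :: "(nat \<Rightarrow> pt) \<Rightarrow> nat \<Rightarrow> pt set" where
  "branch e i = {a *\<^sub>R e i | a. a \<ge> 0}"

definition junction :: "nat \<Rightarrow> (nat \<Rightarrow> pt) \<Rightarrow> pt set" where
  "junction N e = (\<Union>i\<in>{1..N}. branch e i)"

definition jdist :: "nat \<Rightarrow> (nat \<Rightarrow> pt) \<Rightarrow> pt \<Rightarrow> pt \<Rightarrow> real" where
  "jdist N e x y =
     (if \<exists>i\<in>{1..N}. x \<in> branch e i \<and> y \<in> branch e i then norm (x - y)
      else norm x + norm y)"

definition C2_unif_convex :: "real \<Rightarrow> (real \<Rightarrow> real) \<Rightarrow> bool" where
  "C2_unif_convex \<gamma> f \<longleftrightarrow> (\<exists>f1 f2. (\<forall>q. (f has_real_derivative f1 q) (at q))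
      \<and> (\<forall>q. (f1 has_real_derivative f2 q) (at q)) \<and> continuous_on UNIV f2
      \<and> (\<forall>q. f2 q \<ge> \<gamma>))"

definition Ham :: "(real \<Rightarrow> real) \<Rightarrow> real \<Rightarrow> real" where
  "Ham Li p = Sup (range (\<lambda>q. p * q - Li q))"

definition Ham_minus :: "(real \<Rightarrow> real) \<Rightarrow> real \<Rightarrow> real" where
  "Ham_minus Li p = Sup ((\<lambda>q. p * q - Li q) ` {..0})"

definition lipschitz_J :: "nat \<Rightarrow> (nat \<Rightarrow> pt) \<Rightarrow> (pt \<Rightarrow> real) \<Rightarrow> bool" where
  "lipschitz_J N e f \<longleftrightarrow> (\<exists>K. \<forall>x\<in>junction N e. \<forall>y\<in>junction N e.
      \<bar>f x - f y\<bar> \<le> K * jdist N e x y)"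

definition lipschitz_JT :: "nat \<Rightarrow> (nat \<Rightarrow> pt) \<Rightarrow> real \<Rightarrow> (real \<Rightarrow> pt \<Rightarrow> real) \<Rightarrow> bool" where
  "lipschitz_JT N e T u \<longleftrightarrow> (\<exists>K. \<forall>t\<in>{0<..<T}. \<forall>s\<in>{0<..<T}.
      \<forall>x\<in>junction N e. \<forall>y\<in>junction N e.
      \<bar>u t x - u s y\<bar> \<le> K * (\<bar>t - s\<bar> + jdist N e x y))"

text \<open>Test functions C^1_*(J_T): phi with time derivative phit (a function on J_T)
  and branchwise space derivative phix i t a = d/da phi(t, a e_i), one-sided at a = 0.\<close>
definition C1_star :: "nat \<Rightarrow> (nat \<Rightarrow> pt) \<Rightarrow> real \<Rightarrow> (real \<Rightarrow> pt \<Rightarrow> real)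
    \<Rightarrow> (real \<Rightarrow> pt \<Rightarrow> real) \<Rightarrow> (nat \<Rightarrow> real \<Rightarrow> real \<Rightarrow> real) \<Rightarrow> bool" where
  "C1_star N e T \<phi> \<phi>t \<phi>x \<longleftrightarrow> (\<forall>i\<in>{1..N}.
      (\<forall>t\<in>{0<..<T}. \<forall>a\<ge>0.
         ((\<lambda>(s, b). \<phi> s (b *\<^sub>R e i)) has_derivative
            (\<lambda>(ds, db). ds * \<phi>t t (a *\<^sub>R e i) + db * \<phi>x i t a))
         (at (t, a) within {0<..<T} \<times> {0..}))
      \<and> continuous_on ({0<..<T} \<times> {0..}) (\<lambda>(s, b). \<phi>t s (b *\<^sub>R e i))
      \<and> continuous_on ({0<..<T} \<times> {0..}) (\<lambda>(s, b). \<phi>x i s b))"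

definition usc_on :: "nat \<Rightarrow> (nat \<Rightarrow> pt) \<Rightarrow> real \<Rightarrow> (real \<Rightarrow> pt \<Rightarrow> ereal) \<Rightarrow> bool" where
  "usc_on N e T w \<longleftrightarrow> (\<forall>t\<in>{0..<T}. \<forall>x\<in>junction N e. \<forall>c. w t x < c \<longrightarrow>
      (\<exists>\<delta>>0. \<forall>s\<in>{0..<T}. \<forall>y\<in>junction N e.
          \<bar>s - t\<bar> < \<delta> \<and> jdist N e x y < \<delta> \<longrightarrow> w s y < c))"

definition lsc_on :: "nat \<Rightarrow> (nat \<Rightarrow> pt) \<Rightarrow> real \<Rightarrow> (real \<Rightarrow> pt \<Rightarrow> ereal) \<Rightarrow> bool" where
  "lsc_on N e T w \<longleftrightarrow> (\<forall>t\<in>{0..<T}. \<forall>x\<in>junction N e. \<forall>c. c < w t x \<longrightarrow>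
      (\<exists>\<delta>>0. \<forall>s\<in>{0..<T}. \<forall>y\<in>junction N e.
          \<bar>s - t\<bar> < \<delta> \<and> jdist N e x y < \<delta> \<longrightarrow> c < w s y))"

definition usc_env :: "nat \<Rightarrow> (nat \<Rightarrow> pt) \<Rightarrow> real \<Rightarrow> (real \<Rightarrow> pt \<Rightarrow> real) \<Rightarrow> real \<Rightarrow> pt \<Rightarrow> ereal" where
  "usc_env N e T u t x = (INF \<delta>\<in>{0<..}. Sup {ereal (u s y) | s y.
      s \<in> {0..<T} \<and> y \<in> junction N e \<and> \<bar>s - t\<bar> < \<delta> \<and> jdist N e x y < \<delta>})"

definition lsc_env :: "nat \<Rightarrow> (nat \<Rightarrow> pt) \<Rightarrow> real \<Rightarrow> (real \<Rightarrow> pt \<Rightarrow> real) \<Rightarrow> real \<Rightarrow> pt \<Rightarrow> ereal" where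
  "lsc_env N e T u t x = (SUP \<delta>\<in>{0<..}. Inf {ereal (u s y) | s y.
      s \<in> {0..<T} \<and> y \<in> junction N e \<and> \<bar>s - t\<bar> < \<delta> \<and> jdist N e x y < \<delta>})"

text \<open>Viscosity sub-/super-solution with initial datum u0. The ball B(P,r) is intersected
  with J_T (where the test function lives).\<close>
definition visc_sub :: "nat \<Rightarrow> (nat \<Rightarrow> pt) \<Rightarrow> (nat \<Rightarrow> real \<Rightarrow> real) \<Rightarrow> real \<Rightarrow> (pt \<Rightarrow> real)
    \<Rightarrow> (real \<Rightarrow> pt \<Rightarrow> ereal) \<Rightarrow> bool" where
  "visc_sub N e L T u0 w \<longleftrightarrow> usc_on N e T w
    \<and> (\<forall>\<phi> \<phi>t \<phi>x. C1_star N e T \<phi> \<phi>t \<phi>x \<longrightarrow>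
        (\<forall>t\<in>{0<..<T}. \<forall>x\<in>junction N e. \<forall>r>0.
           (\<forall>s\<in>{0<..<T}. \<forall>y\<in>junction N e. \<bar>s - t\<bar> < r \<and> jdist N e x y < r
               \<longrightarrow> w s y \<le> ereal (\<phi> s y))
           \<and> w t x = ereal (\<phi> t x) \<longrightarrow>
           (\<forall>i\<in>{1..N}. \<forall>a>0. x = a *\<^sub>R e i \<longrightarrow> \<phi>t t x + Ham (L i) (\<phi>x i t a) \<le> 0)
           \<and> (x = 0 \<longrightarrow> \<phi>t t 0 + Max ((\<lambda>i. Ham_minus (L i) (\<phi>x i t 0)) ` {1..N}) \<le> 0)))
    \<and> (\<forall>x\<in>junction N e. w 0 x \<le> ereal (u0 x))"

definition visc_super :: "nat \<Rightarrow> (nat \<Rightarrow> pt) \<Rightarrow> (nat \<Rightarrow> real \<Rightarrow> real) \<Rightarrow> real \<Rightarrow> (pt \<Rightarrow> real)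
    \<Rightarrow> (real \<Rightarrow> pt \<Rightarrow> ereal) \<Rightarrow> bool" where
  "visc_super N e L T u0 w \<longleftrightarrow> lsc_on N e T w
    \<and> (\<forall>\<phi> \<phi>t \<phi>x. C1_star N e T \<phi> \<phi>t \<phi>x \<longrightarrow>
        (\<forall>t\<in>{0<..<T}. \<forall>x\<in>junction N e. \<forall>r>0.
           (\<forall>s\<in>{0<..<T}. \<forall>y\<in>junction N e. \<bar>s - t\<bar> < r \<and> jdist N e x y < r
               \<longrightarrow> w s y \<ge> ereal (\<phi> s y))
           \<and> w t x = ereal (\<phi> t x) \<longrightarrow>
           (\<forall>i\<in>{1..N}. \<forall>a>0. x = a *\<^sub>R e i \<longrightarrow> \<phi>t t x + Ham (L i) (\<phi>x i t a) \<ge> 0)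
           \<and> (x = 0 \<longrightarrow> \<phi>t t 0 + Max ((\<lambda>i. Ham_minus (L i) (\<phi>x i t 0)) ` {1..N}) \<ge> 0)))
    \<and> (\<forall>x\<in>junction N e. w 0 x \<ge> ereal (u0 x))"

definition visc_solution :: "nat \<Rightarrow> (nat \<Rightarrow> pt) \<Rightarrow> (nat \<Rightarrow> real \<Rightarrow> real) \<Rightarrow> real \<Rightarrow> (pt \<Rightarrow> real)
    \<Rightarrow> (real \<Rightarrow> pt \<Rightarrow> real) \<Rightarrow> bool" where
  "visc_solution N e L T u0 u \<longleftrightarrow>
     visc_sub N e L T u0 (usc_env N e T u) \<and> visc_super N e L T u0 (lsc_env N e T u)"

end

theory Submission
  imports Defs
begin

text \<open>
  Call \<open>f\<close> dominated if \<open>f(t+h, a+qh) \<le> f(t, a) + h L\<^sub>i(q)\<close> along every straight line inside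
  a branch. The solution is the largest dominated function \<open>u\<close> lying below \<open>u\<^sub>0\<close> at time 0; by
  maximality it lies between \<open>u\<^sub>0 - Bt\<close> and \<open>u\<^sub>0 + Bt\<close>, and comparison with time shifts of itself makes
  it Lipschitz. Domination gives the sub-solution inequality by differentiating along backward lines;
  if the super-solution inequality failed at a point, \<open>u\<close> could be raised by a small cone there.

  Uniqueness needs no doubling of variables. Every sub-solution is dominated, because
  \<open>L\<^sub>i(q)(t-t\<^sub>0) + K(a-X(t))\<^sup>2 + \<sigma>/(T-t)\<close>, with \<open>X\<close> the line of velocity \<open>q\<close>, is a strict
  super-solution for every \<open>K\<close>; hence it is below \<open>u\<close>. Conversely, averaging \<open>u\<close> first in time over
  length \<open>\<delta>\<close> and then in space over length \<open>\<epsilon> \<ll> \<delta>\<close> gives \<open>C\<^sup>1\<close> functions which are sub-solutions up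
  to \<open>O(\<epsilon>/\<delta>)\<close>, even with the full \<open>H\<^sub>i\<close> at the vertex, and these may be used as test functions
  for any super-solution.
\<close>

section \<open>Dominated functions and the maximal one\<close>

text \<open>Doubling variables would pair a point at the vertex with one inside a branch and so
  compare two different Hamiltonians. Here a sub- or super-solution is only compared with explicit
  functions that are C^1 on every branch. Only lines with q \<le> 0 arrive at the vertex from inside
  a branch, so differentiating domination backwards yields \<open>Ham_minus\<close> there. Lines
  leaving the vertex escape the sub-solution test and are recovered from upper semicontinuity. The
  order of averaging matters: a time average takes the same value at the vertex on all branches, and
  its time derivative is Lipschitz in space with constant O(1/\<delta>), so a shift by \<epsilon> in
  space changes that derivative by O(\<epsilon>/\<delta>) only. For u itself no such control is
  available. The term \<sigma>/(T-t) keeps extrema away from the final time and supplies strictness.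
  The bound on |u - u_0|, with u_0 Lipschitz, makes the envelopes finite and helps to confine
  extrema to a compact set.\<close>

text \<open>(A1) enters through two consequences. Superlinear growth keeps the Hamiltonians finite
  and pays for fast lines. The affine minorant touching \<open>L i\<close> at 0 has a slope d at
  which the Hamiltonian attains its minimum \<open>- L i 0\<close>, a value that \<open>Ham\<close>
  and \<open>Ham_minus\<close> share there.\<close>

locale hj_junction =
  fixes N :: nat and e :: "nat \<Rightarrow> real \<times> real" and L :: "nat \<Rightarrow> real \<Rightarrow> real"
    and u0 :: "real \<times> real \<Rightarrow> real" and K0 :: real
  assumes N_ge: "N \<ge> 1"
    and norm_e: "i \<in> {1..N} \<Longrightarrow> norm (e i) = 1"
    and inj_e: "inj_on e {1..N}"
    and superlinear_ex: "i \<in> {1..N} \<Longrightarrow> \<exists>C. \<forall>q. M * \<bar>q\<bar> - C \<le> L i q"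
    and subgradient_ex: "i \<in> {1..N} \<Longrightarrow> \<exists>d. \<forall>q. L i 0 + d * q \<le> L i q"
    and K0_nonneg: "K0 \<ge> 0"
    and u0_lipschitz: "x \<in> junction N e \<Longrightarrow> y \<in> junction N e \<Longrightarrow> \<bar>u0 x - u0 y\<bar> \<le> K0 * jdist N e x y"
begin

\<comment> \<open>so that the index set \<open>{1..N}\<close> is not rewritten to \<open>{Suc 0..N}\<close>\<close>
declare One_nat_def [simp del]

section \<open>Coordinates and distance on the junction\<close>

abbreviation "J \<equiv> junction N e"
abbreviation "dJ \<equiv> jdist N e"

lemma in_branch: "a \<ge> 0 \<Longrightarrow> a *\<^sub>R e i \<in> branch e i"
  by (auto simp: branch_def)

lemma in_J: "i \<in> {1..N} \<Longrightarrow> a \<ge> 0 \<Longrightarrow> a *\<^sub>R e i \<in> J"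
  unfolding junction_def using in_branch by blast

lemma J_cases:
  assumes "x \<in> J"
  obtains i a where "i \<in> {1..N}" "a \<ge> 0" "x = a *\<^sub>R e i"
  using assms unfolding junction_def branch_def by auto

lemma one_mem: "1 \<in> {1..N}"
  using N_ge by simp

lemma norm_coord: "i \<in> {1..N} \<Longrightarrow> a \<ge> 0 \<Longrightarrow> norm (a *\<^sub>R e i) = a"
  by (simp add: norm_e)

lemma coord_unique:
  assumes "i \<in> {1..N}" "j \<in> {1..N}" "a \<ge> 0" "b \<ge> 0" "a *\<^sub>R e i = b *\<^sub>R e j"
  shows "a = b" and "a = 0 \<or> i = j"
proof -
  show ab: "a = b"
    using norm_coord[OF assms(1,3)] norm_coord[OF assms(2,4)] assms(5) by simp
  show "a = 0 \<or> i = j"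
    using ab assms inj_onD[OF inj_e] by auto
qed

lemma zero_in_J: "0 \<in> J"
  using in_J[OF one_mem, of 0] by simp

lemma jdist_same:
  assumes "i \<in> {1..N}" "a \<ge> 0" "b \<ge> 0"
  shows "dJ (a *\<^sub>R e i) (b *\<^sub>R e i) = \<bar>a - b\<bar>"
proof -
  have "norm (a *\<^sub>R e i - b *\<^sub>R e i) = \<bar>a - b\<bar>"
    by (simp add: scaleR_diff_left[symmetric] norm_e[OF assms(1)])
  then show ?thesis
    unfolding jdist_def using in_branch[OF assms(2), of i] in_branch[OF assms(3), of i] assms(1)
    by (auto split: if_splits)
qed

lemma jdist_other:
  assumes "i \<in> {1..N}" "j \<in> {1..N}" "i \<noteq> j" "a \<ge> 0" "b \<ge> 0"
  shows "dJ (a *\<^sub>R e i) (b *\<^sub>R e j) = a + b"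
proof (cases "\<exists>k\<in>{1..N}. a *\<^sub>R e i \<in> branch e k \<and> b *\<^sub>R e j \<in> branch e k")
  case True
  then obtain k c d where k: "k \<in> {1..N}" "c \<ge> 0" "d \<ge> 0" "a *\<^sub>R e i = c *\<^sub>R e k" "b *\<^sub>R e j = d *\<^sub>R e k"
    unfolding branch_def by auto
  have "a = 0 \<or> b = 0"
    using coord_unique[OF assms(1) k(1) assms(4) k(2,4)] coord_unique[OF assms(2) k(1) assms(5) k(3,5)]
      assms(3) by auto
  moreover have "dJ (a *\<^sub>R e i) (b *\<^sub>R e j) = norm (a *\<^sub>R e i - b *\<^sub>R e j)"
    using True by (simp add: jdist_def)
  ultimately show ?thesis
    using assms norm_coord by auto
next
  case False
  then show ?thesis
    using norm_coord[OF assms(1,4)] norm_coord[OF assms(2,5)] by (simp only: jdist_def if_False)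
qed

lemma jdist_refl: "x \<in> J \<Longrightarrow> dJ x x = 0"
  by (erule J_cases) (simp add: jdist_same)

lemma jdist_nonneg: "dJ x y \<ge> 0"
  by (simp add: jdist_def)

lemma jdist_zero:
  assumes "i \<in> {1..N}" "a \<ge> 0"
  shows "dJ 0 (a *\<^sub>R e i) = a" and "dJ (a *\<^sub>R e i) 0 = a"
  using jdist_same[OF assms(1), of 0 a] jdist_same[OF assms(1), of a 0] assms by auto

text \<open>Away from the vertex the branch index is unique. At the vertex the choice is arbitrary,
  so the value is meaningful only if all \<open>g j 0\<close> agree.\<close>

definition glue_branches :: "(nat \<Rightarrow> real \<Rightarrow> real) \<Rightarrow> real \<times> real \<Rightarrow> real" where
  "glue_branches g y = g (SOME i. i \<in> {1..N} \<and> y = norm y *\<^sub>R e i) (norm y)"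

lemma glue_branches_coord:
  assumes "i \<in> {1..N}" "a \<ge> 0" "\<And>j. j \<in> {1..N} \<Longrightarrow> g j 0 = g 1 0"
  shows "glue_branches g (a *\<^sub>R e i) = g i a"
proof -
  define j where "j = (SOME j. j \<in> {1..N} \<and> a *\<^sub>R e i = norm (a *\<^sub>R e i) *\<^sub>R e j)"
  have "j \<in> {1..N} \<and> a *\<^sub>R e i = norm (a *\<^sub>R e i) *\<^sub>R e j"
    unfolding j_def by (rule someI[of _ i]) (use assms norm_coord in simp)
  then have j: "j \<in> {1..N}" "a *\<^sub>R e i = a *\<^sub>R e j"
    unfolding norm_coord[OF assms(1,2)] by auto
  have "glue_branches g (a *\<^sub>R e i) = g j a"
    unfolding glue_branches_def j_def[symmetric] using norm_coord[OF assms(1,2)] by simp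
  then show ?thesis
    using coord_unique(2)[OF assms(1) j(1) assms(2,2) j(2)] assms(3)[OF assms(1)] assms(3)[OF j(1)]
    by auto
qed

section \<open>Growth of the Lagrangians and bounds on the Hamiltonians\<close>

lemma finite_choice_bound:
  assumes "\<And>i. i \<in> {1..N} \<Longrightarrow> \<exists>C. P i C"
    and "\<And>i C D. P i C \<Longrightarrow> C \<le> D \<Longrightarrow> P i D"
  obtains C :: real where "C \<ge> 0" "\<And>i. i \<in> {1..N} \<Longrightarrow> P i C"
proof -
  obtain c where c: "\<And>i. i \<in> {1..N} \<Longrightarrow> P i (c i)"
    using assms(1) by metis
  have "c i \<le> (\<Sum>i\<in>{1..N}. \<bar>c i\<bar>)" if "i \<in> {1..N}" for i
    using member_le_sum[OF that, of "\<lambda>i. \<bar>c i\<bar>"] by simp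
  then have "P i (\<Sum>i\<in>{1..N}. \<bar>c i\<bar>)" if "i \<in> {1..N}" for i
    using c assms(2) that by blast
  then show ?thesis
    using that[of "\<Sum>i\<in>{1..N}. \<bar>c i\<bar>"] by (simp add: sum_nonneg)
qed

lemma superlinear:
  obtains C where "C \<ge> 0" "\<And>i q. i \<in> {1..N} \<Longrightarrow> M * \<bar>q\<bar> - C \<le> L i q"
proof (rule finite_choice_bound[where P = "\<lambda>i C. \<forall>q. M * \<bar>q\<bar> - C \<le> L i q"])
  show "\<exists>C. \<forall>q. M * \<bar>q\<bar> - C \<le> L i q" if "i \<in> {1..N}" for i
    using superlinear_ex[OF that] .
  show "\<forall>q. M * \<bar>q\<bar> - D \<le> L i q" if "\<forall>q. M * \<bar>q\<bar> - C \<le> L i q" "C \<le> D" for i C D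
  proof
    fix q
    show "M * \<bar>q\<bar> - D \<le> L i q"
      using that(1)[rule_format, of q] that(2) by linarith
  qed
qed (use that in blast)

lemma Ham_bdd:
  assumes "i \<in> {1..N}"
  shows "bdd_above (range (\<lambda>q. p * q - L i q))"
proof -
  obtain C where "\<And>q. \<bar>p\<bar> * \<bar>q\<bar> - C \<le> L i q"
    using superlinear_ex[OF assms] by blast
  moreover have "p * q \<le> \<bar>p\<bar> * \<bar>q\<bar>" for q
    by (metis abs_ge_self abs_mult)
  ultimately have "p * q - L i q \<le> C" for q
    by (smt (verit))
  then show ?thesis
    by (intro bdd_aboveI[of _ C]) auto
qed

lemma Ham_ge: "i \<in> {1..N} \<Longrightarrow> p * q - L i q \<le> Ham (L i) p"
  unfolding Ham_def by (intro cSup_upper Ham_bdd) auto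

lemma Ham_le: "(\<And>q. p * q - L i q \<le> c) \<Longrightarrow> Ham (L i) p \<le> c"
  unfolding Ham_def by (intro cSup_least) auto

lemma Ham_minus_ge:
  assumes "i \<in> {1..N}" "q \<le> 0"
  shows "p * q - L i q \<le> Ham_minus (L i) p"
  unfolding Ham_minus_def
  by (intro cSup_upper bdd_above_mono[OF Ham_bdd[OF assms(1)]]) (use assms in auto)

lemma Ham_minus_le: "(\<And>q. q \<le> 0 \<Longrightarrow> p * q - L i q \<le> c) \<Longrightarrow> Ham_minus (L i) p \<le> c"
  unfolding Ham_minus_def by (intro cSup_least) auto

section \<open>Domination along straight lines: gluing and localisation\<close>

text \<open>\<open>h * L i q\<close> is the action of the path of constant velocity q, so this is
  the easy half of the dynamic programming principle. The time set S is a parameter so that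
  functions living on consecutive intervals can be glued.\<close>

definition dominated :: "real set \<Rightarrow> (real \<Rightarrow> real \<times> real \<Rightarrow> real) \<Rightarrow> bool" where
  "dominated S f \<longleftrightarrow> (\<forall>i\<in>{1..N}. \<forall>t\<in>S. \<forall>h\<ge>0. \<forall>a\<ge>0. \<forall>q. t + h \<in> S \<and> 0 \<le> a + q * h \<longrightarrow>
      f (t + h) ((a + q * h) *\<^sub>R e i) \<le> f t (a *\<^sub>R e i) + h * L i q)"

lemma dominatedD:
  "dominated S f \<Longrightarrow> i \<in> {1..N} \<Longrightarrow> t \<in> S \<Longrightarrow> t + h \<in> S \<Longrightarrow> h \<ge> 0 \<Longrightarrow> a \<ge> 0 \<Longrightarrow> 0 \<le> a + q * h \<Longrightarrow>
    f (t + h) ((a + q * h) *\<^sub>R e i) \<le> f t (a *\<^sub>R e i) + h * L i q"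
  unfolding dominated_def by blast

lemma line_nonneg:
  fixes a q h k :: real
  assumes "a \<ge> 0" "0 \<le> a + q * h" "0 \<le> k" "k \<le> h"
  shows "0 \<le> a + q * k"
proof (cases "q \<ge> 0")
  case True
  then show ?thesis using assms by simp
next
  case False
  then have "q * h \<le> q * k"
    using assms by (simp add: mult_left_mono_neg)
  then show ?thesis using assms by linarith
qed

text \<open>A line crossing time r is cut there; both pieces keep the velocity q, so their actions
  add up. A downward jump at r does no harm.\<close>

lemma dominated_glue:
  assumes f: "dominated {0..r} f" and g: "dominated {r..} g" and r: "r \<ge> 0"
    and le: "\<And>x. x \<in> J \<Longrightarrow> g r x \<le> f r x"
  shows "dominated {0..} (\<lambda>t. if t < r then f t else g t)"
  unfolding dominated_def
proof (intro ballI allI impI, elim conjE)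
  fix i t h a q
  assume i: "i \<in> {1..N}" and t: "(t::real) \<in> {0..}" and h: "(h::real) \<ge> 0" and a: "a \<ge> 0"
    and aq: "0 \<le> a + q * h"
  consider "t + h < r" | "t < r" "r \<le> t + h" | "r \<le> t" by linarith
  then show "(if t + h < r then f (t + h) else g (t + h)) ((a + q * h) *\<^sub>R e i)
      \<le> (if t < r then f t else g t) (a *\<^sub>R e i) + h * L i q"
  proof cases
    case 1
    then show ?thesis using dominatedD[OF f i _ _ h a aq, of t] t h by auto
  next
    case 2
    define k where "k = r - t"
    have k: "0 \<le> k" "k \<le> h" using 2 by (auto simp: k_def)
    have ak: "0 \<le> a + q * k" by (rule line_nonneg[OF a aq k])
    have 1: "f r ((a + q * k) *\<^sub>R e i) \<le> f t (a *\<^sub>R e i) + k * L i q"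
      using dominatedD[OF f i, of t k a q] t k ak a r by (simp add: k_def)
    have eq: "a + q * h = (a + q * k) + q * (h - k)" by (simp add: algebra_simps)
    have 2: "g (t + h) ((a + q * h) *\<^sub>R e i) \<le> g r ((a + q * k) *\<^sub>R e i) + (h - k) * L i q"
    proof -
      have th: "t + h = r + (h - k)" by (simp add: k_def)
      show ?thesis
        unfolding th eq by (rule dominatedD[OF g i]) (use k ak aq eq in auto)
    qed
    have 3: "k * L i q + (h - k) * L i q = h * L i q" by (simp add: algebra_simps)
    show ?thesis
      using 1 2 3 le[OF in_J[OF i ak]] \<open>t < r\<close> \<open>r \<le> t + h\<close> by simp
  next
    case 3
    then show ?thesis using dominatedD[OF g i _ _ h a aq, of t] h by auto
  qed
qed

text \<open>Cutting a line into equal pieces of the same velocity reduces domination to lines of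
  small space-time length. This lets a local modification be checked inside a small ball.\<close>

lemma dominated_short_steps:
  assumes r: "r > 0"
    and step: "\<And>i t h a q. i \<in> {1..N} \<Longrightarrow> t \<ge> 0 \<Longrightarrow> h \<ge> 0 \<Longrightarrow> a \<ge> 0 \<Longrightarrow> 0 \<le> a + q * h \<Longrightarrow>
      h + \<bar>q\<bar> * h < r \<Longrightarrow> f (t + h) ((a + q * h) *\<^sub>R e i) \<le> f t (a *\<^sub>R e i) + h * L i q"
  shows "dominated {0..} f"
  unfolding dominated_def
proof (intro ballI allI impI, elim conjE)
  fix i t h a q
  assume i: "i \<in> {1..N}" and t: "(t::real) \<in> {0..}" and h: "(h::real) \<ge> 0" and a: "a \<ge> 0"
    and aq: "0 \<le> a + q * h"
  obtain n :: nat where n: "real n > (h + \<bar>q\<bar> * h) / r" using reals_Archimedean2 by blast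
  have n0: "real n > 0"
    using n h r by (smt (verit) divide_nonneg_pos mult_nonneg_nonneg)
  define k where "k = h / real n"
  have k: "0 \<le> k" "real n * k = h" using h n0 by (auto simp: k_def)
  have kr: "k + \<bar>q\<bar> * k < r"
  proof -
    have "h + \<bar>q\<bar> * h < r * real n" using n r by (simp add: divide_simps mult.commute)
    then have "(h + \<bar>q\<bar> * h) / real n < r" using n0 by (simp add: divide_simps)
    then show ?thesis by (simp add: k_def add_divide_distrib)
  qed
  have pos: "0 \<le> a + q * (real m * k)" if "m \<le> n" for m
    using line_nonneg[OF a aq, of "real m * k"] that k
    by (metis mult_right_mono mult_nonneg_nonneg of_nat_0_le_iff of_nat_le_iff)
  have "m \<le> n \<Longrightarrow> f (t + real m * k) ((a + q * (real m * k)) *\<^sub>R e i) \<le> f t (a *\<^sub>R e i) + real m * k * L i q" for m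
  proof (induction m)
    case (Suc m)
    have eq: "a + q * (real (Suc m) * k) = (a + q * (real m * k)) + q * k"
      "t + real (Suc m) * k = (t + real m * k) + k"
      by (auto simp: algebra_simps)
    have "f (t + real (Suc m) * k) ((a + q * (real (Suc m) * k)) *\<^sub>R e i)
        \<le> f (t + real m * k) ((a + q * (real m * k)) *\<^sub>R e i) + k * L i q"
      unfolding eq
      by (rule step) (use i t k kr pos[of m] pos[OF Suc.prems] eq Suc.prems in auto)
    with Suc show ?case by (simp add: algebra_simps)
  qed simp
  from this[of n] show "f (t + h) ((a + q * h) *\<^sub>R e i) \<le> f t (a *\<^sub>R e i) + h * L i q"
    by (simp add: k)
qed

section \<open>The maximal candidate and its bounds\<close>

definition candidate :: "(real \<Rightarrow> real \<times> real \<Rightarrow> real) \<Rightarrow> bool" where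
  "candidate f \<longleftrightarrow> dominated {0..} f \<and> (\<forall>x\<in>J. f 0 x \<le> u0 x)"

text \<open>A supremum of candidates takes the place of the infimum of the action over trajectories,
  so no path space is needed. The real \<open>Sup\<close> is genuine because
  \<open>candidate_le_u0\<close> bounds the set above and \<open>candidate_affine\<close> shows it
  nonempty.\<close>

definition val :: "real \<Rightarrow> real \<times> real \<Rightarrow> real" where
  "val t x = Sup {f t x | f. candidate f}"

text \<open>One constant for all crude estimates: the growth bound makes
  \<open>u0 x - rate * t\<close> dominated, \<open>L i 0\<close> is the price of standing still, and
  the values at 1 and -1 are the price of walking at unit speed.\<close>

definition rate :: real where
  "rate = (SOME B. B \<ge> 0 \<and> (\<forall>i\<in>{1..N}. (\<forall>q. K0 * \<bar>q\<bar> - B \<le> L i q)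
      \<and> L i 0 \<le> B \<and> L i 1 \<le> B \<and> L i (-1) \<le> B))"

lemma rate_props:
  shows rate_nonneg: "rate \<ge> 0"
    and rate_superlinear: "i \<in> {1..N} \<Longrightarrow> K0 * \<bar>q\<bar> - rate \<le> L i q"
    and rate_bounds: "i \<in> {1..N} \<Longrightarrow> L i 0 \<le> rate" "i \<in> {1..N} \<Longrightarrow> L i 1 \<le> rate"
      "i \<in> {1..N} \<Longrightarrow> L i (-1) \<le> rate"
proof -
  obtain C where C: "C \<ge> 0" "\<And>i q. i \<in> {1..N} \<Longrightarrow> K0 * \<bar>q\<bar> - C \<le> L i q"
    using superlinear by blast
  obtain D where D: "D \<ge> 0" "\<And>i. i \<in> {1..N} \<Longrightarrow> L i 0 \<le> D \<and> L i 1 \<le> D \<and> L i (-1) \<le> D"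
  proof (rule finite_choice_bound[where P = "\<lambda>i D. L i 0 \<le> D \<and> L i 1 \<le> D \<and> L i (-1) \<le> D"])
    show "\<exists>D. L i 0 \<le> D \<and> L i 1 \<le> D \<and> L i (-1) \<le> D" for i
      by (rule exI[of _ "max (L i 0) (max (L i 1) (L i (-1)))"]) auto
  qed (use that in auto)
  have "\<exists>B. B \<ge> 0 \<and> (\<forall>i\<in>{1..N}. (\<forall>q. K0 * \<bar>q\<bar> - B \<le> L i q) \<and> L i 0 \<le> B \<and> L i 1 \<le> B \<and> L i (-1) \<le> B)"
  proof (intro exI[of _ "max C D"] conjI ballI allI)
    fix i q assume i: "i \<in> {1..N}"
    show "K0 * \<bar>q\<bar> - max C D \<le> L i q" using C(2)[OF i, of q] by linarith
    show "L i 0 \<le> max C D" "L i 1 \<le> max C D" "L i (-1) \<le> max C D" using D(2)[OF i] by auto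
  qed (use C in simp)
  from someI_ex[OF this, folded rate_def]
  show "rate \<ge> 0" "i \<in> {1..N} \<Longrightarrow> K0 * \<bar>q\<bar> - rate \<le> L i q"
    "i \<in> {1..N} \<Longrightarrow> L i 0 \<le> rate" "i \<in> {1..N} \<Longrightarrow> L i 1 \<le> rate" "i \<in> {1..N} \<Longrightarrow> L i (-1) \<le> rate"
    by auto
qed

text \<open>A move by \<open>q * h\<close> changes \<open>u0\<close> by at most
  \<open>K0 * \<bar>q\<bar> * h\<close>, which \<open>rate_superlinear\<close> pays for. The free
  constant c is for continuing other functions past a given time.\<close>

lemma dominated_affine: "dominated S (\<lambda>t x. u0 x - rate * t - c)"
  unfolding dominated_def
proof (intro ballI allI impI, elim conjE)
  fix i t h a q
  assume i: "i \<in> {1..N}" and h: "(h::real) \<ge> 0" and a: "a \<ge> 0" and aq: "0 \<le> a + q * h"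
  have "u0 ((a + q * h) *\<^sub>R e i) - u0 (a *\<^sub>R e i) \<le> K0 * \<bar>q * h\<bar>"
    using u0_lipschitz[OF in_J[OF i aq] in_J[OF i a]] jdist_same[OF i aq a] by simp
  also have "\<dots> = h * (K0 * \<bar>q\<bar> - rate) + rate * h"
    using h by (simp add: abs_mult algebra_simps)
  also have "\<dots> \<le> h * L i q + rate * h"
    using rate_superlinear[OF i, of q] h by (simp add: mult_left_mono)
  finally show "u0 ((a + q * h) *\<^sub>R e i) - rate * (t + h) - c \<le> u0 (a *\<^sub>R e i) - rate * t - c + h * L i q"
    by (simp add: algebra_simps)
qed

lemma candidate_affine: "candidate (\<lambda>t x. u0 x - rate * t)"
  unfolding candidate_def using dominated_affine[of _ 0] by auto

lemma candidate_le_u0: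
  assumes "candidate f" "t \<ge> 0" "x \<in> J"
  shows "f t x \<le> u0 x + rate * t"
proof -
  obtain i a where x: "i \<in> {1..N}" "a \<ge> 0" "x = a *\<^sub>R e i"
    using assms(3) by (rule J_cases)
  have "f t x \<le> f 0 x + t * L i 0"
    using dominatedD[of "{0..}" f i 0 t a 0] assms x unfolding candidate_def by auto
  also have "\<dots> \<le> u0 x + t * rate"
    using assms rate_bounds(1)[OF x(1)] unfolding candidate_def
    by (intro add_mono mult_left_mono) auto
  finally show ?thesis by (simp add: mult.commute)
qed

lemma candidate_le_val:
  assumes "candidate f" "t \<ge> 0" "x \<in> J"
  shows "f t x \<le> val t x"
  unfolding val_def
  by (rule cSup_upper)
    (use assms candidate_le_u0[OF _ assms(2,3)] in \<open>auto intro!: bdd_aboveI[of _ "u0 x + rate * t"]\<close>)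

lemma val_le:
  assumes "\<And>f. candidate f \<Longrightarrow> f t x \<le> c"
  shows "val t x \<le> c"
  unfolding val_def by (rule cSup_least) (use candidate_affine assms in auto)

lemma val_bounds:
  assumes "t \<ge> 0" "x \<in> J"
  shows "val t x \<le> u0 x + rate * t" "u0 x - rate * t \<le> val t x"
  using val_le[of t x] candidate_le_u0[OF _ assms] candidate_le_val[OF candidate_affine assms] by auto

lemma val_initial: "x \<in> J \<Longrightarrow> val 0 x = u0 x"
  using val_bounds[of 0 x] by simp

lemma dominated_val: "dominated {0..} val"
  unfolding dominated_def
proof (intro ballI allI impI, elim conjE)
  fix i t h a q
  assume *: "i \<in> {1..N}" "t \<in> {0..}" "(h::real) \<ge> 0" "a \<ge> 0" "0 \<le> a + q * h" "t + h \<in> {0..}"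
  show "val (t + h) ((a + q * h) *\<^sub>R e i) \<le> val t (a *\<^sub>R e i) + h * L i q"
  proof (rule val_le)
    fix f assume f: "candidate f"
    have "f (t + h) ((a + q * h) *\<^sub>R e i) \<le> f t (a *\<^sub>R e i) + h * L i q"
      using f * dominatedD[of "{0..}" f i t h a q] unfolding candidate_def by auto
    also have "\<dots> \<le> val t (a *\<^sub>R e i) + h * L i q"
      using candidate_le_val[OF f _ in_J] * by auto
    finally show "f (t + h) ((a + q * h) *\<^sub>R e i) \<le> val t (a *\<^sub>R e i) + h * L i q" .
  qed
qed

section \<open>Lipschitz regularity of the maximal candidate\<close>

text \<open>Start with \<open>u0 x - rate * r\<close> up to time s and continue with
  \<open>val\<close> delayed by s and lowered by \<open>rate * s\<close>: the two match at time s,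
  so the result is a candidate, and maximality gives the bound.\<close>

lemma val_time_lower:
  assumes "t \<ge> 0" "s \<ge> 0" "x \<in> J"
  shows "val t x - rate * s \<le> val (t + s) x"
proof -
  have 1: "dominated {s..} (\<lambda>r x. val (r - s) x - rate * s)"
    unfolding dominated_def
  proof (intro ballI allI impI, elim conjE)
    fix i t h a q
    assume *: "i \<in> {1..N}" "t \<in> {s..}" "(h::real) \<ge> 0" "a \<ge> 0" "0 \<le> a + q * h"
    show "val (t + h - s) ((a + q * h) *\<^sub>R e i) - rate * s \<le> val (t - s) (a *\<^sub>R e i) - rate * s + h * L i q"
      using dominatedD[OF dominated_val *(1), of "t - s" h a q] * by (simp add: algebra_simps)
  qed
  have "dominated {0..} (\<lambda>r. if r < s then (\<lambda>x. u0 x - rate * r) else (\<lambda>x. val (r - s) x - rate * s))"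
    by (rule dominated_glue[OF _ 1]) (use dominated_affine[of _ 0] assms val_initial in auto)
  then have "candidate (\<lambda>r. if r < s then (\<lambda>x. u0 x - rate * r) else (\<lambda>x. val (r - s) x - rate * s))"
    unfolding candidate_def using val_initial assms(2) by auto
  from candidate_le_val[OF this, of "t + s" x] assms show ?thesis by simp
qed

lemma val_time_upper:
  assumes "t \<ge> 0" "s \<ge> 0" "x \<in> J"
  shows "val (t + s) x \<le> val t x + rate * s"
proof -
  obtain i a where x: "i \<in> {1..N}" "a \<ge> 0" "x = a *\<^sub>R e i"
    using assms(3) by (rule J_cases)
  have "val (t + s) x \<le> val t x + s * L i 0"
    using dominatedD[OF dominated_val x(1), of t s a 0] assms x by simp
  also have "s * L i 0 \<le> rate * s"
    using rate_bounds(1)[OF x(1)] assms by (simp add: mult.commute mult_left_mono)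
  finally show ?thesis by simp
qed

lemma val_time_lipschitz:
  assumes "t \<ge> 0" "s \<ge> 0" "x \<in> J"
  shows "\<bar>val t x - val s x\<bar> \<le> rate * \<bar>t - s\<bar>"
proof (cases "s \<le> t")
  case True
  then show ?thesis
    using val_time_lower[of s "t - s" x] val_time_upper[of s "t - s" x] assms by simp
next
  case False
  then show ?thesis
    using val_time_lower[of t "s - t" x] val_time_upper[of t "s - t" x] assms by simp
qed

definition lip :: real where "lip = 2 * rate + K0"

lemma lip_nonneg: "lip \<ge> 0" and rate_le_lip: "rate \<le> lip"
  using rate_nonneg K0_nonneg by (auto simp: lip_def)

text \<open>If |a - b| \<le> t, go back in time by |a - b| and walk from a to b at unit speed; going
  back and walking cost \<open>rate\<close> each per unit. Otherwise t is smaller than |a - b| and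
  both values are still within \<open>rate * t\<close> of \<open>u0\<close>. Hence
  \<open>lip\<close> is \<open>2 * rate + K0\<close>.\<close>

lemma val_branch_upper:
  assumes "i \<in> {1..N}" "a \<ge> 0" "b \<ge> 0" "t \<ge> 0"
  shows "val t (b *\<^sub>R e i) \<le> val t (a *\<^sub>R e i) + lip * \<bar>a - b\<bar>"
proof -
  define h where "h = \<bar>a - b\<bar>"
  have h: "h \<ge> 0" by (simp add: h_def)
  show ?thesis
  proof (cases "h \<le> t")
    case True
    obtain q where q: "b = a + q * h" "q = 1 \<or> q = -1"
      using that[of 1] that[of "-1"] by (cases "a \<le> b") (auto simp: h_def)
    have "val t (b *\<^sub>R e i) \<le> val (t - h) (a *\<^sub>R e i) + h * L i q"
      using dominatedD[OF dominated_val assms(1), of "t - h" h a q] True h assms q(1) by simp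
    also have "\<dots> \<le> val t (a *\<^sub>R e i) + rate * h + h * rate"
    proof -
      have "h * L i q \<le> h * rate"
        using q(2) rate_bounds(2,3)[OF assms(1)] h by (intro mult_left_mono) auto
      moreover have "val (t - h) (a *\<^sub>R e i) \<le> val t (a *\<^sub>R e i) + rate * h"
        using val_time_lower[of "t - h" h, OF _ h in_J[OF assms(1,2)]] True by simp
      ultimately show ?thesis by linarith
    qed
    also have "\<dots> \<le> val t (a *\<^sub>R e i) + lip * h"
      using K0_nonneg h by (simp add: lip_def algebra_simps)
    finally show ?thesis by (simp add: h_def)
  next
    case False
    have "val t (b *\<^sub>R e i) \<le> u0 (b *\<^sub>R e i) + rate * t"
      using val_bounds(1)[OF assms(4) in_J[OF assms(1,3)]] .
    also have "u0 (b *\<^sub>R e i) \<le> u0 (a *\<^sub>R e i) + K0 * h"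
      using u0_lipschitz[OF in_J[OF assms(1,3)] in_J[OF assms(1,2)]] jdist_same[OF assms(1,3,2)]
      by (simp add: h_def abs_minus_commute)
    also have "u0 (a *\<^sub>R e i) \<le> val t (a *\<^sub>R e i) + rate * t"
      using val_bounds(2)[OF assms(4) in_J[OF assms(1,2)]] by simp
    finally have "val t (b *\<^sub>R e i) \<le> val t (a *\<^sub>R e i) + 2 * (rate * t) + K0 * h" by (simp add: mult.commute)
    moreover have "rate * t \<le> rate * h"
      using False rate_nonneg by (intro mult_left_mono) auto
    ultimately show ?thesis
      by (simp add: h_def[symmetric] lip_def algebra_simps)
  qed
qed

lemma val_branch_lipschitz:
  assumes "i \<in> {1..N}" "a \<ge> 0" "b \<ge> 0" "t \<ge> 0"
  shows "\<bar>val t (a *\<^sub>R e i) - val t (b *\<^sub>R e i)\<bar> \<le> lip * \<bar>a - b\<bar>"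
  using val_branch_upper[OF assms] val_branch_upper[OF assms(1,3,2,4)] by (simp add: abs_minus_commute)

lemma val_lipschitz:
  assumes "t \<ge> 0" "s \<ge> 0" "x \<in> J" "y \<in> J"
  shows "\<bar>val t x - val s y\<bar> \<le> lip * (\<bar>t - s\<bar> + dJ x y)"
proof -
  obtain i a where x: "i \<in> {1..N}" "a \<ge> 0" "x = a *\<^sub>R e i"
    using assms(3) by (rule J_cases)
  obtain j b where y: "j \<in> {1..N}" "b \<ge> 0" "y = b *\<^sub>R e j"
    using assms(4) by (rule J_cases)
  have sp: "\<bar>val s x - val s y\<bar> \<le> lip * dJ x y"
  proof (cases "i = j")
    case True
    then show ?thesis
      using val_branch_lipschitz[OF x(1,2) y(2) assms(2)] jdist_same[OF x(1,2) y(2)] x y by simp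
  next
    case False
    have "\<bar>val s x - val s 0\<bar> \<le> lip * a" "\<bar>val s y - val s 0\<bar> \<le> lip * b"
      using val_branch_lipschitz[OF x(1,2) order_refl assms(2)]
        val_branch_lipschitz[OF y(1,2) order_refl assms(2)] x y by auto
    then show ?thesis
      using jdist_other[OF x(1) y(1) False x(2) y(2)] x y by (simp add: algebra_simps)
  qed
  have "rate * \<bar>t - s\<bar> \<le> lip * \<bar>t - s\<bar>"
    using rate_le_lip by (intro mult_right_mono) auto
  then show ?thesis
    using val_time_lipschitz[OF assms(1,2,3)] sp by (simp add: algebra_simps)
qed

end

section \<open>The maximal dominated function is a solution\<close>

lemma has_derivative_approx:
  fixes F :: "real \<times> real \<Rightarrow> real"
  assumes "(F has_derivative (\<lambda>(ds, db). ds * \<alpha> + db * \<beta>)) (at (t, a) within S)" "\<kappa> > 0"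
  obtains \<rho> where "\<rho> > 0" "\<And>s b. (s, b) \<in> S \<Longrightarrow> \<bar>s - t\<bar> + \<bar>b - a\<bar> < \<rho> \<Longrightarrow>
    \<bar>F (s, b) - F (t, a) - ((s - t) * \<alpha> + (b - a) * \<beta>)\<bar> \<le> \<kappa> * (\<bar>s - t\<bar> + \<bar>b - a\<bar>)"
proof -
  obtain \<rho> where \<rho>: "\<rho> > 0" "\<And>y. y \<in> S \<Longrightarrow> norm (y - (t, a)) < \<rho> \<Longrightarrow>
      norm (F y - F (t, a) - (\<lambda>(ds, db). ds * \<alpha> + db * \<beta>) (y - (t, a))) \<le> \<kappa> * norm (y - (t, a))"
    using assms unfolding has_derivative_within_alt by blast
  show ?thesis
  proof (rule that[OF \<rho>(1)])
    fix s b assume sb: "(s, b) \<in> S" "\<bar>s - t\<bar> + \<bar>b - a\<bar> < \<rho>"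
    have n: "norm ((s, b) - (t, a)) \<le> \<bar>s - t\<bar> + \<bar>b - a\<bar>"
      using norm_Pair_le[of "s - t" "b - a"] by simp
    have "norm (F (s, b) - F (t, a) - ((s - t) * \<alpha> + (b - a) * \<beta>)) \<le> \<kappa> * norm ((s, b) - (t, a))"
      using \<rho>(2)[OF sb(1)] n sb(2) by simp
    also have "\<dots> \<le> \<kappa> * (\<bar>s - t\<bar> + \<bar>b - a\<bar>)"
      using n assms(2) by (intro mult_left_mono) auto
    finally show "\<bar>F (s, b) - F (t, a) - ((s - t) * \<alpha> + (b - a) * \<beta>)\<bar> \<le> \<kappa> * (\<bar>s - t\<bar> + \<bar>b - a\<bar>)"
      by simp
  qed
qed

section \<open>First-order tests along backward lines\<close>

text \<open>The condition on a and q says exactly that the backward point \<open>a - q * h\<close>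
  stays in the branch for small h; dividing the increment by h and letting h shrink gives the claim.
  At the vertex this leaves only q \<le> 0, the range of \<open>Ham_minus\<close>.\<close>

lemma backward_derivative_le:
  fixes F :: "real \<times> real \<Rightarrow> real"
  assumes D: "(F has_derivative (\<lambda>(ds, db). ds * \<alpha> + db * \<beta>)) (at (t, a) within {0<..<T} \<times> {0..})"
    and t: "t \<in> {0<..<T}" and a: "a \<ge> 0" "a > 0 \<or> q \<le> 0" and r: "r > 0"
    and le: "\<And>h. 0 < h \<Longrightarrow> h < t \<Longrightarrow> 0 \<le> a - q * h \<Longrightarrow> h + \<bar>q\<bar> * h < r \<Longrightarrow>
      F (t, a) \<le> F (t - h, a - q * h) + h * c"
  shows "\<alpha> + q * \<beta> \<le> c"
proof (rule ccontr)
  assume "\<not> \<alpha> + q * \<beta> \<le> c"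
  define \<eta> where "\<eta> = \<alpha> + q * \<beta> - c"
  have \<eta>: "\<eta> > 0" using \<open>\<not> \<alpha> + q * \<beta> \<le> c\<close> by (simp add: \<eta>_def)
  \<comment> \<open>A step of duration h has length \<open>h * (1 + \<bar>q\<bar>)\<close>, so the
    linearization error is at most half of the excess \<open>h * \<eta>\<close>.\<close>
  define \<kappa> where "\<kappa> = \<eta> / (2 * (1 + \<bar>q\<bar>))"
  have \<kappa>: "\<kappa> > 0" "\<kappa> * (1 + \<bar>q\<bar>) = \<eta> / 2"
    using \<eta> by (auto simp: \<kappa>_def add_pos_nonneg field_simps)
  obtain \<rho> where \<rho>: "\<rho> > 0" "\<And>s b. (s, b) \<in> {0<..<T} \<times> {0..} \<Longrightarrow> \<bar>s - t\<bar> + \<bar>b - a\<bar> < \<rho> \<Longrightarrow>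
    \<bar>F (s, b) - F (t, a) - ((s - t) * \<alpha> + (b - a) * \<beta>)\<bar> \<le> \<kappa> * (\<bar>s - t\<bar> + \<bar>b - a\<bar>)"
    using has_derivative_approx[OF D \<kappa>(1)] by blast
  \<comment> \<open>Steps shorter than m stay in the differentiability and test neighbourhoods, at
    positive times, and off the vertex if a > 0.\<close>
  define m where "m = min (min \<rho> r) (min t (if a > 0 then a else 1))"
  have m: "m > 0" "m \<le> \<rho>" "m \<le> r" "m \<le> t" "a > 0 \<Longrightarrow> m \<le> a"
    using \<rho>(1) r t by (auto simp: m_def)
  define h where "h = m / (2 * (1 + \<bar>q\<bar>))"
  have h0: "h > 0" using m(1) by (simp add: h_def add_pos_nonneg)
  have hm: "h + \<bar>q\<bar> * h < m"
  proof -
    have "(1 + \<bar>q\<bar>) * h = m / 2"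
      by (simp add: h_def add_pos_nonneg field_simps)
    then show ?thesis using m(1) by (simp add: algebra_simps)
  qed
  have qh: "\<bar>q * h\<bar> = \<bar>q\<bar> * h" using h0 by (simp add: abs_mult)
  have pos: "0 \<le> a - q * h"
  proof (cases "a > 0")
    case True
    then show ?thesis using hm m(5) qh h0 by linarith
  next
    case False
    then have "q * h \<le> 0" using a h0 by (simp add: mult_nonpos_nonneg)
    then show ?thesis using a by linarith
  qed
  have "\<bar>q\<bar> * h \<ge> 0" using h0 by simp
  then have ht: "h < t" using hm m by linarith
  have "F (t, a) \<le> F (t - h, a - q * h) + h * c"
    by (rule le) (use h0 pos hm m ht in auto)
  moreover have "\<bar>F (t - h, a - q * h) - F (t, a) - ((- h) * \<alpha> + (- (q * h)) * \<beta>)\<bar> \<le> \<kappa> * (h + \<bar>q\<bar> * h)"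
    using \<rho>(2)[of "t - h" "a - q * h"] pos ht t h0 hm m qh by (auto simp: abs_minus_commute)
  moreover have "\<kappa> * (h + \<bar>q\<bar> * h) = h * (\<eta> / 2)"
    using \<kappa>(2) by (metis distrib_left mult.commute mult.left_commute mult.right_neutral)
  ultimately have "h * (\<alpha> + q * \<beta>) \<le> h * (c + \<eta> / 2)"
    by (simp add: algebra_simps)
  then have "\<alpha> + q * \<beta> \<le> c + \<eta> / 2" using h0 by simp
  then show False using \<eta> unfolding \<eta>_def by (simp add: field_simps)
qed

context hj_junction begin

lemma C1_starD:
  assumes "C1_star N e T \<phi> \<phi>t \<phi>x" "i \<in> {1..N}" "t \<in> {0<..<T}" "a \<ge> 0"
  shows "((\<lambda>(s, b). \<phi> s (b *\<^sub>R e i)) has_derivative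
            (\<lambda>(ds, db). ds * \<phi>t t (a *\<^sub>R e i) + db * \<phi>x i t a))
         (at (t, a) within {0<..<T} \<times> {0..})"
  using assms unfolding C1_star_def by blast

lemma val_sub_direction:
  assumes C1: "C1_star N e T \<phi> \<phi>t \<phi>x" and t: "t \<in> {0<..<T}" and i: "i \<in> {1..N}" and a: "a \<ge> 0"
    and r: "r > 0"
    and le: "\<And>s y. s \<in> {0<..<T} \<Longrightarrow> y \<in> J \<Longrightarrow> \<bar>s - t\<bar> < r \<Longrightarrow> dJ (a *\<^sub>R e i) y < r \<Longrightarrow> val s y \<le> \<phi> s y"
    and eq: "val t (a *\<^sub>R e i) = \<phi> t (a *\<^sub>R e i)" and q: "a > 0 \<or> q \<le> 0"
  shows "\<phi>t t (a *\<^sub>R e i) + q * \<phi>x i t a \<le> L i q"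
proof (rule backward_derivative_le[OF C1_starD[OF C1 i t a] t a q r])
  fix h assume h: "0 < h" "h < t" "0 \<le> a - q * h" "h + \<bar>q\<bar> * h < r"
  have "val (t - h + h) ((a - q * h + q * h) *\<^sub>R e i) \<le> val (t - h) ((a - q * h) *\<^sub>R e i) + h * L i q"
    by (rule dominatedD[OF dominated_val i]) (use h a in auto)
  moreover have "val (t - h) ((a - q * h) *\<^sub>R e i) \<le> \<phi> (t - h) ((a - q * h) *\<^sub>R e i)"
  proof (rule le)
    have "\<bar>q\<bar> * h \<ge> 0" using h by simp
    then show "\<bar>t - h - t\<bar> < r" using h by linarith
    have "\<bar>a - (a - q * h)\<bar> < r" using h by (simp add: abs_mult)
    then show "dJ (a *\<^sub>R e i) ((a - q * h) *\<^sub>R e i) < r" using jdist_same[OF i a h(3)] by simp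
  qed (use t h in_J[OF i] in auto)
  ultimately show "(case (t, a) of (s, b) \<Rightarrow> \<phi> s (b *\<^sub>R e i))
      \<le> (case (t - h, a - q * h) of (s, b) \<Rightarrow> \<phi> s (b *\<^sub>R e i)) + h * L i q"
    using eq by simp
qed

lemma val_sub_test:
  assumes C1: "C1_star N e T \<phi> \<phi>t \<phi>x" and t: "t \<in> {0<..<T}" and x: "x \<in> J"
    and r: "r > 0"
    and le: "\<And>s y. s \<in> {0<..<T} \<Longrightarrow> y \<in> J \<Longrightarrow> \<bar>s - t\<bar> < r \<Longrightarrow> dJ x y < r \<Longrightarrow> val s y \<le> \<phi> s y"
    and eq: "val t x = \<phi> t x"
  shows "\<forall>i\<in>{1..N}. \<forall>a>0. x = a *\<^sub>R e i \<longrightarrow> \<phi>t t x + Ham (L i) (\<phi>x i t a) \<le> 0"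
    and "x = 0 \<longrightarrow> \<phi>t t 0 + Max ((\<lambda>i. Ham_minus (L i) (\<phi>x i t 0)) ` {1..N}) \<le> 0"
proof -
  show "\<forall>i\<in>{1..N}. \<forall>a>0. x = a *\<^sub>R e i \<longrightarrow> \<phi>t t x + Ham (L i) (\<phi>x i t a) \<le> 0"
  proof (intro ballI allI impI)
    fix i a assume ia: "i \<in> {1..N}" "a > 0" "x = a *\<^sub>R e i"
    have "Ham (L i) (\<phi>x i t a) \<le> - \<phi>t t x"
    proof (rule Ham_le)
      fix q
      show "\<phi>x i t a * q - L i q \<le> - \<phi>t t x"
        using val_sub_direction[OF C1 t ia(1) _ r, of a q] le eq ia by (simp add: mult.commute)
    qed
    then show "\<phi>t t x + Ham (L i) (\<phi>x i t a) \<le> 0" by simp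
  qed
  show "x = 0 \<longrightarrow> \<phi>t t 0 + Max ((\<lambda>i. Ham_minus (L i) (\<phi>x i t 0)) ` {1..N}) \<le> 0"
  proof
    assume x0: "x = 0"
    have "Max ((\<lambda>i. Ham_minus (L i) (\<phi>x i t 0)) ` {1..N}) \<le> - \<phi>t t 0"
    proof (rule Max.boundedI)
      fix m assume "m \<in> (\<lambda>i. Ham_minus (L i) (\<phi>x i t 0)) ` {1..N}"
      then obtain i where i: "i \<in> {1..N}" and m: "m = Ham_minus (L i) (\<phi>x i t 0)" by blast
      show "m \<le> - \<phi>t t 0"
        unfolding m
      proof (rule Ham_minus_le)
        fix q :: real assume "q \<le> 0"
        then show "\<phi>x i t 0 * q - L i q \<le> - \<phi>t t 0"
          using val_sub_direction[OF C1 t i order_refl r, of q] le eq x0 by (simp add: mult.commute)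
      qed
    qed (use N_ge in auto)
    then show "\<phi>t t 0 + Max ((\<lambda>i. Ham_minus (L i) (\<phi>x i t 0)) ` {1..N}) \<le> 0" by simp
  qed
qed

section \<open>The super-solution inequality, by raising a cone\<close>

lemma jdist_triangle_branch:
  assumes "x \<in> J" "k \<in> {1..N}" "a \<ge> 0" "b \<ge> 0"
  shows "dJ x (a *\<^sub>R e k) \<le> dJ x (b *\<^sub>R e k) + \<bar>a - b\<bar>"
proof -
  obtain i c where x: "i \<in> {1..N}" "c \<ge> 0" "x = c *\<^sub>R e i"
    using assms(1) by (rule J_cases)
  show ?thesis
    using jdist_same[OF x(1,2)] jdist_other[OF x(1) assms(2) _ x(2)] assms x by (cases "i = k") auto
qed

text \<open>The maximum of \<open>val\<close> and \<psi> inside the ball, continued by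
  \<open>val\<close> outside, is a candidate. A step shorter than \<rho>/2 that ends where \<psi>
  exceeds \<open>val\<close> ends in the inner half and hence starts in the ball, where \<psi>
  itself is dominated. As \<rho> \<le> t, the initial values are untouched.\<close>

lemma val_bump:
  assumes x: "x \<in> J" and \<rho>: "0 < \<rho>" "\<rho> \<le> t"
    and step: "\<And>k s h a q. k \<in> {1..N} \<Longrightarrow> h \<ge> 0 \<Longrightarrow> a \<ge> 0 \<Longrightarrow> 0 \<le> a + q * h \<Longrightarrow>
      \<bar>s - t\<bar> + dJ x (a *\<^sub>R e k) < \<rho> \<Longrightarrow> \<bar>s + h - t\<bar> + dJ x ((a + q * h) *\<^sub>R e k) < \<rho> \<Longrightarrow>
      \<psi> (s + h) ((a + q * h) *\<^sub>R e k) \<le> \<psi> s (a *\<^sub>R e k) + h * L k q"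
    and annulus: "\<And>s y. y \<in> J \<Longrightarrow> \<rho> / 2 \<le> \<bar>s - t\<bar> + dJ x y \<Longrightarrow> \<bar>s - t\<bar> + dJ x y < \<rho> \<Longrightarrow> \<psi> s y \<le> val s y"
  shows "\<psi> t x \<le> val t x"
proof -
  define D where "D s y = \<bar>s - t\<bar> + dJ x y" for s y
  define f where "f s y = (if D s y < \<rho> then max (val s y) (\<psi> s y) else val s y)" for s y
  have "dominated {0..} f"
  proof (rule dominated_short_steps[of "\<rho> / 2"])
    fix i s h a q
    assume *: "i \<in> {1..N}" "(s::real) \<ge> 0" "h \<ge> 0" "a \<ge> 0" "0 \<le> a + q * h" "h + \<bar>q\<bar> * h < \<rho> / 2"
    let ?y0 = "a *\<^sub>R e i" and ?y1 = "(a + q * h) *\<^sub>R e i"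
    have y1: "?y1 \<in> J" using in_J * by blast
    have valstep: "val (s + h) ?y1 \<le> val s ?y0 + h * L i q"
      by (rule dominatedD[OF dominated_val]) (use * in auto)
    have ge: "val s ?y0 \<le> f s ?y0" by (simp add: f_def)
    show "f (s + h) ?y1 \<le> f s ?y0 + h * L i q"
    proof (cases "D (s + h) ?y1 < \<rho> \<and> val (s + h) ?y1 < \<psi> (s + h) ?y1")
      case False
      then have "f (s + h) ?y1 = val (s + h) ?y1" by (auto simp: f_def)
      then show ?thesis using valstep ge by linarith
    next
      case True
      then have "D (s + h) ?y1 < \<rho> / 2"
        using annulus[OF y1, of "s + h"] unfolding D_def by (meson leI not_le)
      moreover have "dJ x ?y0 \<le> dJ x ?y1 + \<bar>q\<bar> * h"
        using jdist_triangle_branch[OF x *(1,4,5)] *(3) by (simp add: abs_mult)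
      ultimately have 0: "D s ?y0 < \<rho>"
        using * unfolding D_def by linarith
      have "\<psi> (s + h) ?y1 \<le> \<psi> s ?y0 + h * L i q"
        by (rule step) (use * True 0 in \<open>auto simp: D_def\<close>)
      then show ?thesis using True 0 by (simp add: f_def)
    qed
  qed (use \<rho> in simp)
  moreover have "f 0 y \<le> u0 y" if "y \<in> J" for y
    using that \<rho> jdist_nonneg[of x y] val_initial by (simp add: f_def D_def)
  ultimately have "candidate f" by (simp add: candidate_def)
  then have "f t x \<le> val t x" using candidate_le_val x \<rho> by simp
  then show ?thesis using jdist_refl[OF x] \<rho> by (simp add: f_def D_def)
qed

lemma small_ball_coord:
  assumes "i \<in> {1..N}" "k \<in> {1..N}" "a \<ge> 0" "b \<ge> 0" "a > 0 \<Longrightarrow> \<rho> \<le> a" "dJ (a *\<^sub>R e i) (b *\<^sub>R e k) < \<rho>"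
  shows "a = 0 \<or> k = i" "dJ (a *\<^sub>R e i) (b *\<^sub>R e k) = \<bar>b - a\<bar>"
  using assms jdist_same[of i a b] jdist_other[of i k a b] by (cases "i = k"; fastforce)+

text \<open>Serves interior points (only branch i is seen and p is constant) and the vertex (one
  slope per branch) alike. A first-order lower bound for \<open>val\<close> by a strict sub-solution
  can be turned into a cone lifted above \<open>val\<close> at its apex, contradicting
  \<open>val_bump\<close>.\<close>

lemma val_strict_test_contradiction:
  assumes i: "i \<in> {1..N}" and a0: "a0 \<ge> 0" and t: "t > 0" and \<eta>: "\<eta> > 0"
    and p: "\<And>k. a0 > 0 \<Longrightarrow> p k = p i"
    and strict: "\<And>k q. k \<in> {1..N} \<Longrightarrow> a0 = 0 \<or> k = i \<Longrightarrow> \<alpha> + p k * q - L k q \<le> - \<eta>"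
    and low: "\<And>\<kappa>. \<kappa> > 0 \<Longrightarrow> \<exists>\<rho>>0. \<forall>k\<in>{1..N}. \<forall>s. \<forall>b\<ge>0. a0 = 0 \<or> k = i \<longrightarrow> \<bar>s - t\<bar> + \<bar>b - a0\<bar> < \<rho> \<longrightarrow>
      val t (a0 *\<^sub>R e i) + \<alpha> * (s - t) + p k * (b - a0) - \<kappa> * (\<bar>s - t\<bar> + \<bar>b - a0\<bar>) \<le> val s (b *\<^sub>R e k)"
  shows False
proof -
  \<comment> \<open>The summand 1 leaves room for the additional slope |q| caused by the
    cone.\<close>
  define M where "M = (\<Sum>k\<in>{1..N}. \<bar>p k\<bar>) + 1"
  obtain C where C: "C \<ge> 0" "\<And>k q. k \<in> {1..N} \<Longrightarrow> M * \<bar>q\<bar> - C \<le> L k q"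
    using superlinear by blast
  define C1 where "C1 = \<bar>\<alpha>\<bar> + C"
  have C1: "C1 \<ge> 0" using C by (simp add: C1_def)
  have growth: "\<alpha> + p k * q + \<bar>q\<bar> - L k q \<le> C1" if "k \<in> {1..N}" for k q
  proof -
    have "\<bar>p k\<bar> \<le> M - 1"
      using member_le_sum[OF that, of "\<lambda>k. \<bar>p k\<bar>"] by (simp add: M_def)
    then have "\<bar>p k\<bar> * \<bar>q\<bar> \<le> (M - 1) * \<bar>q\<bar>" by (intro mult_right_mono) auto
    moreover have "p k * q \<le> \<bar>p k\<bar> * \<bar>q\<bar>" by (metis abs_ge_self abs_mult)
    ultimately have "p k * q + \<bar>q\<bar> \<le> M * \<bar>q\<bar>" by (simp add: algebra_simps)
    then show ?thesis using C(2)[OF that, of q] abs_ge_self[of \<alpha>] unfolding C1_def by linarith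
  qed
  \<comment> \<open>Weighting the strict inequality by 1 - \<mu> and \<open>growth\<close> by \<mu>
    bounds \<alpha> + p q + \<mu>(1 + |q|) - L by -\<eta> + \<mu>(C1 + 1 + \<eta>), which this \<mu>
    makes zero. So a cone of slope \<mu> is affordable for every velocity.\<close>
  define \<mu> where "\<mu> = \<eta> / (C1 + 1 + \<eta>)"
  have den: "C1 + 1 + \<eta> > 0" using C1 \<eta> by linarith
  have \<mu>: "0 < \<mu>" "\<mu> \<le> 1" "\<mu> * (C1 + 1 + \<eta>) = \<eta>"
    using C1 \<eta> den by (auto simp: \<mu>_def)
  have slack: "\<alpha> + p k * q + \<mu> * (1 + \<bar>q\<bar>) \<le> L k q" if "k \<in> {1..N}" "a0 = 0 \<or> k = i" for k q
  proof -
    have "(1 - \<mu>) * (\<alpha> + p k * q - L k q) \<le> (1 - \<mu>) * (- \<eta>)"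
      using strict[OF that] \<mu> by (intro mult_left_mono) auto
    moreover have "\<mu> * (\<alpha> + p k * q + \<bar>q\<bar> - L k q) \<le> \<mu> * C1"
      using growth[OF that(1)] \<mu> by (intro mult_left_mono) auto
    ultimately show ?thesis using \<mu>(3) by (simp add: algebra_simps)
  qed
  obtain \<rho>0 where \<rho>0: "\<rho>0 > 0" "\<And>k s b. k \<in> {1..N} \<Longrightarrow> b \<ge> 0 \<Longrightarrow> a0 = 0 \<or> k = i \<Longrightarrow> \<bar>s - t\<bar> + \<bar>b - a0\<bar> < \<rho>0 \<Longrightarrow>
      val t (a0 *\<^sub>R e i) + \<alpha> * (s - t) + p k * (b - a0) - \<mu> / 2 * (\<bar>s - t\<bar> + \<bar>b - a0\<bar>) \<le> val s (b *\<^sub>R e k)"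
    using low[of "\<mu> / 2"] \<mu>(1) by (meson half_gt_zero)
  define \<rho> where "\<rho> = min (min \<rho>0 t) (if a0 > 0 then a0 else 1)"
  have \<rho>: "0 < \<rho>" "\<rho> \<le> t" "\<rho> \<le> \<rho>0" "a0 > 0 \<Longrightarrow> \<rho> \<le> a0"
    using \<rho>0(1) t by (auto simp: \<rho>_def)
  \<comment> \<open>\<open>val\<close> lies above the cone of half the slope. Beyond radius \<rho>/2
    the two cones differ by at least \<mu>\<rho>/4, so a lift by \<mu>\<rho>/8 still leaves G below
    \<open>val\<close> there but above it at the centre.\<close>
  define G where "G s k b = val t (a0 *\<^sub>R e i) + \<alpha> * (s - t) + p k * (b - a0) - \<mu> * (\<bar>s - t\<bar> + \<bar>b - a0\<bar>) + \<mu> * \<rho> / 8"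
    for s k b
  define \<psi> where "\<psi> s = glue_branches (G s)" for s
  have \<psi>: "\<psi> s (b *\<^sub>R e k) = G s k b" if "k \<in> {1..N}" "b \<ge> 0" for s k b
    unfolding \<psi>_def
  proof (rule glue_branches_coord[OF that])
    fix j
    have "a0 = 0 \<or> p j = p 1" using p[of j] p[of 1] a0 by fastforce
    then show "G s j 0 = G s 1 0" by (auto simp: G_def)
  qed
  have "\<psi> t (a0 *\<^sub>R e i) \<le> val t (a0 *\<^sub>R e i)"
  proof (rule val_bump[OF in_J[OF i a0] \<rho>(1,2)])
    fix k s h a q
    assume *: "k \<in> {1..N}" "(h::real) \<ge> 0" "a \<ge> 0" "0 \<le> a + q * h"
      "\<bar>s - t\<bar> + dJ (a0 *\<^sub>R e i) (a *\<^sub>R e k) < \<rho>"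
    have ball: "a0 = 0 \<or> k = i"
      by (rule small_ball_coord(1)[OF i *(1) a0 *(3) \<rho>(4)]) (use *(5) in auto)
    have "\<mu> * (\<bar>s - t\<bar> + \<bar>a - a0\<bar>) \<le> \<mu> * (\<bar>s + h - t\<bar> + \<bar>a + q * h - a0\<bar> + h * (1 + \<bar>q\<bar>))"
    proof (rule mult_left_mono)
      have "\<bar>q * h\<bar> = h * \<bar>q\<bar>" using *(2) by (simp add: abs_mult)
      then show "\<bar>s - t\<bar> + \<bar>a - a0\<bar> \<le> \<bar>s + h - t\<bar> + \<bar>a + q * h - a0\<bar> + h * (1 + \<bar>q\<bar>)"
        using *(2) by (simp add: algebra_simps)
    qed (use \<mu> in simp)
    then have "G (s + h) k (a + q * h) \<le> G s k a + h * (\<alpha> + p k * q + \<mu> * (1 + \<bar>q\<bar>))"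
      unfolding G_def by (simp add: algebra_simps)
    also have "\<dots> \<le> G s k a + h * L k q"
      using slack[OF *(1) ball, of q] *(2) by (intro add_left_mono mult_left_mono) auto
    finally show "\<psi> (s + h) ((a + q * h) *\<^sub>R e k) \<le> \<psi> s (a *\<^sub>R e k) + h * L k q"
      using \<psi> * by simp
  next
    fix s y
    assume y: "y \<in> J" "\<rho> / 2 \<le> \<bar>s - t\<bar> + dJ (a0 *\<^sub>R e i) y" "\<bar>s - t\<bar> + dJ (a0 *\<^sub>R e i) y < \<rho>"
    obtain k b where k: "k \<in> {1..N}" "b \<ge> 0" "y = b *\<^sub>R e k"
      using y(1) by (rule J_cases)
    have ball: "a0 = 0 \<or> k = i" "dJ (a0 *\<^sub>R e i) y = \<bar>b - a0\<bar>"
      using small_ball_coord[OF i k(1) a0 k(2) \<rho>(4)] y(3) k(3) by auto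
    have "\<mu> / 2 * (\<bar>s - t\<bar> + \<bar>b - a0\<bar>) \<ge> \<mu> / 2 * (\<rho> / 2)"
      using y(2) ball(2) \<mu> by (intro mult_left_mono) auto
    moreover have "\<mu> * \<rho> > 0" using \<mu> \<rho> by simp
    ultimately have "G s k b \<le> val t (a0 *\<^sub>R e i) + \<alpha> * (s - t) + p k * (b - a0) - \<mu> / 2 * (\<bar>s - t\<bar> + \<bar>b - a0\<bar>)"
      unfolding G_def by (simp add: algebra_simps)
    also have "\<dots> \<le> val s (b *\<^sub>R e k)"
      by (rule \<rho>0(2)[OF k(1,2) ball(1)]) (use y(3) ball(2) \<rho>(3) in auto)
    finally show "\<psi> s y \<le> val s y"
      using \<psi> k by simp
  qed
  moreover have "\<psi> t (a0 *\<^sub>R e i) = val t (a0 *\<^sub>R e i) + \<mu> * \<rho> / 8"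
    using \<psi>[OF i a0] by (simp add: G_def)
  moreover have "\<mu> * \<rho> > 0" using \<mu> \<rho> by simp
  ultimately show False by simp
qed

lemma val_ge_linearization:
  assumes C1: "C1_star N e T \<phi> \<phi>t \<phi>x" and t: "t \<in> {0<..<T}" and i: "i \<in> {1..N}" and a: "a \<ge> 0"
    and r: "r > 0"
    and ge: "\<And>s b. s \<in> {0<..<T} \<Longrightarrow> b \<ge> 0 \<Longrightarrow> \<bar>s - t\<bar> < r \<Longrightarrow> \<bar>b - a\<bar> < r \<Longrightarrow>
      \<phi> s (b *\<^sub>R e i) \<le> val s (b *\<^sub>R e i)"
    and eq: "val t (a *\<^sub>R e i) = \<phi> t (a *\<^sub>R e i)" and \<kappa>: "\<kappa> > 0"
  shows "\<exists>\<rho>>0. \<forall>s. \<forall>b\<ge>0. \<bar>s - t\<bar> + \<bar>b - a\<bar> < \<rho> \<longrightarrow>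
      val t (a *\<^sub>R e i) + \<phi>t t (a *\<^sub>R e i) * (s - t) + \<phi>x i t a * (b - a) - \<kappa> * (\<bar>s - t\<bar> + \<bar>b - a\<bar>)
        \<le> val s (b *\<^sub>R e i)"
proof -
  obtain \<rho>0 where \<rho>0: "\<rho>0 > 0" "\<And>s b. (s, b) \<in> {0<..<T} \<times> {0..} \<Longrightarrow> \<bar>s - t\<bar> + \<bar>b - a\<bar> < \<rho>0 \<Longrightarrow>
    \<bar>\<phi> s (b *\<^sub>R e i) - \<phi> t (a *\<^sub>R e i) - ((s - t) * \<phi>t t (a *\<^sub>R e i) + (b - a) * \<phi>x i t a)\<bar>
      \<le> \<kappa> * (\<bar>s - t\<bar> + \<bar>b - a\<bar>)"
    using has_derivative_approx[OF C1_starD[OF C1 i t a] \<kappa>] by auto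
  define \<rho> where "\<rho> = min (min \<rho>0 r) (min t (T - t))"
  have \<rho>: "\<rho> > 0" "\<rho> \<le> \<rho>0" "\<rho> \<le> r" "\<rho> \<le> t" "\<rho> \<le> T - t"
    using \<rho>0(1) r t by (auto simp: \<rho>_def)
  show ?thesis
  proof (intro exI[of _ \<rho>] conjI allI impI \<rho>(1))
    fix s b assume b: "(b::real) \<ge> 0" and sb: "\<bar>s - t\<bar> + \<bar>b - a\<bar> < \<rho>"
    have s: "s \<in> {0<..<T}" using sb \<rho> by auto
    have "\<phi> s (b *\<^sub>R e i) \<le> val s (b *\<^sub>R e i)"
      by (rule ge) (use s b sb \<rho> in auto)
    moreover have "\<bar>\<phi> s (b *\<^sub>R e i) - \<phi> t (a *\<^sub>R e i) - ((s - t) * \<phi>t t (a *\<^sub>R e i) + (b - a) * \<phi>x i t a)\<bar>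
      \<le> \<kappa> * (\<bar>s - t\<bar> + \<bar>b - a\<bar>)"
      by (rule \<rho>0(2)) (use s b sb \<rho> in auto)
    ultimately show "val t (a *\<^sub>R e i) + \<phi>t t (a *\<^sub>R e i) * (s - t) + \<phi>x i t a * (b - a) - \<kappa> * (\<bar>s - t\<bar> + \<bar>b - a\<bar>)
        \<le> val s (b *\<^sub>R e i)"
      unfolding eq by (simp add: mult.commute[of "s - t"] mult.commute[of "b - a"])
  qed
qed

lemma val_super_test_branch:
  assumes C1: "C1_star N e T \<phi> \<phi>t \<phi>x" and t: "t \<in> {0<..<T}" and i: "i \<in> {1..N}" and a: "a > 0"
    and r: "r > 0"
    and ge: "\<And>s y. s \<in> {0<..<T} \<Longrightarrow> y \<in> J \<Longrightarrow> \<bar>s - t\<bar> < r \<Longrightarrow> dJ (a *\<^sub>R e i) y < r \<Longrightarrow> \<phi> s y \<le> val s y"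
    and eq: "val t (a *\<^sub>R e i) = \<phi> t (a *\<^sub>R e i)"
  shows "\<phi>t t (a *\<^sub>R e i) + Ham (L i) (\<phi>x i t a) \<ge> 0"
proof (rule ccontr)
  define \<eta> where "\<eta> = - (\<phi>t t (a *\<^sub>R e i) + Ham (L i) (\<phi>x i t a))"
  assume "\<not> \<phi>t t (a *\<^sub>R e i) + Ham (L i) (\<phi>x i t a) \<ge> 0"
  then have \<eta>: "\<eta> > 0" by (simp add: \<eta>_def)
  have ge': "\<phi> s (b *\<^sub>R e i) \<le> val s (b *\<^sub>R e i)" if "s \<in> {0<..<T}" "b \<ge> 0" "\<bar>s - t\<bar> < r" "\<bar>b - a\<bar> < r" for s b
    using ge[OF that(1) in_J[OF i that(2)] that(3)] jdist_same[OF i less_imp_le[OF a] that(2)] that(4)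
    by (simp add: abs_minus_commute)
  show False
  proof (rule val_strict_test_contradiction[OF i _ _ \<eta>, of a t "\<lambda>_. \<phi>x i t a" "\<phi>t t (a *\<^sub>R e i)"])
    fix k q assume "k \<in> {1..N}" "a = 0 \<or> k = i"
    then have k: "k = i" using a by simp
    show "\<phi>t t (a *\<^sub>R e i) + \<phi>x i t a * q - L k q \<le> - \<eta>"
      unfolding \<eta>_def k using Ham_ge[OF i, of "\<phi>x i t a" q] by linarith
  next
    fix \<kappa> :: real assume "\<kappa> > 0"
    from val_ge_linearization[OF C1 t i less_imp_le[OF a] r ge' eq this]
    show "\<exists>\<rho>>0. \<forall>k\<in>{1..N}. \<forall>s. \<forall>b\<ge>0. a = 0 \<or> k = i \<longrightarrow> \<bar>s - t\<bar> + \<bar>b - a\<bar> < \<rho> \<longrightarrow>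
        val t (a *\<^sub>R e i) + \<phi>t t (a *\<^sub>R e i) * (s - t) + \<phi>x i t a * (b - a) - \<kappa> * (\<bar>s - t\<bar> + \<bar>b - a\<bar>)
          \<le> val s (b *\<^sub>R e k)"
      using a by auto
  qed (use a t in auto)
qed

text \<open>The cone argument needs strictness for all velocities, whereas \<open>Ham_minus\<close>
  controls only q \<le> 0. Lowering each slope to at most the minimiser of the Hamiltonian closes
  this gap, and since b \<ge> 0 it keeps the linearization below \<open>val\<close>.\<close>

lemma val_super_test_vertex:
  assumes C1: "C1_star N e T \<phi> \<phi>t \<phi>x" and t: "t \<in> {0<..<T}" and r: "r > 0"
    and ge: "\<And>s y. s \<in> {0<..<T} \<Longrightarrow> y \<in> J \<Longrightarrow> \<bar>s - t\<bar> < r \<Longrightarrow> dJ 0 y < r \<Longrightarrow> \<phi> s y \<le> val s y"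
    and eq: "val t 0 = \<phi> t 0"
  shows "\<phi>t t 0 + Max ((\<lambda>i. Ham_minus (L i) (\<phi>x i t 0)) ` {1..N}) \<ge> 0" (is "_ + ?M \<ge> 0")
proof (rule ccontr)
  define \<eta> where "\<eta> = - (\<phi>t t 0 + ?M)"
  assume "\<not> \<phi>t t 0 + ?M \<ge> 0"
  then have \<eta>: "\<eta> > 0" by (simp add: \<eta>_def)
  have M: "Ham_minus (L k) (\<phi>x k t 0) \<le> ?M" if "k \<in> {1..N}" for k
    by (rule Max_ge) (use that in auto)
  obtain d where d: "\<And>k q. k \<in> {1..N} \<Longrightarrow> L k 0 + d k * q \<le> L k q"
    using subgradient_ex by metis
  define p where "p k = min (\<phi>x k t 0) (d k)" for k
  have ge': "\<phi> s (b *\<^sub>R e k) \<le> val s (b *\<^sub>R e k)"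
    if "k \<in> {1..N}" "s \<in> {0<..<T}" "b \<ge> 0" "\<bar>s - t\<bar> < r" "\<bar>b - 0\<bar> < r" for k s b
    using ge[OF that(2) in_J[OF that(1,3)] that(4)] jdist_zero(1)[OF that(1,3)] that(3,5) by simp
  show False
  proof (rule val_strict_test_contradiction[OF one_mem order_refl _ \<eta>, of t p "\<phi>t t 0"])
    fix k q assume k: "k \<in> {1..N}"
    \<comment> \<open>Slopes above the minimiser d of H can be lowered to d at no cost, where H and H^- agree.\<close>
    have "p k * q - L k q \<le> Ham_minus (L k) (\<phi>x k t 0)"
    proof (cases "q \<le> 0 \<and> \<phi>x k t 0 \<le> d k")
      case True
      then show ?thesis using Ham_minus_ge[OF k, of q "\<phi>x k t 0"] by (simp add: p_def)
    next
      case False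
      have "p k * q \<le> d k * q"
      proof (cases "q \<le> 0")
        case True
        then show ?thesis using False by (simp add: p_def)
      next
        case False
        then show ?thesis by (intro mult_right_mono) (auto simp: p_def)
      qed
      then have "p k * q - L k q \<le> - L k 0" using d[OF k, of q] by linarith
      then show ?thesis using Ham_minus_ge[OF k order_refl, of "\<phi>x k t 0"] by simp
    qed
    then show "\<phi>t t 0 + p k * q - L k q \<le> - \<eta>"
      unfolding \<eta>_def using M[OF k] by linarith
  next
    fix \<kappa> :: real assume \<kappa>: "\<kappa> > 0"
    have "\<exists>\<rho>>0. \<forall>s. \<forall>b\<ge>0. \<bar>s - t\<bar> + \<bar>b - 0\<bar> < \<rho> \<longrightarrow>
      val t (0 *\<^sub>R e k) + \<phi>t t (0 *\<^sub>R e k) * (s - t) + \<phi>x k t 0 * (b - 0) - \<kappa> * (\<bar>s - t\<bar> + \<bar>b - 0\<bar>)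
        \<le> val s (b *\<^sub>R e k)" if "k \<in> {1..N}" for k
      by (rule val_ge_linearization[OF C1 t that order_refl r ge'[OF that] _ \<kappa>]) (use eq in auto)
    then obtain R where R: "\<And>k. k \<in> {1..N} \<Longrightarrow> R k > 0"
      "\<And>k s b. k \<in> {1..N} \<Longrightarrow> b \<ge> 0 \<Longrightarrow> \<bar>s - t\<bar> + \<bar>b - 0\<bar> < R k \<Longrightarrow>
        val t 0 + \<phi>t t 0 * (s - t) + \<phi>x k t 0 * b - \<kappa> * (\<bar>s - t\<bar> + \<bar>b - 0\<bar>) \<le> val s (b *\<^sub>R e k)"
      unfolding scaleR_zero_left diff_zero by metis
    define \<rho> where "\<rho> = Min (R ` {1..N})"
    have \<rho>: "\<rho> > 0" "\<And>k. k \<in> {1..N} \<Longrightarrow> \<rho> \<le> R k"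
      unfolding \<rho>_def using R(1) N_ge by (auto simp: Min_gr_iff)
    show "\<exists>\<rho>>0. \<forall>k\<in>{1..N}. \<forall>s. \<forall>b\<ge>0. (0::real) = 0 \<or> k = 1 \<longrightarrow> \<bar>s - t\<bar> + \<bar>b - 0\<bar> < \<rho> \<longrightarrow>
        val t (0 *\<^sub>R e 1) + \<phi>t t 0 * (s - t) + p k * (b - 0) - \<kappa> * (\<bar>s - t\<bar> + \<bar>b - 0\<bar>) \<le> val s (b *\<^sub>R e k)"
    proof (intro exI[of _ \<rho>] conjI ballI allI impI \<rho>(1))
      fix k s b assume k: "k \<in> {1..N}" and b: "(b::real) \<ge> 0" and sb: "\<bar>s - t\<bar> + \<bar>b - 0\<bar> < \<rho>"
      have "p k * b \<le> \<phi>x k t 0 * b" using b by (intro mult_right_mono) (auto simp: p_def)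
      then show "val t (0 *\<^sub>R e 1) + \<phi>t t 0 * (s - t) + p k * (b - 0) - \<kappa> * (\<bar>s - t\<bar> + \<bar>b - 0\<bar>) \<le> val s (b *\<^sub>R e k)"
        using R(2)[OF k b, of s] sb \<rho>(2)[OF k] by simp
    qed
  qed (use t in auto)
qed

section \<open>Semicontinuous envelopes and the solution property\<close>

lemma usc_env_ge: "t \<in> {0..<T} \<Longrightarrow> x \<in> J \<Longrightarrow> ereal (u t x) \<le> usc_env N e T u t x"
  unfolding usc_env_def
  by (rule INF_greatest, rule Sup_upper, rule CollectI, intro exI[of _ t] exI[of _ x])
    (use jdist_refl[of x] in auto)

lemma lsc_env_le: "t \<in> {0..<T} \<Longrightarrow> x \<in> J \<Longrightarrow> lsc_env N e T u t x \<le> ereal (u t x)"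
  unfolding lsc_env_def
  by (rule SUP_least, rule Inf_lower, rule CollectI, intro exI[of _ t] exI[of _ x])
    (use jdist_refl[of x] in auto)

lemma val_local_bound:
  assumes "\<epsilon> > 0"
  obtains \<delta> where "\<delta> > 0" "\<And>t x s y. t \<ge> 0 \<Longrightarrow> x \<in> J \<Longrightarrow> s \<ge> 0 \<Longrightarrow> y \<in> J \<Longrightarrow> \<bar>s - t\<bar> < \<delta> \<Longrightarrow> dJ x y < \<delta> \<Longrightarrow>
    \<bar>val t x - val s y\<bar> \<le> \<epsilon>"
proof
  define \<delta> where "\<delta> = \<epsilon> / (2 * lip + 1)"
  have den: "2 * lip + 1 > 0" using lip_nonneg by linarith
  show \<delta>: "\<delta> > 0" using assms den by (simp add: \<delta>_def)
  fix t x s y assume *: "(t::real) \<ge> 0" "x \<in> J" "(s::real) \<ge> 0" "y \<in> J" "\<bar>s - t\<bar> < \<delta>" "dJ x y < \<delta>"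
  have "\<bar>val t x - val s y\<bar> \<le> lip * (\<bar>t - s\<bar> + dJ x y)" using val_lipschitz * by blast
  also have "\<dots> \<le> lip * (2 * \<delta>)" using * lip_nonneg by (intro mult_left_mono) auto
  also have "\<dots> \<le> (2 * lip + 1) * \<delta>" using \<delta> by (simp add: algebra_simps)
  also have "\<dots> = \<epsilon>" using den by (simp add: \<delta>_def)
  finally show "\<bar>val t x - val s y\<bar> \<le> \<epsilon>" .
qed

lemma usc_env_val:
  assumes "t \<in> {0..<T}" "x \<in> J"
  shows "usc_env N e T val t x = ereal (val t x)"
proof (rule antisym[OF ereal_le_epsilon2 usc_env_ge[OF assms]])
  fix \<epsilon> :: real assume "\<epsilon> > 0"
  then obtain \<delta> where \<delta>: "\<delta> > 0" "\<And>t x s y. t \<ge> 0 \<Longrightarrow> x \<in> J \<Longrightarrow> s \<ge> 0 \<Longrightarrow> y \<in> J \<Longrightarrow> \<bar>s - t\<bar> < \<delta> \<Longrightarrow> dJ x y < \<delta> \<Longrightarrow>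
    \<bar>val t x - val s y\<bar> \<le> \<epsilon>" using val_local_bound by metis
  show "usc_env N e T val t x \<le> ereal (val t x) + ereal \<epsilon>"
    unfolding usc_env_def
  proof (rule INF_lower2[of \<delta>], use \<delta>(1) in simp, rule Sup_least, clarsimp)
    fix s a b assume "0 \<le> s" "(a, b) \<in> J" "\<bar>s - t\<bar> < \<delta>" "dJ x (a, b) < \<delta>"
    then show "val s (a, b) \<le> val t x + \<epsilon>"
      using \<delta>(2)[of t x s "(a, b)"] assms by auto
  qed
qed

lemma lsc_env_val:
  assumes "t \<in> {0..<T}" "x \<in> J"
  shows "lsc_env N e T val t x = ereal (val t x)"
proof (rule antisym[OF lsc_env_le[OF assms] ereal_le_epsilon2])
  fix \<epsilon> :: real assume "\<epsilon> > 0"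
  then obtain \<delta> where \<delta>: "\<delta> > 0" "\<And>t x s y. t \<ge> 0 \<Longrightarrow> x \<in> J \<Longrightarrow> s \<ge> 0 \<Longrightarrow> y \<in> J \<Longrightarrow> \<bar>s - t\<bar> < \<delta> \<Longrightarrow> dJ x y < \<delta> \<Longrightarrow>
    \<bar>val t x - val s y\<bar> \<le> \<epsilon>" using val_local_bound by metis
  have "ereal (val t x - \<epsilon>) \<le> lsc_env N e T val t x"
    unfolding lsc_env_def
  proof (rule SUP_upper2[of \<delta>], use \<delta>(1) in simp, rule Inf_greatest, clarsimp)
    fix s a b assume "0 \<le> s" "(a, b) \<in> J" "\<bar>s - t\<bar> < \<delta>" "dJ x (a, b) < \<delta>"
    then show "val t x - \<epsilon> \<le> val s (a, b)"
      using \<delta>(2)[of t x s "(a, b)"] assms by auto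
  qed
  then show "ereal (val t x) \<le> lsc_env N e T val t x + ereal \<epsilon>"
    using ereal_minus_le[of "ereal \<epsilon>" "ereal (val t x)" "lsc_env N e T val t x"] by simp
qed

lemma visc_solution_val: "visc_solution N e L T u0 val"
  unfolding visc_solution_def
proof
  have loc: "\<exists>\<delta>>0. \<forall>s\<in>{0..<T}. \<forall>y\<in>J. \<bar>s - t\<bar> < \<delta> \<and> dJ x y < \<delta> \<longrightarrow> \<bar>val t x - val s y\<bar> \<le> \<epsilon>"
    if "\<epsilon> > 0" "t \<in> {0..<T}" "x \<in> J" for \<epsilon> t x
    using val_local_bound[OF that(1)] that(2,3) by (metis atLeastLessThan_iff)
  show "visc_sub N e L T u0 (usc_env N e T val)"
    unfolding visc_sub_def
  proof (intro conjI)
    show "usc_on N e T (usc_env N e T val)"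
      unfolding usc_on_def
    proof (intro ballI allI impI)
      fix t x c assume tx: "t \<in> {0..<T}" "x \<in> J" and c: "usc_env N e T val t x < c"
      then have "ereal (val t x) < c" using usc_env_val by simp
      \<comment> \<open>The level c may be infinite, so a real level is inserted.\<close>
      then obtain z where z: "val t x < z" "ereal z \<le> c"
        by (metis ereal_dense2 less_ereal.simps(1) less_imp_le)
      obtain \<delta> where \<delta>: "\<delta> > 0" "\<And>s y. s \<in> {0..<T} \<Longrightarrow> y \<in> J \<Longrightarrow> \<bar>s - t\<bar> < \<delta> \<and> dJ x y < \<delta> \<Longrightarrow>
          \<bar>val t x - val s y\<bar> \<le> (z - val t x) / 2"
        using loc[of "(z - val t x) / 2", OF _ tx] z by auto
      show "\<exists>\<delta>>0. \<forall>s\<in>{0..<T}. \<forall>y\<in>J. \<bar>s - t\<bar> < \<delta> \<and> dJ x y < \<delta> \<longrightarrow> usc_env N e T val s y < c"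
      proof (intro exI[of _ \<delta>] conjI ballI impI \<delta>(1))
        fix s y assume sy: "s \<in> {0..<T}" "y \<in> J" "\<bar>s - t\<bar> < \<delta> \<and> dJ x y < \<delta>"
        have "val s y < z" using \<delta>(2)[OF sy] z(1) by argo
        then have "ereal (val s y) < c" using z(2) by (metis less_ereal.simps(1) less_le_trans)
        then show "usc_env N e T val s y < c" using usc_env_val[OF sy(1,2)] by simp
      qed
    qed
    show "\<forall>x\<in>J. usc_env N e T val 0 x \<le> ereal (u0 x)"
    proof (cases "T > 0")
      case True
      then show ?thesis using usc_env_val val_initial by simp
    next
      \<comment> \<open>No time lies in \<open>{0..<T}\<close>, so the envelope is an empty
        supremum, hence minus infinity.\<close>
      case False
      then show ?thesis
        by (auto simp: usc_env_def intro!: INF_lower2[of 1] Sup_least)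
    qed
    show "\<forall>\<phi> \<phi>t \<phi>x. C1_star N e T \<phi> \<phi>t \<phi>x \<longrightarrow> (\<forall>t\<in>{0<..<T}. \<forall>x\<in>J. \<forall>r>0.
           (\<forall>s\<in>{0<..<T}. \<forall>y\<in>J. \<bar>s - t\<bar> < r \<and> dJ x y < r \<longrightarrow> usc_env N e T val s y \<le> ereal (\<phi> s y))
           \<and> usc_env N e T val t x = ereal (\<phi> t x) \<longrightarrow>
           (\<forall>i\<in>{1..N}. \<forall>a>0. x = a *\<^sub>R e i \<longrightarrow> \<phi>t t x + Ham (L i) (\<phi>x i t a) \<le> 0)
           \<and> (x = 0 \<longrightarrow> \<phi>t t 0 + Max ((\<lambda>i. Ham_minus (L i) (\<phi>x i t 0)) ` {1..N}) \<le> 0))"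
    proof (intro allI ballI impI, elim conjE)
      fix \<phi> \<phi>t \<phi>x t x r
      assume C1: "C1_star N e T \<phi> \<phi>t \<phi>x" and tx: "t \<in> {0<..<T}" "x \<in> J" and r: "(r::real) > 0"
        and le: "\<forall>s\<in>{0<..<T}. \<forall>y\<in>J. \<bar>s - t\<bar> < r \<and> dJ x y < r \<longrightarrow> usc_env N e T val s y \<le> ereal (\<phi> s y)"
        and eq: "usc_env N e T val t x = ereal (\<phi> t x)"
      have le': "val s y \<le> \<phi> s y" if "s \<in> {0<..<T}" "y \<in> J" "\<bar>s - t\<bar> < r" "dJ x y < r" for s y
        using le[rule_format, OF that(1,2)] that usc_env_val[of s T y] by simp
      have eq': "val t x = \<phi> t x" using eq usc_env_val[of t T x] tx by auto
      show "(\<forall>i\<in>{1..N}. \<forall>a>0. x = a *\<^sub>R e i \<longrightarrow> \<phi>t t x + Ham (L i) (\<phi>x i t a) \<le> 0)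
           \<and> (x = 0 \<longrightarrow> \<phi>t t 0 + Max ((\<lambda>i. Ham_minus (L i) (\<phi>x i t 0)) ` {1..N}) \<le> 0)"
        using val_sub_test[OF C1 tx r le' eq'] by blast
    qed
  qed
  show "visc_super N e L T u0 (lsc_env N e T val)"
    unfolding visc_super_def
  proof (intro conjI)
    show "lsc_on N e T (lsc_env N e T val)"
      unfolding lsc_on_def
    proof (intro ballI allI impI)
      fix t x c assume tx: "t \<in> {0..<T}" "x \<in> J" and c: "c < lsc_env N e T val t x"
      then have "c < ereal (val t x)" using lsc_env_val by simp
      then obtain z where z: "z < val t x" "c \<le> ereal z"
        by (metis ereal_dense2 less_ereal.simps(1) less_imp_le)
      obtain \<delta> where \<delta>: "\<delta> > 0" "\<And>s y. s \<in> {0..<T} \<Longrightarrow> y \<in> J \<Longrightarrow> \<bar>s - t\<bar> < \<delta> \<and> dJ x y < \<delta> \<Longrightarrow>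
          \<bar>val t x - val s y\<bar> \<le> (val t x - z) / 2"
        using loc[of "(val t x - z) / 2", OF _ tx] z by auto
      show "\<exists>\<delta>>0. \<forall>s\<in>{0..<T}. \<forall>y\<in>J. \<bar>s - t\<bar> < \<delta> \<and> dJ x y < \<delta> \<longrightarrow> c < lsc_env N e T val s y"
      proof (intro exI[of _ \<delta>] conjI ballI impI \<delta>(1))
        fix s y assume sy: "s \<in> {0..<T}" "y \<in> J" "\<bar>s - t\<bar> < \<delta> \<and> dJ x y < \<delta>"
        have "z < val s y" using \<delta>(2)[OF sy] z(1) by argo
        then have "c < ereal (val s y)" using z(2) by (metis less_ereal.simps(1) le_less_trans)
        then show "c < lsc_env N e T val s y" using lsc_env_val[OF sy(1,2)] by simp
      qed
    qed
    show "\<forall>x\<in>J. lsc_env N e T val 0 x \<ge> ereal (u0 x)"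
    proof (cases "T > 0")
      case True
      then show ?thesis using lsc_env_val val_initial by simp
    next
      case False
      then show ?thesis
        by (auto simp: lsc_env_def intro!: SUP_upper2[of 1] Inf_greatest)
    qed
    show "\<forall>\<phi> \<phi>t \<phi>x. C1_star N e T \<phi> \<phi>t \<phi>x \<longrightarrow> (\<forall>t\<in>{0<..<T}. \<forall>x\<in>J. \<forall>r>0.
           (\<forall>s\<in>{0<..<T}. \<forall>y\<in>J. \<bar>s - t\<bar> < r \<and> dJ x y < r \<longrightarrow> lsc_env N e T val s y \<ge> ereal (\<phi> s y))
           \<and> lsc_env N e T val t x = ereal (\<phi> t x) \<longrightarrow>
           (\<forall>i\<in>{1..N}. \<forall>a>0. x = a *\<^sub>R e i \<longrightarrow> \<phi>t t x + Ham (L i) (\<phi>x i t a) \<ge> 0)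
           \<and> (x = 0 \<longrightarrow> \<phi>t t 0 + Max ((\<lambda>i. Ham_minus (L i) (\<phi>x i t 0)) ` {1..N}) \<ge> 0))"
    proof (intro allI ballI impI, elim conjE)
      fix \<phi> \<phi>t \<phi>x t x r
      assume C1: "C1_star N e T \<phi> \<phi>t \<phi>x" and tx: "t \<in> {0<..<T}" "x \<in> J" and r: "(r::real) > 0"
        and ge: "\<forall>s\<in>{0<..<T}. \<forall>y\<in>J. \<bar>s - t\<bar> < r \<and> dJ x y < r \<longrightarrow> lsc_env N e T val s y \<ge> ereal (\<phi> s y)"
        and eq: "lsc_env N e T val t x = ereal (\<phi> t x)"
      have ge': "\<phi> s y \<le> val s y" if "s \<in> {0<..<T}" "y \<in> J" "\<bar>s - t\<bar> < r" "dJ x y < r" for s y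
        using ge[rule_format, OF that(1,2)] that lsc_env_val[of s T y] by simp
      have eq': "val t x = \<phi> t x" using eq lsc_env_val[of t T x] tx by auto
      show "(\<forall>i\<in>{1..N}. \<forall>a>0. x = a *\<^sub>R e i \<longrightarrow> \<phi>t t x + Ham (L i) (\<phi>x i t a) \<ge> 0)
           \<and> (x = 0 \<longrightarrow> \<phi>t t 0 + Max ((\<lambda>i. Ham_minus (L i) (\<phi>x i t 0)) ` {1..N}) \<ge> 0)"
        using val_super_test_branch[OF C1 tx(1) _ _ r] val_super_test_vertex[OF C1 tx(1) r] ge' eq'
        by blast
    qed
  qed
qed

end

section \<open>Sub-solutions are dominated\<close>

text \<open>Without a maximum each x has some \<open>Y x\<close> with a larger value, and the sets
  where f is below \<open>f (Y x)\<close> cover S. The largest \<open>f (Y z)\<close> of a finite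
  subcover is then exceeded by another one.\<close>

lemma usc_attains_max:
  fixes f :: "'a::topological_space \<Rightarrow> real"
  assumes S: "compact S" "S \<noteq> {}"
    and usc: "\<And>x c. x \<in> S \<Longrightarrow> f x < c \<Longrightarrow> \<exists>U. open U \<and> x \<in> U \<and> (\<forall>y\<in>U \<inter> S. f y < c)"
  obtains x where "x \<in> S" "\<And>y. y \<in> S \<Longrightarrow> f y \<le> f x"
proof (rule ccontr)
  assume "\<not> thesis"
  then have "\<forall>x\<in>S. \<exists>y\<in>S. f x < f y" using that by (meson not_le)
  then obtain Y where Y: "\<And>x. x \<in> S \<Longrightarrow> Y x \<in> S" "\<And>x. x \<in> S \<Longrightarrow> f x < f (Y x)" by metis
  then obtain U where U: "\<And>x. x \<in> S \<Longrightarrow> open (U x)" "\<And>x. x \<in> S \<Longrightarrow> x \<in> U x"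
      "\<And>x y. x \<in> S \<Longrightarrow> y \<in> U x \<inter> S \<Longrightarrow> f y < f (Y x)"
    using usc[OF _ Y(2)] by metis
  obtain F where F: "F \<subseteq> S" "finite F" "S \<subseteq> (\<Union>x\<in>F. U x)"
    by (rule compactE_image[OF S(1), of S U]) (use U in auto)
  then have "F \<noteq> {}" using S(2) by auto
  then obtain z where "z \<in> F" and Mz: "Max ((\<lambda>x. f (Y x)) ` F) = f (Y z)"
    using obtains_MAX[OF F(2), of "\<lambda>x. f (Y x)"] by blast
  then have z: "z \<in> F" "\<And>x. x \<in> F \<Longrightarrow> f (Y x) \<le> f (Y z)"
    using F(2) by (auto simp: Mz[symmetric])
  have "Y z \<in> S" using z F Y by blast
  then obtain x where "x \<in> F" "Y z \<in> U x" using F by blast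
  then have "f (Y z) < f (Y x)" using U(3) F \<open>Y z \<in> S\<close> by blast
  then show False using z(2)[OF \<open>x \<in> F\<close>] by simp
qed

context hj_junction begin

lemma usc_onD:
  assumes "usc_on N e T (\<lambda>t x. ereal (h t x))" "t \<in> {0..<T}" "x \<in> J" "h t x < c"
  obtains \<delta> where "\<delta> > 0" "\<And>s y. s \<in> {0..<T} \<Longrightarrow> y \<in> J \<Longrightarrow> \<bar>s - t\<bar> < \<delta> \<Longrightarrow> dJ x y < \<delta> \<Longrightarrow> h s y < c"
  using assms(1)[unfolded usc_on_def, rule_format, OF assms(2,3), of "ereal c"] assms(4) by auto

lemma junction_max:
  assumes usc: "usc_on N e T (\<lambda>t x. ereal (h t x))"
    and cont: "\<And>k. k \<in> {1..N} \<Longrightarrow> continuous_on ({0..<T} \<times> {0..}) (\<lambda>(s, b). G s (b *\<^sub>R e k) :: real)"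
    and I: "I \<subseteq> {1..N}" "I \<noteq> {}" and t: "0 \<le> t0" "t0 \<le> T2" "T2 < T" and r: "0 \<le> r" "r \<le> R"
  obtains k s b where "k \<in> I" "s \<in> {t0..T2}" "b \<in> {r..R}"
    "\<And>k' s' b'. k' \<in> I \<Longrightarrow> s' \<in> {t0..T2} \<Longrightarrow> b' \<in> {r..R} \<Longrightarrow>
      h s' (b' *\<^sub>R e k') + G s' (b' *\<^sub>R e k') \<le> h s (b *\<^sub>R e k) + G s (b *\<^sub>R e k)"
proof -
  \<comment> \<open>The branch index is a discrete coordinate, so the box is compact; the vertex
    occurs once per branch with the same value.\<close>
  define S where "S = I \<times> ({t0..T2} \<times> {r..R})"
  define f where "f = (\<lambda>(k, s, b). h s (b *\<^sub>R e k) + G s (b *\<^sub>R e k))"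
  have "finite I" using I finite_subset by blast
  then have "compact S" unfolding S_def by (intro compact_Times compact_Icc finite_imp_compact)
  moreover have "S \<noteq> {}" using I t r by (auto simp: S_def)
  moreover have "\<exists>U. open U \<and> p \<in> U \<and> (\<forall>y\<in>U \<inter> S. f y < c)" if p: "p \<in> S" and fc: "f p < c" for p c
  proof -
    obtain k s b where p': "p = (k, s, b)" by (cases p) auto
    have k: "k \<in> {1..N}" and s: "s \<in> {0..<T}" and b: "b \<ge> 0"
      using p I t r by (auto simp: S_def p')
    define \<epsilon> where "\<epsilon> = (c - f p) / 2"
    have \<epsilon>: "\<epsilon> > 0" using fc by (simp add: \<epsilon>_def)
    obtain \<delta>1 where \<delta>1: "\<delta>1 > 0" "\<And>s' y. s' \<in> {0..<T} \<Longrightarrow> y \<in> J \<Longrightarrow> \<bar>s' - s\<bar> < \<delta>1 \<Longrightarrow> dJ (b *\<^sub>R e k) y < \<delta>1 \<Longrightarrow>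
        h s' y < h s (b *\<^sub>R e k) + \<epsilon>"
      using usc_onD[OF usc s in_J[OF k b], of "h s (b *\<^sub>R e k) + \<epsilon>"] \<epsilon> by auto
    obtain \<delta>2 where \<delta>2: "\<delta>2 > 0" "\<And>s' b'. s' \<in> {0..<T} \<Longrightarrow> b' \<ge> 0 \<Longrightarrow> dist (s', b') (s, b) < \<delta>2 \<Longrightarrow>
        dist (G s' (b' *\<^sub>R e k)) (G s (b *\<^sub>R e k)) < \<epsilon>"
      using cont[OF k, unfolded continuous_on_iff, rule_format, of "(s, b)" \<epsilon>] s b \<epsilon> by auto
    define \<delta> where "\<delta> = min \<delta>1 \<delta>2"
    show ?thesis
    proof (intro exI[of _ "{k} \<times> ball (s, b) \<delta>"] conjI ballI)
      show "open ({k} \<times> ball (s, b) \<delta>)" by (intro open_Times open_discrete open_ball)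
      show "p \<in> {k} \<times> ball (s, b) \<delta>" using \<delta>1 \<delta>2 by (simp add: p' \<delta>_def)
      fix y assume y: "y \<in> ({k} \<times> ball (s, b) \<delta>) \<inter> S"
      then obtain s' b' where y': "y = (k, s', b')" and d: "dist (s', b') (s, b) < \<delta>"
        by (auto simp: dist_commute)
      have s': "s' \<in> {0..<T}" and b': "b' \<ge> 0"
        using y t r by (auto simp: S_def y')
      have "dist s' s < \<delta>" "dist b' b < \<delta>"
        using d dist_fst_le[of "(s', b')" "(s, b)"] dist_snd_le[of "(s', b')" "(s, b)"] by auto
      then have "h s' (b' *\<^sub>R e k) < h s (b *\<^sub>R e k) + \<epsilon>"
        by (intro \<delta>1(2) s' in_J k b') (use jdist_same[OF k b b'] in \<open>auto simp: dist_real_def \<delta>_def\<close>)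
      moreover have "dist (G s' (b' *\<^sub>R e k)) (G s (b *\<^sub>R e k)) < \<epsilon>"
        using \<delta>2(2)[OF s' b'] d by (simp add: \<delta>_def)
      then have "G s' (b' *\<^sub>R e k) < G s (b *\<^sub>R e k) + \<epsilon>" by (simp add: dist_real_def abs_less_iff)
      ultimately have "f y < f p + 2 * \<epsilon>" by (simp add: f_def y' p')
      moreover have "2 * \<epsilon> = c - f p" by (simp add: \<epsilon>_def)
      ultimately show "f y < c" by simp
    qed
  qed
  ultimately obtain p where p: "p \<in> S" "\<And>y. y \<in> S \<Longrightarrow> f y \<le> f p"
    using usc_attains_max[of S f] by blast
  obtain k s b where p': "p = (k, s, b)" by (cases p) auto
  show ?thesis
  proof (rule that)
    show "k \<in> I" "s \<in> {t0..T2}" "b \<in> {r..R}" using p(1) by (auto simp: S_def p')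
    fix k' s' b' assume "k' \<in> I" "s' \<in> {t0..T2}" "b' \<in> {r..R}"
    then show "h s' (b' *\<^sub>R e k') + G s' (b' *\<^sub>R e k') \<le> h s (b *\<^sub>R e k) + G s (b *\<^sub>R e k)"
      using p(2)[of "(k', s', b')"] by (simp add: f_def S_def p')
  qed
qed

text \<open>The maximum over the box beats the reference point, so it avoids the boundary and is a
  local maximum on the whole junction. For this the box must either stay off the vertex or contain
  all branches at it, which is what \<open>side\<close> says.\<close>

lemma junction_local_max:
  assumes usc: "usc_on N e T (\<lambda>t x. ereal (h t x))"
    and cont: "\<And>k. k \<in> {1..N} \<Longrightarrow> continuous_on ({0..<T} \<times> {0..}) (\<lambda>(s, b). G s (b *\<^sub>R e k) :: real)"
    and I: "I \<subseteq> {1..N}" and t: "0 \<le> t0" "t0 \<le> T2" "T2 < T" and r: "0 \<le> r" "r \<le> R"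
    and side: "r > 0 \<or> I = {1..N} \<and> r = 0"
    and ref: "i \<in> I" "t1 \<in> {t0..T2}" "x1 \<in> {r..R}"
    and bd: "\<And>k s b. k \<in> I \<Longrightarrow> s \<in> {t0..T2} \<Longrightarrow> b \<in> {r..R} \<Longrightarrow>
      s = t0 \<or> s = T2 \<or> b = R \<or> (r > 0 \<and> b = r) \<Longrightarrow>
      h s (b *\<^sub>R e k) + G s (b *\<^sub>R e k) < h t1 (x1 *\<^sub>R e i) + G t1 (x1 *\<^sub>R e i)"
  obtains k s b \<rho> where "k \<in> I" "s \<in> {t0<..<T2}" "b \<in> {r..R}" "b = 0 \<Longrightarrow> r = 0" "\<rho> > 0"
    "\<And>s' y. y \<in> J \<Longrightarrow> \<bar>s' - s\<bar> < \<rho> \<Longrightarrow> dJ (b *\<^sub>R e k) y < \<rho> \<Longrightarrow>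
      h s' y + G s' y \<le> h s (b *\<^sub>R e k) + G s (b *\<^sub>R e k)"
proof -
  obtain k s b where *: "k \<in> I" "s \<in> {t0..T2}" "b \<in> {r..R}"
    and max: "\<And>k' s' b'. k' \<in> I \<Longrightarrow> s' \<in> {t0..T2} \<Longrightarrow> b' \<in> {r..R} \<Longrightarrow>
      h s' (b' *\<^sub>R e k') + G s' (b' *\<^sub>R e k') \<le> h s (b *\<^sub>R e k) + G s (b *\<^sub>R e k)"
    by (rule junction_max[OF usc, of G I t0 T2 r R]) (use cont I t r ref in auto)
  have int: "s \<noteq> t0" "s \<noteq> T2" "b \<noteq> R" "r > 0 \<Longrightarrow> b \<noteq> r"
    using bd[OF *] max[OF ref] by (auto simp: not_less)
  define \<rho> where "\<rho> = min (min (s - t0) (T2 - s)) (min (R - b) (if b > 0 then b - r else 1))"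
  have \<rho>: "\<rho> > 0" "\<rho> \<le> s - t0" "\<rho> \<le> T2 - s" "\<rho> \<le> R - b" "b > 0 \<Longrightarrow> \<rho> \<le> b - r"
    using int * r side by (auto simp: \<rho>_def)
  have k: "k \<in> {1..N}" and b: "b \<ge> 0" using * I r by auto
  show ?thesis
  proof (rule that[OF *(1) _ *(3) _ \<rho>(1)])
    show "s \<in> {t0<..<T2}" using * int by auto
    show "r = 0" if "b = 0" using that * r by auto
    fix s' y assume y: "y \<in> J" and d: "\<bar>s' - s\<bar> < \<rho>" "dJ (b *\<^sub>R e k) y < \<rho>"
    obtain k' b' where y': "k' \<in> {1..N}" "b' \<ge> 0" "y = b' *\<^sub>R e k'" using y by (rule J_cases)
    have c: "b = 0 \<or> k' = k" "dJ (b *\<^sub>R e k) y = \<bar>b' - b\<bar>"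
      using small_ball_coord[OF k y'(1) b y'(2), of \<rho>] \<rho>(5) r d(2) y'(3) by fastforce+
    have "k' \<in> I" using c(1) * side y' r by auto
    moreover have "b' \<in> {r..R}"
    proof (cases "b > 0")
      case True
      then show ?thesis using \<rho>(4,5) d(2) c(2) by auto
    next
      case False
      then show ?thesis using * r b y' d(2) c(2) \<rho>(4) side by auto
    qed
    moreover have "s' \<in> {t0..T2}" using d(1) \<rho>(2,3) by auto
    ultimately show "h s' y + G s' y \<le> h s (b *\<^sub>R e k) + G s (b *\<^sub>R e k)"
      using max[of k' s' b'] y' by simp
  qed
qed

section \<open>Gluing and shifting test functions\<close>

lemma C1_star_glue:
  assumes "\<And>k t a. k \<in> {1..N} \<Longrightarrow> t \<in> {0<..<T} \<Longrightarrow> a \<ge> 0 \<Longrightarrow>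
      ((\<lambda>(s, b). g k s b) has_derivative (\<lambda>(ds, db). ds * gt k t a + db * gx k t a)) (at (t, a) within {0<..<T} \<times> {0..})"
    and "\<And>k. k \<in> {1..N} \<Longrightarrow> continuous_on ({0<..<T} \<times> {0..}) (\<lambda>(s, b). gt k s b)"
    and "\<And>k. k \<in> {1..N} \<Longrightarrow> continuous_on ({0<..<T} \<times> {0..}) (\<lambda>(s, b). gx k s b)"
    and g0: "\<And>k s. k \<in> {1..N} \<Longrightarrow> g k s 0 = g 1 s 0"
    and gt0: "\<And>k s. k \<in> {1..N} \<Longrightarrow> gt k s 0 = gt 1 s 0"
  shows "C1_star N e T (\<lambda>s. glue_branches (\<lambda>k. g k s)) (\<lambda>s. glue_branches (\<lambda>k. gt k s)) gx"
  unfolding C1_star_def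
proof (intro ballI allI impI conjI)
  have G: "glue_branches (\<lambda>k. g k s) (b *\<^sub>R e k) = g k s b"
    "glue_branches (\<lambda>k. gt k s) (b *\<^sub>R e k) = gt k s b" if "k \<in> {1..N}" "b \<ge> 0" for k s b
    using glue_branches_coord[OF that, of "\<lambda>k. g k s", OF g0]
      glue_branches_coord[OF that, of "\<lambda>k. gt k s", OF gt0] by blast+
  fix k assume k: "k \<in> {1..N}"
  show "continuous_on ({0<..<T} \<times> {0..}) (\<lambda>(s, b). gx k s b)" using assms(3) k .
  show "continuous_on ({0<..<T} \<times> {0..}) (\<lambda>(s, b). glue_branches (\<lambda>k. gt k s) (b *\<^sub>R e k))"
    by (rule continuous_on_eq[OF assms(2)[OF k]]) (use G(2)[OF k] in auto)
  fix t a assume ta: "t \<in> {0<..<T}" "(a::real) \<ge> 0"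
  show "((\<lambda>(s, b). glue_branches (\<lambda>k. g k s) (b *\<^sub>R e k)) has_derivative
      (\<lambda>(ds, db). ds * glue_branches (\<lambda>k. gt k t) (a *\<^sub>R e k) + db * gx k t a)) (at (t, a) within {0<..<T} \<times> {0..})"
    unfolding G(2)[OF k ta(2)]
    by (rule has_derivative_transform[OF _ _ assms(1)[OF k ta]]) (use G(1)[OF k] ta in auto)
qed

lemma C1_star_add_const:
  assumes "C1_star N e T \<phi> \<phi>t \<phi>x"
  shows "C1_star N e T (\<lambda>s y. \<phi> s y + c) \<phi>t \<phi>x"
proof -
  have "((\<lambda>(s, b). \<phi> s (b *\<^sub>R e i) + c) has_derivative (\<lambda>(ds, db). ds * \<phi>t t (a *\<^sub>R e i) + db * \<phi>x i t a))
         (at (t, a) within {0<..<T} \<times> {0..})" if "i \<in> {1..N}" "t \<in> {0<..<T}" "a \<ge> 0" for i t a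
    using has_derivative_add_const[OF C1_starD[OF assms that], of c] by (simp add: case_prod_unfold)
  then show ?thesis using assms unfolding C1_star_def by blast
qed

text \<open>Adding a constant makes \<phi> touch w. A bound on the maximum over branches is a bound
  on every branch, while for super-solutions it singles out only one.\<close>

lemma visc_sub_local_max:
  assumes sub: "visc_sub N e L T u0 (\<lambda>t x. ereal (w t x))" and C1: "C1_star N e T \<phi> \<phi>t \<phi>x"
    and t: "t \<in> {0<..<T}" and x: "x \<in> J" and r: "r > 0"
    and max: "\<And>s y. y \<in> J \<Longrightarrow> \<bar>s - t\<bar> < r \<Longrightarrow> dJ x y < r \<Longrightarrow> w s y - \<phi> s y \<le> w t x - \<phi> t x"
  shows "i \<in> {1..N} \<Longrightarrow> a > 0 \<Longrightarrow> x = a *\<^sub>R e i \<Longrightarrow> \<phi>t t x + Ham (L i) (\<phi>x i t a) \<le> 0"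
    and "x = 0 \<Longrightarrow> i \<in> {1..N} \<Longrightarrow> \<phi>t t 0 + Ham_minus (L i) (\<phi>x i t 0) \<le> 0"
proof -
  define c where "c = w t x - \<phi> t x"
  have *: "(\<forall>i\<in>{1..N}. \<forall>a>0. x = a *\<^sub>R e i \<longrightarrow> \<phi>t t x + Ham (L i) (\<phi>x i t a) \<le> 0)
           \<and> (x = 0 \<longrightarrow> \<phi>t t 0 + Max ((\<lambda>i. Ham_minus (L i) (\<phi>x i t 0)) ` {1..N}) \<le> 0)"
  proof (rule sub[unfolded visc_sub_def, THEN conjunct2, THEN conjunct1, rule_format,
        OF C1_star_add_const[OF C1, of c] t x r], intro conjI ballI impI)
    fix s y assume "y \<in> J" "\<bar>s - t\<bar> < r \<and> dJ x y < r"
    then show "ereal (w s y) \<le> ereal (\<phi> s y + c)" using max[of y s] by (simp add: c_def)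
  qed (simp add: c_def)
  then show "i \<in> {1..N} \<Longrightarrow> a > 0 \<Longrightarrow> x = a *\<^sub>R e i \<Longrightarrow> \<phi>t t x + Ham (L i) (\<phi>x i t a) \<le> 0" by blast
  assume x0: "x = 0" and i: "i \<in> {1..N}"
  have "Ham_minus (L i) (\<phi>x i t 0) \<le> Max ((\<lambda>i. Ham_minus (L i) (\<phi>x i t 0)) ` {1..N})"
    by (rule Max_ge) (use i in auto)
  then show "\<phi>t t 0 + Ham_minus (L i) (\<phi>x i t 0) \<le> 0" using * x0 by auto
qed

lemma visc_super_local_min:
  assumes super: "visc_super N e L T u0 (\<lambda>t x. ereal (w t x))" and C1: "C1_star N e T \<phi> \<phi>t \<phi>x"
    and t: "t \<in> {0<..<T}" and x: "x \<in> J" and r: "r > 0"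
    and min: "\<And>s y. y \<in> J \<Longrightarrow> \<bar>s - t\<bar> < r \<Longrightarrow> dJ x y < r \<Longrightarrow> w t x - \<phi> t x \<le> w s y - \<phi> s y"
  shows "i \<in> {1..N} \<Longrightarrow> a > 0 \<Longrightarrow> x = a *\<^sub>R e i \<Longrightarrow> \<phi>t t x + Ham (L i) (\<phi>x i t a) \<ge> 0"
    and "x = 0 \<Longrightarrow> \<exists>i\<in>{1..N}. \<phi>t t 0 + Ham_minus (L i) (\<phi>x i t 0) \<ge> 0"
proof -
  define c where "c = w t x - \<phi> t x"
  have *: "(\<forall>i\<in>{1..N}. \<forall>a>0. x = a *\<^sub>R e i \<longrightarrow> \<phi>t t x + Ham (L i) (\<phi>x i t a) \<ge> 0)
           \<and> (x = 0 \<longrightarrow> \<phi>t t 0 + Max ((\<lambda>i. Ham_minus (L i) (\<phi>x i t 0)) ` {1..N}) \<ge> 0)"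
  proof (rule super[unfolded visc_super_def, THEN conjunct2, THEN conjunct1, rule_format,
        OF C1_star_add_const[OF C1, of c] t x r], intro conjI ballI impI)
    fix s y assume "y \<in> J" "\<bar>s - t\<bar> < r \<and> dJ x y < r"
    then show "ereal (\<phi> s y + c) \<le> ereal (w s y)" using min[of y s] by (simp add: c_def)
  qed (simp add: c_def)
  then show "i \<in> {1..N} \<Longrightarrow> a > 0 \<Longrightarrow> x = a *\<^sub>R e i \<Longrightarrow> \<phi>t t x + Ham (L i) (\<phi>x i t a) \<ge> 0" by blast
  assume x0: "x = 0"
  have "Max ((\<lambda>i. Ham_minus (L i) (\<phi>x i t 0)) ` {1..N}) \<in> (\<lambda>i. Ham_minus (L i) (\<phi>x i t 0)) ` {1..N}"
    by (rule Max_in) (use N_ge in auto)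
  then show "\<exists>i\<in>{1..N}. \<phi>t t 0 + Ham_minus (L i) (\<phi>x i t 0) \<ge> 0" using * x0 by auto
qed

section \<open>Sub-solutions along a single line\<close>

lemma u0_le: "i \<in> {1..N} \<Longrightarrow> a \<ge> 0 \<Longrightarrow> \<bar>u0 (a *\<^sub>R e i)\<bar> \<le> \<bar>u0 0\<bar> + K0 * a"
  using u0_lipschitz[OF in_J[of i a] zero_in_J] jdist_zero(2)[of i a] by simp

text \<open>If the inequality failed, w minus the penalised line function would have a local maximum
  strictly inside a box around the line. There the single velocity q contradicts the sub-solution
  test; on another branch velocity 1 does. The case excluded by \<open>dir\<close>, a line leaving
  the vertex, is treated in \<open>sub_dominated\<close>.\<close>

lemma sub_line:
  assumes sub: "visc_sub N e L T u0 (\<lambda>t x. ereal (w t x))"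
    and bound: "\<And>t x. t \<in> {0..<T} \<Longrightarrow> x \<in> J \<Longrightarrow> w t x \<le> u0 x + C1"
    and i: "i \<in> {1..N}" and t: "0 \<le> t0" "t0 < t1" "t1 < T"
    and x0: "x0 \<ge> 0" and x1: "x0 + q * (t1 - t0) \<ge> 0" and dir: "q \<le> 0 \<or> x0 > 0"
  shows "w t1 ((x0 + q * (t1 - t0)) *\<^sub>R e i) \<le> w t0 (x0 *\<^sub>R e i) + (t1 - t0) * L i q"
proof (rule ccontr)
  define w0 where "w0 = w t0 (x0 *\<^sub>R e i)"
  define w1 where "w1 = w t1 ((x0 + q * (t1 - t0)) *\<^sub>R e i)"
  define \<theta> where "\<theta> = (w1 - w0 - (t1 - t0) * L i q) / 3"
  assume "\<not> ?thesis"
  then have \<theta>: "\<theta> > 0" by (simp add: \<theta>_def w0_def w1_def)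
  have w1: "w1 = w0 + (t1 - t0) * L i q + 3 * \<theta>" by (simp add: \<theta>_def field_simps)
  have usc: "usc_on N e T (\<lambda>t x. ereal (w t x))" using sub by (simp add: visc_sub_def)
  define X where "X s = x0 + q * (s - t0)" for s
  define Xm where "Xm = x0 + \<bar>q\<bar> * T"
  define R where "R = Xm + 1"
  \<comment> \<open>A line with q > 0 stays at or above x0 > 0, so a box on branch i off the vertex
    is enough. A line with q \<le> 0 may reach the vertex, and the box must contain all
    branches.\<close>
  define I where "I = (if q \<le> 0 then {1..N} else {i})"
  define r where "r = (if q \<le> 0 then 0 else x0 / 2)"
  have Xm: "\<bar>X s\<bar> \<le> Xm" if "s \<in> {t0..<T}" for s
  proof -
    have "\<bar>q * (s - t0)\<bar> \<le> \<bar>q\<bar> * T"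
      unfolding abs_mult using that t by (intro mult_left_mono) auto
    then show ?thesis using x0 unfolding X_def Xm_def by linarith
  qed
  have Xm0: "x0 \<le> Xm" "0 \<le> Xm" using t x0 by (auto simp: Xm_def)
  define Wb where "Wb = \<bar>u0 0\<bar> + K0 * R + C1"
  have Wb: "w s (b *\<^sub>R e k) \<le> Wb" if "s \<in> {0..<T}" "k \<in> {1..N}" "b \<in> {0..R}" for s k b
  proof -
    have "K0 * b \<le> K0 * R" using that K0_nonneg by (intro mult_left_mono) auto
    then show ?thesis
      using bound[OF that(1) in_J[OF that(2)], of b] u0_le[OF that(2), of b] that(3) unfolding Wb_def by auto
  qed
  \<comment> \<open>A penalty of size Z pushes the penalised value below w0, as \<open>far\<close>
    records.\<close>
  define Z where "Z = \<bar>Wb\<bar> + \<bar>w0\<bar> + \<bar>L i q\<bar> * T + 1"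
  have Z: "Z > 0" "Wb + \<bar>L i q\<bar> * T - Z < w0"
    using t by (auto simp: Z_def add_nonneg_pos)
  \<comment> \<open>The time penalty is exactly \<theta> at t1 and reaches Z at the time T2 chosen
    next.\<close>
  define \<sigma> where "\<sigma> = \<theta> * (T - t1)"
  have \<sigma>: "\<sigma> > 0" "\<sigma> / (T - t1) = \<theta>" using \<theta> t by (auto simp: \<sigma>_def)
  define T2 where "T2 = T - min ((T - t1) / 2) (\<sigma> / Z)"
  have T2: "t1 < T2" "T2 < T" and T2Z: "\<sigma> / (T - T2) \<ge> Z"
  proof -
    have m: "min ((T - t1) / 2) (\<sigma> / Z) > 0" using t \<sigma> Z by auto
    then show "T2 < T" by (simp add: T2_def)
    have "min ((T - t1) / 2) (\<sigma> / Z) \<le> (T - t1) / 2" by (rule min.cobounded1)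
    also have "\<dots> < T - t1" using t by simp
    finally show "t1 < T2" by (simp add: T2_def)
    have "Z * (T - T2) \<le> Z * (\<sigma> / Z)" unfolding T2_def using Z by (intro mult_left_mono) auto
    then show "\<sigma> / (T - T2) \<ge> Z" using Z m by (simp add: T2_def le_divide_eq)
  qed
  obtain \<delta> where \<delta>: "\<delta> > 0" "\<And>s y. s \<in> {0..<T} \<Longrightarrow> y \<in> J \<Longrightarrow> \<bar>s - t0\<bar> < \<delta> \<Longrightarrow> dJ (x0 *\<^sub>R e i) y < \<delta> \<Longrightarrow>
      w s y < w0 + \<theta>"
    by (rule usc_onD[OF usc, of t0 "x0 *\<^sub>R e i" "w0 + \<theta>"]) (use t \<theta> in_J[OF i x0] w0_def in auto)
  \<comment> \<open>Half of \<delta>, because off branch i the distance x0 + b \<ge> \<delta> only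
    makes one of the summands \<ge> \<delta>/2. The bounds 1 and x0/2 handle the edges b = R and b =
    r. K then makes the quadratic reach Z at distance \<omega>.\<close>
  define \<omega> where "\<omega> = min (min 1 (\<delta> / 2)) (if q \<le> 0 then 1 else x0 / 2)"
  have \<omega>: "\<omega> > 0" "\<omega> \<le> 1" "\<omega> \<le> \<delta> / 2" "\<not> q \<le> 0 \<Longrightarrow> \<omega> \<le> x0 / 2"
    using \<delta>(1) dir by (auto simp: \<omega>_def)
  define K where "K = Z / \<omega>\<^sup>2"
  have K: "K > 0" and KZ: "Z \<le> K * y\<^sup>2" if "\<bar>y\<bar> \<ge> \<omega>" for y
  proof -
    show K: "K > 0" using Z \<omega> by (simp add: K_def)
    have "\<omega>\<^sup>2 \<le> \<bar>y\<bar>\<^sup>2" using that \<omega> by (intro power_mono) auto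
    then have "K * \<omega>\<^sup>2 \<le> K * y\<^sup>2" using K by simp
    then show "Z \<le> K * y\<^sup>2" using \<omega> by (simp add: K_def)
  qed
  have K: "K > 0" by (rule K[of \<omega>]) (use \<omega> in simp)
  \<comment> \<open>M does two jobs: \<open>M * b\<close> reaches Z at b = \<omega>, and
    \<open>M - L k 1\<close>, a lower bound for the Hamiltonian at slope M, outweighs the remaining
    time derivative on branches other than i.\<close>
  define M where "M = Z / \<omega> + \<bar>L i q\<bar> + 2 * K * \<bar>q\<bar> * Xm + (\<Sum>k\<in>{1..N}. \<bar>L k 1\<bar>) + 1"
  have Mge: "M \<ge> Z / \<omega>" "M - L k 1 > \<bar>L i q\<bar> + 2 * K * \<bar>q\<bar> * Xm" if "k \<in> {1..N}" for k
  proof -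
    have "\<bar>L k 1\<bar> \<le> (\<Sum>k\<in>{1..N}. \<bar>L k 1\<bar>)" using member_le_sum[OF that, of "\<lambda>k. \<bar>L k 1\<bar>"] by simp
    moreover have "2 * K * \<bar>q\<bar> * Xm \<ge> 0" "Z / \<omega> > 0" using K Xm0 Z \<omega> by auto
    ultimately show "M \<ge> Z / \<omega>" "M - L k 1 > \<bar>L i q\<bar> + 2 * K * \<bar>q\<bar> * Xm" unfolding M_def by linarith+
  qed
  have M0: "M \<ge> 0" using Mge(1)[OF i] Z \<omega> by (meson divide_pos_pos less_imp_le order_trans)
  have MZ: "Z \<le> M * b" if "b \<ge> \<omega>" for b
  proof -
    have "Z / \<omega> * \<omega> \<le> M * b" using Mge(1)[OF i] that \<omega> M0 by (intro mult_mono) auto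
    then show ?thesis using \<omega> by simp
  qed
  define pen where "pen k s b = (if k = i then K * (b - X s)\<^sup>2 else K * (X s)\<^sup>2 + M * b)" for k s b
  define g where "g k s b = L i q * (s - t0) + \<sigma> / (T - s) + pen k s b" for k s b
  define gt where "gt k s b = L i q + \<sigma> / (T - s)\<^sup>2 + (if k = i then - 2 * K * q * (b - X s) else 2 * K * q * X s)"
    for k s b
  define gx where "gx k s b = (if k = i then 2 * K * (b - X s) else M)" for k s b
  define \<Phi> where "\<Phi> s = glue_branches (\<lambda>k. g k s)" for s
  define \<Phi>t where "\<Phi>t s = glue_branches (\<lambda>k. gt k s)" for s
  have g0: "g k s 0 = g 1 s 0" "gt k s 0 = gt 1 s 0" for k s by (auto simp: g_def gt_def pen_def)
  have \<Phi>: "\<Phi> s (b *\<^sub>R e k) = g k s b" "\<Phi>t s (b *\<^sub>R e k) = gt k s b" if "k \<in> {1..N}" "b \<ge> 0" for k s b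
    unfolding \<Phi>_def \<Phi>t_def
    using glue_branches_coord[OF that, of "\<lambda>k. g k s", OF g0(1)]
      glue_branches_coord[OF that, of "\<lambda>k. gt k s", OF g0(2)] by blast+
  have C1: "C1_star N e T \<Phi> \<Phi>t gx"
    unfolding \<Phi>_def \<Phi>t_def
  proof (rule C1_star_glue)
    fix k t a assume "t \<in> {0<..<T}"
    then show "((\<lambda>(s, b). g k s b) has_derivative (\<lambda>(ds, db). ds * gt k t a + db * gx k t a)) (at (t, a) within {0<..<T} \<times> {0..})"
      unfolding g_def gt_def gx_def pen_def X_def case_prod_unfold
      by (cases "k = i") (auto intro!: derivative_eq_intros simp: field_simps power2_eq_square)
  next
    fix k
    show "continuous_on ({0<..<T} \<times> {0..}) (\<lambda>(s, b). gt k s b)"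
      "continuous_on ({0<..<T} \<times> {0..}) (\<lambda>(s, b). gx k s b)"
      unfolding gt_def gx_def X_def case_prod_unfold
      by (cases "k = i"; force intro!: continuous_intros)+
  qed (rule g0)+
  have pen0: "pen k s b \<ge> 0" if "b \<ge> 0" for k s b using K M0 that by (simp add: pen_def)
  have cost: "- (L i q * (s - t0)) \<le> \<bar>L i q\<bar> * T" if "s \<in> {t0..<T}" for s
  proof -
    have "\<bar>L i q * (s - t0)\<bar> \<le> \<bar>L i q\<bar> * T" unfolding abs_mult using that t by (intro mult_left_mono) auto
    then show ?thesis by linarith
  qed
  have I: "I \<subseteq> {1..N}" "i \<in> I" using i by (auto simp: I_def)
  have far: "w s (b *\<^sub>R e k) - \<Phi> s (b *\<^sub>R e k) < w0 + 2 * \<theta>"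
    if "k \<in> I" "s \<in> {t0..T2}" "b \<in> {0..R}" "pen k s b + \<sigma> / (T - s) \<ge> Z" for k s b
  proof -
    have "w s (b *\<^sub>R e k) \<le> Wb" by (rule Wb) (use that I t T2 in auto)
    moreover have "\<Phi> s (b *\<^sub>R e k) = g k s b" using \<Phi> that I by auto
    moreover have "- (L i q * (s - t0)) \<le> \<bar>L i q\<bar> * T" by (rule cost) (use that T2 in auto)
    ultimately show ?thesis using that(4) Z(2) \<theta> unfolding g_def by linarith
  qed
  have X1: "X t1 = x0 + q * (t1 - t0)" by (simp add: X_def)
  \<comment> \<open>Of the excess 3\<theta> the time penalty uses up \<theta>; on the line the
    spatial penalty vanishes.\<close>
  have ref: "w t1 (X t1 *\<^sub>R e i) - \<Phi> t1 (X t1 *\<^sub>R e i) = w0 + 2 * \<theta>"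
    using \<Phi>(1)[OF i] x1 \<sigma>(2) w1 by (simp add: X1 g_def pen_def w1_def)
  have r: "0 \<le> r" "r \<le> R" "r \<le> X t1" "X t1 \<le> R"
  proof -
    show "0 \<le> r" "r \<le> R" using x0 Xm0 by (auto simp: r_def R_def)
    show "X t1 \<le> R" using Xm[of t1] t by (auto simp: R_def)
    show "r \<le> X t1" using x0 x1 t by (auto simp: r_def X1 add_increasing2)
  qed
  obtain k s b \<rho> where ksb: "k \<in> I" "s \<in> {t0<..<T2}" "b \<in> {r..R}" "b = 0 \<Longrightarrow> r = 0" and \<rho>: "\<rho> > 0"
    and max: "\<And>s' y. y \<in> J \<Longrightarrow> \<bar>s' - s\<bar> < \<rho> \<Longrightarrow> dJ (b *\<^sub>R e k) y < \<rho> \<Longrightarrow>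
      w s' y + - \<Phi> s' y \<le> w s (b *\<^sub>R e k) + - \<Phi> s (b *\<^sub>R e k)"
  proof (rule junction_local_max[OF usc, of "\<lambda>s y. - \<Phi> s y" I t0 T2 r R i t1 "X t1"])
    show "continuous_on ({0..<T} \<times> {0..}) (\<lambda>(s, b). - \<Phi> s (b *\<^sub>R e k))" if "k \<in> {1..N}" for k
    proof (rule continuous_on_eq[of _ "\<lambda>(s, b). - g k s b"])
      show "continuous_on ({0..<T} \<times> {0..}) (\<lambda>(s, b). - g k s b)"
        unfolding g_def pen_def X_def case_prod_unfold
        by (cases "k = i"; force intro!: continuous_intros)
    qed (use \<Phi>(1)[OF that] in auto)
    show "r > 0 \<or> I = {1..N} \<and> r = 0" using dir by (auto simp: r_def I_def)
    fix k s b
    assume *: "k \<in> I" "s \<in> {t0..T2}" "b \<in> {r..R}" "s = t0 \<or> s = T2 \<or> b = R \<or> (r > 0 \<and> b = r)"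
    have k: "k \<in> {1..N}" and b: "b \<ge> 0" "b \<in> {0..R}" and s: "s \<in> {t0..<T}" using * I r T2 by auto
    have \<sigma>s: "\<sigma> / (T - s) > 0" using \<sigma> s by auto
    have "w s (b *\<^sub>R e k) - \<Phi> s (b *\<^sub>R e k) < w0 + 2 * \<theta>"
    proof (cases "s = t0 \<and> dJ (x0 *\<^sub>R e i) (b *\<^sub>R e k) < \<delta>")
      case True
      then have "w s (b *\<^sub>R e k) < w0 + \<theta>" using \<delta> t in_J[OF k b(1)] by auto
      moreover have "\<Phi> s (b *\<^sub>R e k) \<ge> 0"
        using \<Phi>(1)[OF k b(1)] pen0[OF b(1)] True \<sigma>s by (simp add: g_def)
      ultimately show ?thesis using \<theta> by linarith
    next
      case False
      consider "s = t0" "dJ (x0 *\<^sub>R e i) (b *\<^sub>R e k) \<ge> \<delta>" | "s = T2" | "b = R" | "r > 0" "b = r"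
        using False *(4) by fastforce
      then have "pen k s b + \<sigma> / (T - s) \<ge> Z"
      proof cases
        case 1
        have "pen k s b \<ge> Z"
        proof (cases "k = i")
          case True
          then have "\<bar>b - X s\<bar> \<ge> \<omega>" using 1 jdist_same[OF i x0 b(1)] \<omega> by (auto simp: X_def)
          then show ?thesis using KZ True by (simp add: pen_def)
        next
          case False
          then have "x0 + b \<ge> \<delta>" using 1 jdist_other[OF i k _ x0 b(1)] by auto
          then consider "\<bar>X s\<bar> \<ge> \<omega>" | "b \<ge> \<omega>" using \<omega> 1 by (fastforce simp: X_def)
          then show ?thesis
          proof cases
            case 1
            moreover have "M * b \<ge> 0" using M0 b by simp
            ultimately show ?thesis using KZ[of "X s"] False by (simp add: pen_def)
          next
            case 2
            moreover have "K * (X s)\<^sup>2 \<ge> 0" using K by simp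
            ultimately show ?thesis using MZ False by (simp add: pen_def add_increasing)
          qed
        qed
        then show ?thesis using \<sigma>s by linarith
      next
        case 2
        then show ?thesis using T2Z pen0[OF b(1), of k s] by simp
      next
        case 3
        have "pen k s b \<ge> Z"
        proof (cases "k = i")
          case True
          have "\<bar>b - X s\<bar> \<ge> \<omega>" using 3 Xm[OF s] \<omega>(2) unfolding R_def by linarith
          then show ?thesis using KZ True by (simp add: pen_def)
        next
          case False
          have "b \<ge> \<omega>" using 3 Xm0 \<omega>(2) unfolding R_def by linarith
          then have "Z \<le> M * b" by (rule MZ)
          moreover have "K * (X s)\<^sup>2 \<ge> 0" using K by simp
          ultimately show ?thesis using False by (simp add: pen_def)
        qed
        then show ?thesis using \<sigma>s by linarith
      next
        case 4
        then have q: "\<not> q \<le> 0" by (auto simp: r_def)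
        then have "X s \<ge> x0" using s by (simp add: X_def)
        then have "\<bar>b - X s\<bar> \<ge> \<omega>" using 4 q \<omega>(4) x0 by (auto simp: r_def)
        moreover have "k = i" using *(1) q by (simp add: I_def)
        ultimately have "pen k s b \<ge> Z" using KZ by (simp add: pen_def)
        then show ?thesis using \<sigma>s by linarith
      qed
      then show ?thesis using far[OF *(1,2) b(2)] by blast
    qed
    then show "w s (b *\<^sub>R e k) + - \<Phi> s (b *\<^sub>R e k) < w t1 (X t1 *\<^sub>R e i) + - \<Phi> t1 (X t1 *\<^sub>R e i)"
      using ref by simp
  qed (use I t T2 r in auto)
  have k: "k \<in> {1..N}" and b: "b \<ge> 0" and s: "s \<in> {0<..<T}" using ksb I r t T2 by auto
  have "0 < \<sigma> / (T - s)\<^sup>2" using \<sigma> s by auto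
  note test = visc_sub_local_max[OF sub C1 s in_J[OF k b] \<rho>]
  have max': "w s' y - \<Phi> s' y \<le> w s (b *\<^sub>R e k) - \<Phi> s (b *\<^sub>R e k)"
    if "y \<in> J" "\<bar>s' - s\<bar> < \<rho>" "dJ (b *\<^sub>R e k) y < \<rho>" for s' y
    using max[OF that] by simp
  \<comment> \<open>The quadratic is transported with velocity q, so its contributions cancel
    whatever K is, and only the strict term survives.\<close>
  have line: "gt i s b + (gx i s b * q - L i q) = \<sigma> / (T - s)\<^sup>2" by (simp add: gt_def gx_def algebra_simps)
  consider "b = 0" | "b > 0" "k = i" | "b > 0" "k \<noteq> i" using b by linarith
  then show False
  proof cases
    case 1
    then have q: "q \<le> 0" using ksb(4) dir by (auto simp: r_def split: if_splits)
    have "\<Phi>t s 0 + Ham_minus (L i) (gx i s 0) \<le> 0"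
      using test(2)[OF max' _ i] 1 by simp
    moreover have "\<Phi>t s 0 = gt i s 0" using \<Phi>(2)[OF i, of 0 s] by simp
    ultimately show False
      using Ham_minus_ge[OF i q, of "gx i s 0"] line[unfolded 1] \<open>0 < \<sigma> / (T - s)\<^sup>2\<close> by linarith
  next
    case 2
    then have "gt i s b + Ham (L i) (gx i s b) \<le> 0"
      using test(1)[OF max' k 2(1)] \<Phi>(2)[OF k b] by simp
    then show False
      using Ham_ge[OF i, of "gx i s b" q] line \<open>0 < \<sigma> / (T - s)\<^sup>2\<close> by linarith
  next
    case 3
    have "gt k s b + Ham (L k) (gx k s b) \<le> 0"
      using test(1)[OF max' k 3(1)] \<Phi>(2)[OF k b] by simp
    then have "L i q + \<sigma> / (T - s)\<^sup>2 + 2 * K * q * X s + (M - L k 1) \<le> 0"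
      using Ham_ge[OF k, of M 1] 3 by (simp add: gt_def gx_def)
    moreover have "\<bar>2 * K * q * X s\<bar> \<le> 2 * K * \<bar>q\<bar> * Xm"
      unfolding abs_mult using Xm[of s] ksb T2 K by (intro mult_mono) auto
    ultimately show False
      using Mge(2)[OF k] \<open>0 < \<sigma> / (T - s)\<^sup>2\<close> by linarith
  qed
qed

text \<open>The remaining lines start at the vertex with q > 0. Such a line is started a short time
  m later, where w exceeds its value at the vertex by less than \<epsilon>/2 by semicontinuity; the
  skipped action is another \<epsilon>/2.\<close>

lemma sub_dominated:
  assumes sub: "visc_sub N e L T u0 (\<lambda>t x. ereal (w t x))"
    and bound: "\<And>t x. t \<in> {0..<T} \<Longrightarrow> x \<in> J \<Longrightarrow> w t x \<le> u0 x + C1"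
  shows "dominated {0..<T} w"
  unfolding dominated_def
proof (intro ballI allI impI, elim conjE)
  fix i t h a q
  assume i: "i \<in> {1..N}" and t: "t \<in> {0..<T}" and h: "(h::real) \<ge> 0" and a: "a \<ge> 0"
    and th: "t + h \<in> {0..<T}" and aq: "0 \<le> a + q * h"
  have usc: "usc_on N e T (\<lambda>t x. ereal (w t x))" using sub by (simp add: visc_sub_def)
  consider "h = 0" | "h > 0" "q \<le> 0 \<or> a > 0" | "h > 0" "a = 0" "q > 0" using h a by linarith
  then show "w (t + h) ((a + q * h) *\<^sub>R e i) \<le> w t (a *\<^sub>R e i) + h * L i q"
  proof cases
    case 1
    then show ?thesis by simp
  next
    case 2
    then show ?thesis
      using sub_line[OF sub bound i, of t "t + h" a q] t th a aq by simp
  next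
    case 3
    show ?thesis
    proof (rule field_le_epsilon)
      fix \<epsilon> :: real assume \<epsilon>: "\<epsilon> > 0"
      obtain \<delta> where \<delta>: "\<delta> > 0" "\<And>s y. s \<in> {0..<T} \<Longrightarrow> y \<in> J \<Longrightarrow> \<bar>s - t\<bar> < \<delta> \<Longrightarrow> dJ (a *\<^sub>R e i) y < \<delta> \<Longrightarrow>
          w s y < w t (a *\<^sub>R e i) + \<epsilon> / 2"
        by (rule usc_onD[OF usc t in_J[OF i a], of "w t (a *\<^sub>R e i) + \<epsilon> / 2"]) (use \<epsilon> in auto)
      define m where "m = min (min (h / 2) (\<delta> / 2)) (min (\<delta> / (2 * q)) (\<epsilon> / (2 * (\<bar>L i q\<bar> + 1))))"
      have m: "m > 0" "m \<le> h / 2" "m \<le> \<delta> / 2" "m \<le> \<delta> / (2 * q)" "m \<le> \<epsilon> / (2 * (\<bar>L i q\<bar> + 1))"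
        using 3 \<delta>(1) \<epsilon> unfolding m_def
        by (auto intro: min.coboundedI1 min.coboundedI2 simp del: le_divide_eq_numeral1)
      have qm: "q * m \<le> \<delta> / 2" using m(4) 3 by (simp add: field_simps)
      have "m * (\<bar>L i q\<bar> + 1) \<le> \<epsilon> / 2" using m(5) by (simp add: field_simps)
      then have Lm: "m * \<bar>L i q\<bar> \<le> \<epsilon> / 2" using m(1) by (simp add: algebra_simps)
      have pos: "0 < q * m" using 3 m by simp
      have "w (t + m) ((q * m) *\<^sub>R e i) < w t (a *\<^sub>R e i) + \<epsilon> / 2"
        by (rule \<delta>(2)) (use t th m 3 pos qm \<delta>(1) in_J[OF i, of "q * m"] jdist_same[OF i a, of "q * m"] in auto)
      moreover have "w (t + h) ((q * m + q * (h - m)) *\<^sub>R e i) \<le> w (t + m) ((q * m) *\<^sub>R e i) + (h - m) * L i q"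
        using sub_line[OF sub bound i, of "t + m" "t + h" "q * m" q] t th m 3 pos by simp
      moreover have "- (m * L i q) \<le> m * \<bar>L i q\<bar>" using m(1) by (metis abs_ge_minus_self abs_mult abs_of_pos)
      moreover have "q * m + q * (h - m) = a + q * h" using 3 by (simp add: algebra_simps)
      ultimately show "w (t + h) ((a + q * h) *\<^sub>R e i) \<le> w t (a *\<^sub>R e i) + h * L i q + \<epsilon>"
        using Lm by (simp add: algebra_simps)
    qed
  qed
qed

text \<open>Candidates live on all times, so w is cut at some r between t and T and continued by a
  dominated function that the lower bound on w places below it.\<close>

lemma dominated_le_val:
  assumes dom: "dominated {0..<T} w" and init: "\<And>x. x \<in> J \<Longrightarrow> w 0 x \<le> u0 x"
    and low: "\<And>t x. t \<in> {0..<T} \<Longrightarrow> x \<in> J \<Longrightarrow> u0 x - C \<le> w t x"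
    and t: "t \<in> {0..<T}" and x: "x \<in> J"
  shows "w t x \<le> val t x"
proof -
  define r where "r = (t + T) / 2"
  have r: "t < r" "r < T" using t by (auto simp: r_def)
  have r0: "0 < r" using r t by simp
  have "dominated {0..r} w"
    using dom r unfolding dominated_def by auto
  then have "dominated {0..} (\<lambda>s. if s < r then w s else (\<lambda>x. u0 x - rate * s - C))"
  proof (rule dominated_glue[OF _ dominated_affine])
    fix x assume "x \<in> J"
    moreover have "rate * r \<ge> 0" using rate_nonneg r0 by simp
    ultimately show "u0 x - rate * r - C \<le> w r x" using low[of r x] r r0 by auto
  qed (use r0 in simp)
  then have "candidate (\<lambda>s. if s < r then w s else (\<lambda>x. u0 x - rate * s - C))"
    unfolding candidate_def using init r0 by simp
  from candidate_le_val[OF this, of t x] show ?thesis using t x r by simp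
qed

end

section \<open>Averages of Lipschitz functions\<close>

definition avg :: "real \<Rightarrow> (real \<Rightarrow> real) \<Rightarrow> real" where
  "avg d f = integral {0..d} f / d"

lemma avg_le:
  assumes "d > 0" "continuous_on {0..d} f" "continuous_on {0..d} g" "\<And>s. s \<in> {0..d} \<Longrightarrow> f s \<le> g s + c"
  shows "avg d f \<le> avg d g + c"
proof -
  have "integral {0..d} f \<le> integral {0..d} (\<lambda>s. g s + c)"
    by (rule integral_le) (use assms in \<open>auto intro!: integrable_continuous_real continuous_intros\<close>)
  also have "\<dots> = integral {0..d} g + d * c"
    using assms by (subst integral_add) (auto intro!: integrable_continuous_real)
  finally show ?thesis
    using assms(1) by (simp add: avg_def field_simps)
qed

lemma avg_dist_le:
  assumes "d > 0" "continuous_on {0..d} f" "continuous_on {0..d} g" "\<And>s. s \<in> {0..d} \<Longrightarrow> \<bar>f s - g s\<bar> \<le> c"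
  shows "\<bar>avg d f - avg d g\<bar> \<le> c"
proof -
  have "avg d f \<le> avg d g + c"
    by (rule avg_le[OF assms(1-3)]) (use assms(4) in \<open>fastforce simp: abs_le_iff\<close>)
  moreover have "avg d g \<le> avg d f + c"
    by (rule avg_le[OF assms(1,3,2)]) (use assms(4) in \<open>fastforce simp: abs_le_iff\<close>)
  ultimately show ?thesis by simp
qed

lemma avg_const: "d > 0 \<Longrightarrow> avg d (\<lambda>_. c) = c"
  by (simp add: avg_def)

lemma integral_has_derivative_ray:
  assumes "continuous_on {0..} f" "t \<ge> 0"
  shows "((\<lambda>x. integral {0..x} f) has_real_derivative f t) (at t within {0..})"
proof -
  have "((\<lambda>x. integral {0..x} f) has_real_derivative f t) (at t within {0..t+1})"
    by (rule integral_has_real_derivative) (use assms continuous_on_subset in \<open>auto intro: continuous_on_subset\<close>)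
  moreover have "at t within {0..t+1} = at t within {0..}"
    by (rule at_within_nhd[of _ "{..<t+1}"]) auto
  ultimately show ?thesis by simp
qed

text \<open>The forward window keeps everything on the half-line, including the one-sided derivative
  at 0. The derivative is a difference quotient, so a Lipschitz f has a C^1 average.\<close>

lemma avg_shift_has_derivative:
  assumes f: "continuous_on {0..} f" and t: "t \<ge> 0" and d: "d > 0"
  shows "((\<lambda>t. avg d (\<lambda>s. f (t + s))) has_real_derivative (f (t + d) - f t) / d) (at t within {0..})"
proof -
  define F where "F x = integral {0..x} f" for x
  have F: "(F has_real_derivative f x) (at x within {0..})" if "x \<ge> 0" for x
    unfolding F_def by (rule integral_has_derivative_ray[OF f that])
  have "(F \<circ> (\<lambda>x. x + d) has_real_derivative f (t + d) * 1) (at t within {0..})"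
    by (rule DERIV_image_chain)
      (use F[of "t + d"] t d in \<open>auto intro!: derivative_eq_intros DERIV_subset[of F _ _ "{0..}"]\<close>)
  then have "((\<lambda>x. (F (x + d) - F x) / d) has_real_derivative (f (t + d) - f t) / d) (at t within {0..})"
    using F[OF t] d by (auto intro!: derivative_eq_intros simp: o_def)
  moreover have "avg d (\<lambda>s. f (x + s)) = (F (x + d) - F x) / d" if "x \<in> {0..}" for x
  proof -
    have "integral {0..d} (f \<circ> (\<lambda>s. s + x)) = integral {0 + x..d + x} f"
      by (rule integral_shift) (use f that continuous_on_subset in \<open>auto intro: continuous_on_subset\<close>)
    moreover have "integral {0..x} f + integral {x..x + d} f = integral {0..x + d} f"
      by (rule Henstock_Kurzweil_Integration.integral_combine)
        (use f that d in \<open>auto intro!: integrable_continuous_real intro: continuous_on_subset\<close>)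
    ultimately show ?thesis by (simp add: avg_def F_def o_def add.commute)
  qed
  ultimately show ?thesis
    using t unfolding has_field_derivative_def by (auto intro: has_derivative_transform)
qed

section \<open>Functions Lipschitz in time and space, their averages and quotients\<close>

definition lip2 :: "real \<Rightarrow> (real \<Rightarrow> real \<Rightarrow> real) \<Rightarrow> bool" where
  "lip2 K F \<longleftrightarrow> K \<ge> 0 \<and> (\<forall>t\<ge>0. \<forall>s\<ge>0. \<forall>a\<ge>0. \<forall>b\<ge>0. \<bar>F t a - F s b\<bar> \<le> K * (\<bar>t - s\<bar> + \<bar>a - b\<bar>))"

lemma lip2D:
  "lip2 K F \<Longrightarrow> t \<ge> 0 \<Longrightarrow> s \<ge> 0 \<Longrightarrow> a \<ge> 0 \<Longrightarrow> b \<ge> 0 \<Longrightarrow> \<bar>F t a - F s b\<bar> \<le> K * (\<bar>t - s\<bar> + \<bar>a - b\<bar>)"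
  by (simp add: lip2_def)

lemma lip2_continuous:
  assumes "lip2 K F"
  shows "continuous_on ({0..} \<times> {0..}) (\<lambda>(t, a). F t a)"
  unfolding continuous_on_iff
proof (intro ballI allI impI)
  fix p :: "real \<times> real" and \<epsilon> :: real
  assume p: "p \<in> {0..} \<times> {0..}" and \<epsilon>: "\<epsilon> > 0"
  have K: "K \<ge> 0" using assms by (simp add: lip2_def)
  define d where "d = \<epsilon> / (2 * K + 1)"
  have d: "d > 0" using K \<epsilon> by (simp add: d_def)
  show "\<exists>d>0. \<forall>p'\<in>{0..} \<times> {0..}. dist p' p < d \<longrightarrow> dist (case p' of (t, a) \<Rightarrow> F t a) (case p of (t, a) \<Rightarrow> F t a) < \<epsilon>"
  proof (intro exI[of _ d] conjI ballI impI d)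
    fix p' :: "real \<times> real" assume p': "p' \<in> {0..} \<times> {0..}" "dist p' p < d"
    have "dist (fst p') (fst p) < d" "dist (snd p') (snd p) < d"
      using p'(2) dist_fst_le[of p' p] dist_snd_le[of p' p] by auto
    then have "K * (\<bar>fst p' - fst p\<bar> + \<bar>snd p' - snd p\<bar>) \<le> K * (2 * d)"
      using K by (intro mult_left_mono) (auto simp: dist_real_def)
    also have "\<dots> < (2 * K + 1) * d" using d by (simp add: algebra_simps)
    also have "\<dots> = \<epsilon>" using K by (simp add: d_def)
    finally have "K * (\<bar>fst p' - fst p\<bar> + \<bar>snd p' - snd p\<bar>) < \<epsilon>" .
    moreover have "\<bar>F (fst p') (snd p') - F (fst p) (snd p)\<bar> \<le> K * (\<bar>fst p' - fst p\<bar> + \<bar>snd p' - snd p\<bar>)"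
      by (rule lip2D[OF assms]) (use p p' in auto)
    ultimately show "dist (case p' of (t, a) \<Rightarrow> F t a) (case p of (t, a) \<Rightarrow> F t a) < \<epsilon>"
      by (simp add: dist_real_def case_prod_unfold)
  qed
qed

lemma lip2_continuous_time:
  assumes "lip2 K F" "a \<ge> 0"
  shows "continuous_on {0..} (\<lambda>t. F t a)"
proof -
  have "continuous_on {0..} (\<lambda>t. case (t, a) of (t, a) \<Rightarrow> F t a)"
    by (rule continuous_on_compose2[OF lip2_continuous[OF assms(1)]])
      (use assms(2) in \<open>auto intro!: continuous_intros\<close>)
  then show ?thesis by simp
qed

lemma lip2_continuous_space:
  assumes "lip2 K F" "t \<ge> 0"
  shows "continuous_on {0..} (F t)"
proof -
  have "continuous_on {0..} (\<lambda>a. case (t, a) of (t, a) \<Rightarrow> F t a)"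
    by (rule continuous_on_compose2[OF lip2_continuous[OF assms(1)]])
      (use assms(2) in \<open>auto intro!: continuous_intros\<close>)
  then show ?thesis by simp
qed

lemma continuous_on_shift:
  fixes f :: "real \<Rightarrow> real"
  assumes "continuous_on {0..} f" "t \<ge> 0"
  shows "continuous_on {0..d} (\<lambda>s. f (t + s))"
  by (rule continuous_on_compose2[OF assms(1)]) (use assms(2) in \<open>auto intro!: continuous_intros\<close>)

definition time_avg :: "real \<Rightarrow> (real \<Rightarrow> real \<Rightarrow> real) \<Rightarrow> real \<Rightarrow> real \<Rightarrow> real" where
  "time_avg d F t a = avg d (\<lambda>s. F (t + s) a)"

definition space_avg :: "real \<Rightarrow> (real \<Rightarrow> real \<Rightarrow> real) \<Rightarrow> real \<Rightarrow> real \<Rightarrow> real" where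
  "space_avg d F t a = avg d (\<lambda>y. F t (a + y))"

lemma lip2_time_avg:
  assumes F: "lip2 K F" and d: "d > 0"
  shows "lip2 K (time_avg d F)"
  unfolding lip2_def time_avg_def
proof (intro conjI allI impI avg_dist_le d)
  show "K \<ge> 0" using F by (simp add: lip2_def)
  fix t s a b :: real assume *: "t \<ge> 0" "s \<ge> 0" "a \<ge> 0" "b \<ge> 0"
  show "continuous_on {0..d} (\<lambda>s. F (t + s) a)" "continuous_on {0..d} (\<lambda>r. F (s + r) b)"
    using continuous_on_shift[OF lip2_continuous_time[OF F]] * by auto
  fix r assume "r \<in> {0..d}"
  then show "\<bar>F (t + r) a - F (s + r) b\<bar> \<le> K * (\<bar>t - s\<bar> + \<bar>a - b\<bar>)"
    using lip2D[OF F, of "t + r" "s + r" a b] * by simp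
qed

lemma lip2_space_avg:
  assumes F: "lip2 K F" and d: "d > 0"
  shows "lip2 K (space_avg d F)"
  unfolding lip2_def space_avg_def
proof (intro conjI allI impI avg_dist_le d)
  show "K \<ge> 0" using F by (simp add: lip2_def)
  fix t s a b :: real assume *: "t \<ge> 0" "s \<ge> 0" "a \<ge> 0" "b \<ge> 0"
  show "continuous_on {0..d} (\<lambda>y. F t (a + y))" "continuous_on {0..d} (\<lambda>y. F s (b + y))"
    using continuous_on_shift[OF lip2_continuous_space[OF F]] * by auto
  fix y assume "y \<in> {0..d}"
  then show "\<bar>F t (a + y) - F s (b + y)\<bar> \<le> K * (\<bar>t - s\<bar> + \<bar>a - b\<bar>)"
    using lip2D[OF F, of t s "a + y" "b + y"] * by simp
qed

lemma time_avg_close: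
  assumes F: "lip2 K F" and d: "d > 0" and *: "t \<ge> 0" "a \<ge> 0"
  shows "\<bar>time_avg d F t a - F t a\<bar> \<le> K * d"
proof -
  have K: "K \<ge> 0" using F by (simp add: lip2_def)
  have "\<bar>avg d (\<lambda>s. F (t + s) a) - avg d (\<lambda>_. F t a)\<bar> \<le> K * d"
  proof (rule avg_dist_le[OF d])
    show "continuous_on {0..d} (\<lambda>s. F (t + s) a)"
      using continuous_on_shift[OF lip2_continuous_time[OF F]] * by auto
    fix s assume "s \<in> {0..d}"
    then have "\<bar>F (t + s) a - F t a\<bar> \<le> K * s" "K * s \<le> K * d"
      using lip2D[OF F, of "t + s" t a a] * K by (auto intro: mult_left_mono)
    then show "\<bar>F (t + s) a - F t a\<bar> \<le> K * d" by linarith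
  qed simp
  then show ?thesis by (simp add: time_avg_def avg_const[OF d])
qed

lemma space_avg_close:
  assumes F: "lip2 K F" and d: "d > 0" and *: "t \<ge> 0" "a \<ge> 0"
  shows "\<bar>space_avg d F t a - F t a\<bar> \<le> K * d"
proof -
  have K: "K \<ge> 0" using F by (simp add: lip2_def)
  have "\<bar>avg d (\<lambda>y. F t (a + y)) - avg d (\<lambda>_. F t a)\<bar> \<le> K * d"
  proof (rule avg_dist_le[OF d])
    show "continuous_on {0..d} (\<lambda>y. F t (a + y))"
      using continuous_on_shift[OF lip2_continuous_space[OF F]] * by auto
    fix y assume "y \<in> {0..d}"
    then have "\<bar>F t (a + y) - F t a\<bar> \<le> K * y" "K * y \<le> K * d"
      using lip2D[OF F, of t t "a + y" a] * K by (auto intro: mult_left_mono)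
    then show "\<bar>F t (a + y) - F t a\<bar> \<le> K * d" by linarith
  qed simp
  then show ?thesis by (simp add: space_avg_def avg_const[OF d])
qed

definition time_quot :: "real \<Rightarrow> (real \<Rightarrow> real \<Rightarrow> real) \<Rightarrow> real \<Rightarrow> real \<Rightarrow> real" where
  "time_quot d F t a = (F (t + d) a - F t a) / d"

definition space_quot :: "real \<Rightarrow> (real \<Rightarrow> real \<Rightarrow> real) \<Rightarrow> real \<Rightarrow> real \<Rightarrow> real" where
  "space_quot d F t a = (F t (a + d) - F t a) / d"

lemma lip2_quot_aux:
  assumes "\<bar>x1 - y1\<bar> \<le> c" "\<bar>x2 - y2\<bar> \<le> c" "(d::real) > 0"
  shows "\<bar>(x1 - x2) / d - (y1 - y2) / d\<bar> \<le> 2 * c / d"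
proof -
  have "\<bar>(x1 - x2) / d - (y1 - y2) / d\<bar> = \<bar>(x1 - y1) - (x2 - y2)\<bar> / d"
    using assms(3) by (simp add: diff_divide_distrib[symmetric] algebra_simps)
  also have "\<dots> \<le> 2 * c / d" using assms by (intro divide_right_mono) auto
  finally show ?thesis .
qed

text \<open>The factor 1/d here is the source of the error O(\<epsilon>/\<delta>) in the
  smoothing.\<close>

lemma lip2_time_quot:
  assumes F: "lip2 K F" and d: "d > 0"
  shows "lip2 (2 * K / d) (time_quot d F)"
  unfolding lip2_def
proof (intro conjI allI impI)
  show "2 * K / d \<ge> 0" using F d by (simp add: lip2_def)
  fix t s a b :: real assume *: "t \<ge> 0" "s \<ge> 0" "a \<ge> 0" "b \<ge> 0"
  show "\<bar>time_quot d F t a - time_quot d F s b\<bar> \<le> 2 * K / d * (\<bar>t - s\<bar> + \<bar>a - b\<bar>)"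
    using lip2_quot_aux[OF _ lip2D[OF F *] d, of "F (t + d) a" "F (s + d) b"]
      lip2D[OF F, of "t + d" "s + d" a b] * d by (simp add: time_quot_def mult_ac)
qed

lemma lip2_space_quot:
  assumes F: "lip2 K F" and d: "d > 0"
  shows "lip2 (2 * K / d) (space_quot d F)"
  unfolding lip2_def
proof (intro conjI allI impI)
  show "2 * K / d \<ge> 0" using F d by (simp add: lip2_def)
  fix t s a b :: real assume *: "t \<ge> 0" "s \<ge> 0" "a \<ge> 0" "b \<ge> 0"
  show "\<bar>space_quot d F t a - space_quot d F s b\<bar> \<le> 2 * K / d * (\<bar>t - s\<bar> + \<bar>a - b\<bar>)"
    using lip2_quot_aux[OF _ lip2D[OF F *] d, of "F t (a + d)" "F s (b + d)"]
      lip2D[OF F, of t s "a + d" "b + d"] * d by (simp add: space_quot_def mult_ac)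
qed

lemma time_avg_has_derivative:
  assumes "lip2 K F" "d > 0" "t \<ge> 0" "a \<ge> 0"
  shows "((\<lambda>t. time_avg d F t a) has_real_derivative time_quot d F t a) (at t within {0..})"
  unfolding time_avg_def time_quot_def
  by (rule avg_shift_has_derivative[OF lip2_continuous_time[OF assms(1,4)] assms(3,2)])

lemma space_avg_has_derivative:
  assumes "lip2 K F" "d > 0" "t \<ge> 0" "a \<ge> 0"
  shows "(space_avg d F t has_real_derivative space_quot d F t a) (at a within {0..})"
  unfolding space_avg_def space_quot_def
  by (rule avg_shift_has_derivative[OF lip2_continuous_space[OF assms(1,3)] assms(4,2)])

lemma space_avg_time_derivative:
  assumes G: "lip2 K G" and G': "lip2 K' G'" and d: "d > 0" and t: "t \<ge> 0" and a: "a \<ge> 0"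
    and deriv: "\<And>t a. t \<ge> 0 \<Longrightarrow> a \<ge> 0 \<Longrightarrow> ((\<lambda>t. G t a) has_real_derivative G' t a) (at t within {0..})"
  shows "((\<lambda>t. space_avg d G t a) has_real_derivative space_avg d G' t a) (at t within {0..})"
proof -
  have "((\<lambda>t. integral (cbox 0 d) (\<lambda>y. G t (a + y))) has_field_derivative integral (cbox 0 d) (\<lambda>y. G' t (a + y)))
      (at t within {0..})"
  proof (rule leibniz_rule_field_derivative)
    show "((\<lambda>t. G t (a + y)) has_real_derivative G' x (a + y)) (at x within {0..})"
      if "x \<in> {0..}" "y \<in> cbox 0 d" for x y
      using deriv[of x "a + y"] that a by simp
    show "(\<lambda>y. G x (a + y)) integrable_on cbox 0 d" if "x \<in> {0..}" for x
      using continuous_on_shift[OF lip2_continuous_space[OF G] a, of x d] that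
      by (auto intro: integrable_continuous_real)
    show "continuous_on ({0..} \<times> cbox 0 d) (\<lambda>(x, y). G' x (a + y))"
    proof -
      have "continuous_on ({0..} \<times> cbox 0 d) (\<lambda>p. case (fst p, a + snd p) of (t, a) \<Rightarrow> G' t a)"
        by (rule continuous_on_compose2[OF lip2_continuous[OF G']])
          (use a in \<open>auto intro!: continuous_intros\<close>)
      then show ?thesis by (simp add: case_prod_unfold)
    qed
  qed (use t in auto)
  then show ?thesis
    unfolding space_avg_def avg_def using d by (auto intro!: derivative_eq_intros)
qed

text \<open>Joint differentiability follows from one partial derivative at the point and the other
  one existing nearby and being continuous.\<close>

lemma lip2_partials_has_derivative:
  assumes x: "lip2 K Ax" and t: "t \<in> {0<..<T}" and a: "a \<ge> 0"
    and dt: "((\<lambda>t. A t a) has_real_derivative c) (at t within {0..})"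
    and dx: "\<And>t a. t \<ge> 0 \<Longrightarrow> a \<ge> 0 \<Longrightarrow> (A t has_real_derivative Ax t a) (at a within {0..})"
  shows "((\<lambda>(s, b). A s b) has_derivative (\<lambda>(ds, db). ds * c + db * Ax t a)) (at (t, a) within {0<..<T} \<times> {0..})"
proof -
  have "((\<lambda>(s, b). A s b) has_derivative (\<lambda>(ds, db). c * ds + blinfun_mult_right (Ax t a) db))
      (at (t, a) within {0<..<T} \<times> {0..})"
  proof (rule has_derivative_partialsI)
    show "((\<lambda>t. A t a) has_derivative (*) c) (at t within {0<..<T})"
      using has_derivative_subset[OF dt[unfolded has_field_derivative_def], of "{0<..<T}"] by fastforce
    show "(A s has_derivative blinfun_apply (blinfun_mult_right (Ax s b))) (at b within {0..})"
      if "s \<in> {0<..<T}" "b \<in> {0..}" for s b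
      using dx[of s b] that by (simp add: has_field_derivative_def)
    have "continuous_on ({0<..<T} \<times> {0..}) (\<lambda>(s, b). Ax s b)"
      by (rule continuous_on_subset[OF lip2_continuous[OF x]]) auto
    then have "continuous_on ({0<..<T} \<times> {0..}) (\<lambda>p. blinfun_mult_right (case p of (s, b) \<Rightarrow> Ax s b))"
      by (intro bounded_linear.continuous_on[OF bounded_linear_blinfun_mult_right])
    then show "continuous (at (t, a) within {0<..<T} \<times> {0..}) (\<lambda>(s, b). blinfun_mult_right (Ax s b))"
      using t a by (auto simp: continuous_on_eq_continuous_within case_prod_unfold)
  qed (use a in auto)
  then show ?thesis by (simp add: mult.commute)
qed

section \<open>Super-solutions lie above the maximal dominated function\<close>

context hj_junction begin

section \<open>Smoothing the maximal candidate\<close>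

definition bval :: "nat \<Rightarrow> real \<Rightarrow> real \<Rightarrow> real" where
  "bval k t a = val t (a *\<^sub>R e k)"

lemma lip2_bval: "k \<in> {1..N} \<Longrightarrow> lip2 lip (bval k)"
  unfolding lip2_def bval_def
proof (intro conjI allI impI lip_nonneg)
  fix t s a b :: real assume k: "k \<in> {1..N}" and *: "t \<ge> 0" "s \<ge> 0" "a \<ge> 0" "b \<ge> 0"
  show "\<bar>val t (a *\<^sub>R e k) - val s (b *\<^sub>R e k)\<bar> \<le> lip * (\<bar>t - s\<bar> + \<bar>a - b\<bar>)"
    using val_lipschitz[OF *(1,2) in_J[OF k *(3)] in_J[OF k *(4)]] jdist_same[OF k *(3,4)] by simp
qed

text \<open>Averaging separately on each branch destroys continuity at the vertex; the time-dependent
  correction restores it, and costs only \<open>O(\<epsilon>/\<delta>)\<close> in the time derivative.\<close>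

definition smooth :: "real \<Rightarrow> real \<Rightarrow> nat \<Rightarrow> real \<Rightarrow> real \<Rightarrow> real" where
  "smooth \<delta> \<epsilon> k t a = space_avg \<epsilon> (time_avg \<delta> (bval k)) t a
     - space_avg \<epsilon> (time_avg \<delta> (bval k)) t 0 + time_avg \<delta> (bval k) t 0"

definition smooth_t :: "real \<Rightarrow> real \<Rightarrow> nat \<Rightarrow> real \<Rightarrow> real \<Rightarrow> real" where
  "smooth_t \<delta> \<epsilon> k t a = space_avg \<epsilon> (time_quot \<delta> (bval k)) t a
     - space_avg \<epsilon> (time_quot \<delta> (bval k)) t 0 + time_quot \<delta> (bval k) t 0"

definition smooth_x :: "real \<Rightarrow> real \<Rightarrow> nat \<Rightarrow> real \<Rightarrow> real \<Rightarrow> real" where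
  "smooth_x \<delta> \<epsilon> k t a = space_quot \<epsilon> (time_avg \<delta> (bval k)) t a"

context
  fixes \<delta> \<epsilon> :: real
  assumes \<delta>: "\<delta> > 0" and \<epsilon>: "\<epsilon> > 0"
begin

lemma smooth_vertex:
  "smooth \<delta> \<epsilon> k t 0 = smooth \<delta> \<epsilon> 1 t 0" "smooth_t \<delta> \<epsilon> k t 0 = smooth_t \<delta> \<epsilon> 1 t 0"
  by (simp_all add: smooth_def smooth_t_def time_avg_def time_quot_def bval_def)

lemma lip2_smooth_parts:
  assumes "k \<in> {1..N}"
  shows "lip2 lip (time_avg \<delta> (bval k))" "lip2 lip (space_avg \<epsilon> (time_avg \<delta> (bval k)))"
    "lip2 (2 * lip / \<delta>) (time_quot \<delta> (bval k))" "lip2 (2 * lip / \<delta>) (space_avg \<epsilon> (time_quot \<delta> (bval k)))"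
    "lip2 (2 * lip / \<epsilon>) (smooth_x \<delta> \<epsilon> k)"
  unfolding smooth_x_def
  by (intro lip2_time_avg lip2_space_avg lip2_time_quot lip2_space_quot lip2_bval \<delta> \<epsilon> assms)+

lemma double_avg_time_derivative:
  assumes "k \<in> {1..N}" "t \<ge> 0" "a \<ge> 0"
  shows "((\<lambda>t. space_avg \<epsilon> (time_avg \<delta> (bval k)) t a) has_real_derivative
     space_avg \<epsilon> (time_quot \<delta> (bval k)) t a) (at t within {0..})"
  by (rule space_avg_time_derivative[OF lip2_smooth_parts(1,3)[OF assms(1)] \<epsilon> assms(2,3)
        time_avg_has_derivative[OF lip2_bval[OF assms(1)] \<delta>]])

lemma double_avg_space_derivative:
  assumes "k \<in> {1..N}" "t \<ge> 0" "a \<ge> 0"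
  shows "(space_avg \<epsilon> (time_avg \<delta> (bval k)) t has_real_derivative smooth_x \<delta> \<epsilon> k t a) (at a within {0..})"
  unfolding smooth_x_def by (rule space_avg_has_derivative[OF lip2_smooth_parts(1)[OF assms(1)] \<epsilon> assms(2,3)])

lemma double_avg_has_derivative:
  assumes "k \<in> {1..N}" "t \<in> {0<..<T}" "a \<ge> 0"
  shows "((\<lambda>(s, b). space_avg \<epsilon> (time_avg \<delta> (bval k)) s b) has_derivative
     (\<lambda>(ds, db). ds * space_avg \<epsilon> (time_quot \<delta> (bval k)) t a + db * smooth_x \<delta> \<epsilon> k t a))
     (at (t, a) within {0<..<T} \<times> {0..})"
  by (rule lip2_partials_has_derivative[OF lip2_smooth_parts(5)[OF assms(1)] assms(2,3)])
    (use assms double_avg_time_derivative double_avg_space_derivative in auto)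

lemma smooth_has_derivative:
  assumes k: "k \<in> {1..N}" and t: "t \<in> {0<..<T}" and a: "a \<ge> 0"
  shows "((\<lambda>(s, b). smooth \<delta> \<epsilon> k s b) has_derivative
     (\<lambda>(ds, db). ds * smooth_t \<delta> \<epsilon> k t a + db * smooth_x \<delta> \<epsilon> k t a)) (at (t, a) within {0<..<T} \<times> {0..})"
proof (rule lip2_partials_has_derivative[OF lip2_smooth_parts(5)[OF k] t a])
  show "((\<lambda>t. smooth \<delta> \<epsilon> k t a) has_real_derivative smooth_t \<delta> \<epsilon> k t a) (at t within {0..})"
    unfolding smooth_def smooth_t_def
    by (intro derivative_intros double_avg_time_derivative time_avg_has_derivative[OF lip2_bval] \<delta>)
      (use k t a in auto)
  show "(smooth \<delta> \<epsilon> k s has_real_derivative smooth_x \<delta> \<epsilon> k s b) (at b within {0..})" if "s \<ge> 0" "b \<ge> 0" for s b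
    unfolding smooth_def using double_avg_space_derivative[OF k that]
    by (auto intro!: derivative_eq_intros)
qed

lemma smooth_continuous:
  assumes "k \<in> {1..N}"
  shows "continuous_on ({0..} \<times> {0..}) (\<lambda>(s, b). smooth \<delta> \<epsilon> k s b)"
    "continuous_on ({0..} \<times> {0..}) (\<lambda>(s, b). smooth_t \<delta> \<epsilon> k s b)"
    "continuous_on ({0..} \<times> {0..}) (\<lambda>(s, b). smooth_x \<delta> \<epsilon> k s b)"
proof -
  have vertex: "continuous_on ({0..} \<times> {0..}) (\<lambda>p::real \<times> real. F (fst p) 0)" if "lip2 K F" for K F
    by (rule continuous_on_compose2[OF lip2_continuous_time[OF that order_refl]])
      (auto intro!: continuous_intros)
  note c = lip2_continuous[unfolded case_prod_unfold]
  show "continuous_on ({0..} \<times> {0..}) (\<lambda>(s, b). smooth \<delta> \<epsilon> k s b)"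
    "continuous_on ({0..} \<times> {0..}) (\<lambda>(s, b). smooth_t \<delta> \<epsilon> k s b)"
    unfolding smooth_def smooth_t_def case_prod_unfold
    by (intro continuous_intros c vertex; use lip2_smooth_parts[OF assms] in blast)+
  show "continuous_on ({0..} \<times> {0..}) (\<lambda>(s, b). smooth_x \<delta> \<epsilon> k s b)"
    using lip2_continuous lip2_smooth_parts(5)[OF assms] by blast
qed

lemma smooth_close:
  assumes "k \<in> {1..N}" "t \<ge> 0" "a \<ge> 0"
  shows "\<bar>smooth \<delta> \<epsilon> k t a - bval k t a\<bar> \<le> lip * \<delta> + 2 * (lip * \<epsilon>)"
  using space_avg_close[OF lip2_smooth_parts(1)[OF assms(1)] \<epsilon> assms(2,3)]
    space_avg_close[OF lip2_smooth_parts(1)[OF assms(1)] \<epsilon> assms(2) order_refl]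
    time_avg_close[OF lip2_bval[OF assms(1)] \<delta> assms(2,3)]
  unfolding smooth_def by linarith

text \<open>A line shifted forward in time and outward in space is again a line in the branch with
  the same velocity and action, so both averages inherit domination and can be differentiated
  backwards. The vertex correction depends on time alone and adds at most the last term.\<close>

lemma smooth_subsolution:
  assumes k: "k \<in> {1..N}" and t: "t \<in> {0<..<T}" and a: "a \<ge> 0" "a > 0 \<or> q \<le> 0"
  shows "smooth_t \<delta> \<epsilon> k t a + q * smooth_x \<delta> \<epsilon> k t a \<le> L k q + 2 * lip * \<epsilon> / \<delta>"
proof -
  have "space_avg \<epsilon> (time_quot \<delta> (bval k)) t a + q * smooth_x \<delta> \<epsilon> k t a \<le> L k q"
  proof (rule backward_derivative_le[OF double_avg_has_derivative[OF k t a(1)] t a zero_less_one])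
    fix h assume h: "0 < h" "h < t" "0 \<le> a - q * h"
    have F: "bval k (t + s) (a + y) \<le> bval k (t - h + s) (a - q * h + y) + h * L k q" if "s \<ge> 0" "y \<ge> 0" for s y
      using dominatedD[OF dominated_val k, of "t - h + s" h "a - q * h + y" q] that h a
      by (simp add: bval_def algebra_simps)
    have T: "time_avg \<delta> (bval k) t (a + y) \<le> time_avg \<delta> (bval k) (t - h) (a - q * h + y) + h * L k q" if "y \<ge> 0" for y
      unfolding time_avg_def
      by (rule avg_le[OF \<delta>]) (use F h a that in \<open>auto intro!: continuous_on_shift lip2_continuous_time[OF lip2_bval[OF k]]\<close>)
    show "(case (t, a) of (s, b) \<Rightarrow> space_avg \<epsilon> (time_avg \<delta> (bval k)) s b)
        \<le> (case (t - h, a - q * h) of (s, b) \<Rightarrow> space_avg \<epsilon> (time_avg \<delta> (bval k)) s b) + h * L k q"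
      unfolding space_avg_def prod.case
      by (rule avg_le[OF \<epsilon>]) (use T h a in \<open>auto intro!: continuous_on_shift lip2_continuous_space[OF lip2_smooth_parts(1)[OF k]]\<close>)
  qed
  moreover have "\<bar>space_avg \<epsilon> (time_quot \<delta> (bval k)) t 0 - time_quot \<delta> (bval k) t 0\<bar> \<le> 2 * lip / \<delta> * \<epsilon>"
    by (rule space_avg_close[OF lip2_smooth_parts(3)[OF k] \<epsilon>]) (use t in auto)
  ultimately show ?thesis unfolding smooth_t_def by (simp add: abs_le_iff)
qed

end

section \<open>Comparison of super-solutions with the smoothed function\<close>

text \<open>The test function blends the smoothed \<open>val\<close> with the classical sub-solution
  -(M s + K1 b) and subtracts \<sigma>/(T-s). Of the gap 6\<theta>, three parts are lost at the
  reference point (smoothing, blending, time penalty), while on the boundary of the box w - \<Phi>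
  exceeds -2\<theta>; so the minimum is interior and the strict inequality contradicts the
  super-solution test.\<close>

lemma super_ge_val:
  assumes super: "visc_super N e L T u0 (\<lambda>t x. ereal (w t x))"
    and low: "\<And>t x. t \<in> {0..<T} \<Longrightarrow> x \<in> J \<Longrightarrow> u0 x - C \<le> w t x"
    and t1: "t1 \<in> {0..<T}" and x1: "x1 \<in> J"
  shows "val t1 x1 \<le> w t1 x1"
proof (rule ccontr)
  obtain i a1 where i: "i \<in> {1..N}" and a1: "a1 \<ge> 0" and x1': "x1 = a1 *\<^sub>R e i" using x1 by (rule J_cases)
  define \<theta> where "\<theta> = (val t1 x1 - w t1 x1) / 6"
  assume "\<not> ?thesis"
  then have \<theta>: "\<theta> > 0" by (simp add: \<theta>_def)
  have gap: "w t1 x1 = val t1 x1 - 6 * \<theta>" by (simp add: \<theta>_def field_simps)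
  have T: "T > 0" using t1 by auto
  have usc: "usc_on N e T (\<lambda>t x. ereal (- w t x))"
    unfolding usc_on_def
  proof (intro ballI allI impI)
    fix t x c assume tx: "t \<in> {0..<T}" "x \<in> J" and c: "ereal (- w t x) < c"
    then have "- c < ereal (w t x)" using ereal_minus_less_minus[of "c" "ereal (- w t x)"] by simp
    then obtain d where d: "d > 0" "\<And>s y. s \<in> {0..<T} \<Longrightarrow> y \<in> J \<Longrightarrow> \<bar>s - t\<bar> < d \<and> dJ x y < d \<Longrightarrow> - c < ereal (w s y)"
      using super tx unfolding visc_super_def lsc_on_def by meson
    have "ereal (- w s y) < c" if "s \<in> {0..<T}" "y \<in> J" "\<bar>s - t\<bar> < d \<and> dJ x y < d" for s y
      using d(2)[OF that] ereal_minus_less_minus[of "ereal (w s y)" "- c"] by simp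
    then show "\<exists>d>0. \<forall>s\<in>{0..<T}. \<forall>y\<in>J. \<bar>s - t\<bar> < d \<and> dJ x y < d \<longrightarrow> ereal (- w s y) < c"
      using d(1) by blast
  qed
  \<comment> \<open>One more than the growth rate of \<open>u0\<close>: the blend then forces w -
    \<Phi> to grow at least like \<open>\<mu> * b\<close>.\<close>
  define K1 where "K1 = K0 + 1"
  obtain M where M: "M \<ge> 0" "\<And>k q. k \<in> {1..N} \<Longrightarrow> K1 * \<bar>q\<bar> - M \<le> L k q"
    using superlinear by blast
  define U0 where "U0 = \<bar>u0 0\<bar> + rate * T"
  have rT: "rate * s \<le> rate * T" if "s \<in> {0..<T}" for s using that rate_nonneg by (intro mult_left_mono) auto
  have U0: "U0 \<ge> 0" "- U0 - K0 * b \<le> bval k s b" if "k \<in> {1..N}" "s \<in> {0..<T}" "b \<ge> 0" for k s b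
  proof -
    show "U0 \<ge> 0" using rate_nonneg T by (simp add: U0_def)
    show "- U0 - K0 * b \<le> bval k s b"
      using val_bounds(2)[of s "b *\<^sub>R e k"] in_J[OF that(1,3)] u0_le[OF that(1,3)] rT[OF that(2)] that(2)
      unfolding U0_def bval_def by auto
  qed
  have U0': "U0 \<ge> 0" by (rule U0(1)[OF i t1 a1])
  define V where "V = val t1 x1"
  define B where "B = \<bar>V\<bar> + \<theta> + M * T + K1 * a1"
  have B: "B \<ge> 0" using \<theta> M(1) T a1 K0_nonneg by (simp add: B_def K1_def)
  define \<sigma> where "\<sigma> = \<theta> * (T - t1)"
  have \<sigma>: "\<sigma> > 0" "\<sigma> / (T - t1) = \<theta>" using \<theta> t1 by (auto simp: \<sigma>_def)
  \<comment> \<open>B bounds the blending loss at the reference point and U0 + \<theta> the one in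
    \<open>lower\<close>; weighted by \<mu>, each is at most \<theta>.\<close>
  define \<mu> where "\<mu> = min (1/2) (\<theta> / (B + U0 + \<theta> + 1))"
  have den: "B + U0 + \<theta> + 1 > 0" using B U0' \<theta> by linarith
  have \<mu>: "0 < \<mu>" "\<mu> \<le> 1" using \<theta> den by (auto simp: \<mu>_def)
  have \<mu>m: "\<mu> * (B + U0 + \<theta> + 1) \<le> \<theta>"
  proof -
    have "\<mu> \<le> \<theta> / (B + U0 + \<theta> + 1)" unfolding \<mu>_def by (rule min.cobounded2)
    then show ?thesis using den by (simp add: pos_le_divide_eq)
  qed
  have \<mu>B: "\<mu> * B \<le> \<theta>" and \<mu>U: "\<mu> * (U0 + \<theta>) \<le> \<theta>"
  proof -
    have "\<mu> * B \<le> \<mu> * (B + U0 + \<theta> + 1)" "\<mu> * (U0 + \<theta>) \<le> \<mu> * (B + U0 + \<theta> + 1)"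
      using \<mu> B U0' \<theta> by (auto intro!: mult_left_mono)
    then show "\<mu> * B \<le> \<theta>" "\<mu> * (U0 + \<theta>) \<le> \<theta>" using \<mu>m by linarith+
  qed
  define \<delta> where "\<delta> = \<theta> / (2 * (lip + 1))"
  have \<delta>: "\<delta> > 0" using \<theta> lip_nonneg by (simp add: \<delta>_def)
  have l\<delta>: "lip * \<delta> \<le> \<theta> / 2"
  proof -
    have "(lip + 1) * \<delta> = \<theta> / 2" using lip_nonneg by (simp add: \<delta>_def field_simps)
    then show ?thesis using \<delta> by (simp add: algebra_simps)
  qed
  \<comment> \<open>The first entry bounds the distance to \<open>val\<close>. The second keeps the
    smoothing error below \<sigma>/(2 T^2), half of the least gain from the time penalty.\<close>
  define \<epsilon> where "\<epsilon> = min (\<theta> / (4 * (lip + 1))) (\<delta> * \<sigma> / (4 * (lip + 1) * T\<^sup>2))"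
  have \<epsilon>: "\<epsilon> > 0" using \<theta> lip_nonneg \<delta> \<sigma> T by (simp add: \<epsilon>_def)
  have l\<epsilon>: "2 * (lip * \<epsilon>) \<le> \<theta> / 2"
  proof -
    have "\<epsilon> \<le> \<theta> / (4 * (lip + 1))" unfolding \<epsilon>_def by (rule min.cobounded1)
    then have "(lip + 1) * \<epsilon> * 4 \<le> \<theta>" using lip_nonneg by (simp add: pos_le_divide_eq mult_ac)
    then show ?thesis using \<epsilon> by (simp add: algebra_simps)
  qed
  have err: "2 * lip * \<epsilon> / \<delta> \<le> \<sigma> / (2 * T\<^sup>2)"
  proof -
    have "\<epsilon> \<le> \<delta> * \<sigma> / (4 * (lip + 1) * T\<^sup>2)" unfolding \<epsilon>_def by (rule min.cobounded2)
    then have "\<epsilon> * (4 * (lip + 1) * T\<^sup>2) \<le> \<delta> * \<sigma>" using lip_nonneg T by (simp add: pos_le_divide_eq)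
    moreover have "\<epsilon> * (4 * lip * T\<^sup>2) \<le> \<epsilon> * (4 * (lip + 1) * T\<^sup>2)"
      using \<epsilon> by (intro mult_left_mono mult_right_mono) auto
    ultimately have "2 * lip * \<epsilon> * (2 * T\<^sup>2) \<le> \<sigma> * \<delta>" by (simp add: mult_ac)
    then show ?thesis using \<delta> T by (simp add: divide_simps mult_ac)
  qed
  have close: "\<bar>smooth \<delta> \<epsilon> k s b - bval k s b\<bar> \<le> \<theta>" if "k \<in> {1..N}" "s \<ge> 0" "b \<ge> 0" for k s b
    using smooth_close[OF \<delta> \<epsilon> that] l\<delta> l\<epsilon> by linarith
  define g where "g k s b = (1 - \<mu>) * smooth \<delta> \<epsilon> k s b - \<mu> * (M * s + K1 * b) - \<sigma> / (T - s)" for k s b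
  define gt where "gt k s b = (1 - \<mu>) * smooth_t \<delta> \<epsilon> k s b - \<mu> * M - \<sigma> / (T - s)\<^sup>2" for k s b
  define gx where "gx k s b = (1 - \<mu>) * smooth_x \<delta> \<epsilon> k s b - \<mu> * K1" for k s b
  define \<Phi> where "\<Phi> s = glue_branches (\<lambda>k. g k s)" for s
  define \<Phi>t where "\<Phi>t s = glue_branches (\<lambda>k. gt k s)" for s
  have g0: "g k s 0 = g 1 s 0" "gt k s 0 = gt 1 s 0" for k s
    unfolding g_def gt_def using smooth_vertex[of \<delta> \<epsilon> k s] \<delta> \<epsilon> by simp_all
  have \<Phi>: "\<Phi> s (b *\<^sub>R e k) = g k s b" "\<Phi>t s (b *\<^sub>R e k) = gt k s b" if "k \<in> {1..N}" "b \<ge> 0" for k s b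
    unfolding \<Phi>_def \<Phi>t_def
    using glue_branches_coord[OF that, of "\<lambda>k. g k s", OF g0(1)]
      glue_branches_coord[OF that, of "\<lambda>k. gt k s", OF g0(2)] by blast+
  have contT: "continuous_on ({0..<T} \<times> {0..}) (\<lambda>p. smooth \<delta> \<epsilon> k (fst p) (snd p))"
    "continuous_on ({0<..<T} \<times> {0..}) (\<lambda>p. smooth_t \<delta> \<epsilon> k (fst p) (snd p))"
    "continuous_on ({0<..<T} \<times> {0..}) (\<lambda>p. smooth_x \<delta> \<epsilon> k (fst p) (snd p))" if "k \<in> {1..N}" for k
    by (rule continuous_on_subset[OF smooth_continuous(1)[OF \<delta> \<epsilon> that, unfolded case_prod_unfold]], force,
        rule continuous_on_subset[OF smooth_continuous(2)[OF \<delta> \<epsilon> that, unfolded case_prod_unfold]], force,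
        rule continuous_on_subset[OF smooth_continuous(3)[OF \<delta> \<epsilon> that, unfolded case_prod_unfold]], force)
  have C1: "C1_star N e T \<Phi> \<Phi>t gx"
    unfolding \<Phi>_def \<Phi>t_def
  proof (rule C1_star_glue)
    fix k t a assume k: "k \<in> {1..N}" and t: "t \<in> {0<..<T}" and a: "(a::real) \<ge> 0"
    note D = smooth_has_derivative[OF \<delta> \<epsilon> k t a, unfolded case_prod_unfold]
    show "((\<lambda>(s, b). g k s b) has_derivative (\<lambda>(ds, db). ds * gt k t a + db * gx k t a)) (at (t, a) within {0<..<T} \<times> {0..})"
      unfolding g_def gt_def gx_def case_prod_unfold
      by (rule derivative_eq_intros D refl | use t in \<open>force simp: field_simps power2_eq_square\<close>)+
  next
    fix k assume k: "k \<in> {1..N}"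
    show "continuous_on ({0<..<T} \<times> {0..}) (\<lambda>(s, b). gt k s b)"
      "continuous_on ({0<..<T} \<times> {0..}) (\<lambda>(s, b). gx k s b)"
      unfolding gt_def gx_def case_prod_unfold
      by (intro continuous_intros contT k; force)+
  qed (rule g0)+
  define Z where "Z = \<bar>C\<bar> + rate * T + 1"
  have Z: "Z > 0" using rate_nonneg T by (simp add: Z_def add_nonneg_pos)
  have wV: "1 - Z \<le> w s (b *\<^sub>R e k) - bval k s b" if "k \<in> {1..N}" "s \<in> {0..<T}" "b \<ge> 0" for k s b
    using low[OF that(2) in_J[OF that(1,3)]] val_bounds(1)[OF _ in_J[OF that(1,3)], of s] rT[OF that(2)] that(2)
    unfolding Z_def bval_def by (auto simp: abs_if)
  have lower: "(w s (b *\<^sub>R e k) - bval k s b) - 2 * \<theta> + \<mu> * b + \<sigma> / (T - s) \<le> w s (b *\<^sub>R e k) - \<Phi> s (b *\<^sub>R e k)"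
    if "k \<in> {1..N}" "s \<in> {0..<T}" "b \<ge> 0" for k s b
  proof -
    have "(1 - \<mu>) * smooth \<delta> \<epsilon> k s b \<le> (1 - \<mu>) * (bval k s b + \<theta>)"
      using close[OF that(1) _ that(3), of s] that(2) \<mu> by (intro mult_left_mono) auto
    moreover have "\<mu> * (- U0 - K0 * b) \<le> \<mu> * bval k s b"
      using U0(2)[OF that] \<mu> by (intro mult_left_mono) auto
    moreover have "\<mu> * (M * s) \<ge> 0" "\<mu> * \<theta> \<ge> 0" using M(1) that \<mu> \<theta> by auto
    ultimately show ?thesis
      using \<mu>U unfolding \<Phi>(1)[OF that(1,3)] g_def K1_def by (simp add: algebra_simps)
  qed
  have ref: "w t1 (a1 *\<^sub>R e i) - \<Phi> t1 (a1 *\<^sub>R e i) \<le> - 3 * \<theta>"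
  proof -
    have c: "\<bar>smooth \<delta> \<epsilon> i t1 a1 - V\<bar> \<le> \<theta>" using close[OF i _ a1, of t1] t1 by (simp add: bval_def V_def x1')
    then have "\<mu> * smooth \<delta> \<epsilon> i t1 a1 \<le> \<mu> * (\<bar>V\<bar> + \<theta>)" using \<mu> by (intro mult_left_mono) auto
    moreover have "\<mu> * (M * t1) \<le> \<mu> * (M * T)" using \<mu> M(1) t1 by (intro mult_left_mono) auto
    ultimately have "\<mu> * smooth \<delta> \<epsilon> i t1 a1 + \<mu> * (M * t1 + K1 * a1) \<le> \<theta>"
      using \<mu>B unfolding B_def by (simp add: algebra_simps)
    moreover have "w t1 (a1 *\<^sub>R e i) = V - 6 * \<theta>" using gap by (simp add: V_def x1')
    ultimately show ?thesis
      using c \<sigma>(2) unfolding \<Phi>(1)[OF i a1] g_def by (simp add: left_diff_distrib abs_le_iff)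
  qed
  define T2 where "T2 = T - min ((T - t1) / 2) (\<sigma> / Z)"
  have T2: "t1 < T2" "T2 < T" and T2Z: "\<sigma> / (T - T2) \<ge> Z"
  proof -
    have m: "min ((T - t1) / 2) (\<sigma> / Z) > 0" using t1 \<sigma> Z by auto
    then show "T2 < T" by (simp add: T2_def)
    have "min ((T - t1) / 2) (\<sigma> / Z) \<le> (T - t1) / 2" by (rule min.cobounded1)
    also have "\<dots> < T - t1" using t1 by simp
    finally show "t1 < T2" by (simp add: T2_def)
    have "Z * (T - T2) \<le> Z * (\<sigma> / Z)" unfolding T2_def using Z by (intro mult_left_mono) auto
    then show "\<sigma> / (T - T2) \<ge> Z" using Z m by (simp add: T2_def le_divide_eq)
  qed
  \<comment> \<open>At b = R the growth \<open>\<mu> * b\<close> compensates the worst value of w -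
    val, which is above -Z.\<close>
  define R where "R = max a1 (Z / \<mu>)"
  have RZ: "\<mu> * R \<ge> Z"
  proof -
    have "\<mu> * (Z / \<mu>) \<le> \<mu> * R" using \<mu> by (intro mult_left_mono) (auto simp: R_def)
    then show ?thesis using \<mu> by simp
  qed
  obtain k s b \<rho> where ksb: "k \<in> {1..N}" "s \<in> {0<..<T2}" "b \<in> {0..R}" and \<rho>: "\<rho> > 0"
    and max: "\<And>s' y. y \<in> J \<Longrightarrow> \<bar>s' - s\<bar> < \<rho> \<Longrightarrow> dJ (b *\<^sub>R e k) y < \<rho> \<Longrightarrow>
      - w s' y + \<Phi> s' y \<le> - w s (b *\<^sub>R e k) + \<Phi> s (b *\<^sub>R e k)"
  proof (rule junction_local_max[OF usc, of \<Phi> "{1..N}" 0 T2 0 R i t1 a1])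
    show "continuous_on ({0..<T} \<times> {0..}) (\<lambda>(s, b). \<Phi> s (b *\<^sub>R e k))" if "k \<in> {1..N}" for k
    proof (rule continuous_on_eq[of _ "\<lambda>(s, b). g k s b"])
      show "continuous_on ({0..<T} \<times> {0..}) (\<lambda>(s, b). g k s b)"
        unfolding g_def case_prod_unfold by (intro continuous_intros contT that; force)
    qed (use \<Phi>(1)[OF that] in auto)
    fix k s b
    assume *: "k \<in> {1..N}" "s \<in> {0..T2}" "b \<in> {0..R}" "s = 0 \<or> s = T2 \<or> b = R \<or> ((0::real) > 0 \<and> b = 0)"
    have s: "s \<in> {0..<T}" and b: "b \<ge> 0" using * T2 by auto
    have pos: "\<sigma> / (T - s) > 0" "\<mu> * b \<ge> 0" using \<sigma> s \<mu> b by auto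
    have "- 2 * \<theta> < w s (b *\<^sub>R e k) - \<Phi> s (b *\<^sub>R e k)"
    proof -
      consider "s = 0" | "s = T2" | "b = R" using *(4) by auto
      then have "(w s (b *\<^sub>R e k) - bval k s b) + \<mu> * b + \<sigma> / (T - s) > 0"
      proof cases
        case 1
        have "ereal (u0 (b *\<^sub>R e k)) \<le> ereal (w 0 (b *\<^sub>R e k))"
          using super in_J[OF *(1) b] unfolding visc_super_def by blast
        then have "w s (b *\<^sub>R e k) - bval k s b \<ge> 0"
          using val_initial[OF in_J[OF *(1) b]] 1 by (simp add: bval_def)
        then show ?thesis using pos by linarith
      next
        case 2
        then show ?thesis using T2Z wV[OF *(1) s b] pos(2) by simp
      next
        case 3
        then show ?thesis using RZ wV[OF *(1) s b] pos(1) by simp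
      qed
      then show ?thesis using lower[OF *(1) s b] by linarith
    qed
    then show "- w s (b *\<^sub>R e k) + \<Phi> s (b *\<^sub>R e k) < - w t1 (a1 *\<^sub>R e i) + \<Phi> t1 (a1 *\<^sub>R e i)"
      using ref \<theta> by linarith
  qed (use i t1 T2 a1 that in \<open>auto simp: R_def\<close>)
  have s: "s \<in> {0<..<T}" and b: "b \<ge> 0" and k: "k \<in> {1..N}" using ksb T2 by auto
  \<comment> \<open>The expression is affine in the test function, so the blend splits into the
    smoothing error, a nonpositive part from \<open>K1 * \<bar>q\<bar> - M \<le> L j q\<close>, and
    the strict time term.\<close>
  have strict: "gt j s c + (gx j s c * q - L j q) \<le> - \<sigma> / (2 * T\<^sup>2)"
    if j: "j \<in> {1..N}" and c: "c \<ge> 0" "c > 0 \<or> q \<le> 0" for j c q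
  proof -
    have "(1 - \<mu>) * (smooth_t \<delta> \<epsilon> j s c + q * smooth_x \<delta> \<epsilon> j s c - L j q) \<le> (1 - \<mu>) * (\<sigma> / (2 * T\<^sup>2))"
      using smooth_subsolution[OF \<delta> \<epsilon> j s c] err \<mu> by (intro mult_left_mono) auto
    also have "\<dots> \<le> \<sigma> / (2 * T\<^sup>2)" by (rule mult_left_le_one_le) (use \<mu> \<sigma> in auto)
    finally have 1: "(1 - \<mu>) * (smooth_t \<delta> \<epsilon> j s c + q * smooth_x \<delta> \<epsilon> j s c - L j q) \<le> \<sigma> / (2 * T\<^sup>2)" .
    have "- (K1 * q) \<le> K1 * \<bar>q\<bar>" using K0_nonneg abs_ge_minus_self[of "K1 * q"] by (simp add: abs_mult K1_def)
    then have "\<mu> * (- M - K1 * q - L j q) \<le> 0"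
      using M(2)[OF j, of q] \<mu> by (intro mult_nonneg_nonpos) auto
    moreover have "\<sigma> / T\<^sup>2 \<le> \<sigma> / (T - s)\<^sup>2"
      using \<sigma> s by (intro divide_left_mono power_mono mult_pos_pos) auto
    moreover have "\<sigma> / T\<^sup>2 = 2 * (\<sigma> / (2 * T\<^sup>2))" by simp
    moreover have "gt j s c + (gx j s c * q - L j q) =
        (1 - \<mu>) * (smooth_t \<delta> \<epsilon> j s c + q * smooth_x \<delta> \<epsilon> j s c - L j q)
        + \<mu> * (- M - K1 * q - L j q) - \<sigma> / (T - s)\<^sup>2"
      unfolding gt_def gx_def by (simp add: algebra_simps)
    moreover have "- \<sigma> / (2 * T\<^sup>2) = - (\<sigma> / (2 * T\<^sup>2))" by simp
    ultimately show ?thesis using 1 by linarith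
  qed
  have neg: "- \<sigma> / (2 * T\<^sup>2) < 0" using \<sigma> T by simp
  have min': "w s (b *\<^sub>R e k) - \<Phi> s (b *\<^sub>R e k) \<le> w s' y - \<Phi> s' y"
    if "y \<in> J" "\<bar>s' - s\<bar> < \<rho>" "dJ (b *\<^sub>R e k) y < \<rho>" for s' y
    using max[OF that] by simp
  note test = visc_super_local_min[OF super C1 s in_J[OF k b] \<rho> min']
  show False
  proof (cases "b = 0")
    case True
    then obtain j where j: "j \<in> {1..N}" "\<Phi>t s 0 + Ham_minus (L j) (gx j s 0) \<ge> 0"
      using test(2) by auto
    have "Ham_minus (L j) (gx j s 0) \<le> - gt j s 0 - \<sigma> / (2 * T\<^sup>2)"
    proof (rule Ham_minus_le)
      fix q :: real assume "q \<le> 0"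
      then show "gx j s 0 * q - L j q \<le> - gt j s 0 - \<sigma> / (2 * T\<^sup>2)"
        using strict[OF j(1) order_refl, of q] by simp
    qed
    moreover have "\<Phi>t s 0 = gt j s 0" using \<Phi>(2)[OF j(1), of 0 s] by simp
    ultimately show False using j(2) neg by simp
  next
    case False
    then have b': "b > 0" using b by simp
    have "Ham (L k) (gx k s b) \<le> - gt k s b - \<sigma> / (2 * T\<^sup>2)"
    proof (rule Ham_le)
      fix q
      show "gx k s b * q - L k q \<le> - gt k s b - \<sigma> / (2 * T\<^sup>2)"
        using strict[OF k b, of q] b' by simp
    qed
    moreover have "gt k s b + Ham (L k) (gx k s b) \<ge> 0"
      using test(1)[OF _ _ _ k b' refl] \<Phi>(2)[OF k b] by simp
    ultimately show False using neg by simp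
  qed
qed

end

section \<open>Well-posedness\<close>

context hj_junction begin

section \<open>Finite envelopes and uniqueness\<close>

lemma visc_sub_cong:
  assumes "\<And>t x. t \<in> {0..<T} \<Longrightarrow> x \<in> J \<Longrightarrow> w t x = w' t x" "T > 0" "visc_sub N e L T u0 w"
  shows "visc_sub N e L T u0 w'"
proof -
  have "w' t x = w t x" if "t \<in> {0<..<T}" "x \<in> J" for t x using assms(1) that by auto
  moreover have "w' t x = w t x" if "t \<in> {0..<T}" "x \<in> J" for t x using assms(1) that by auto
  moreover have "w' 0 x = w 0 x" if "x \<in> J" for x using assms(1,2) that by auto
  ultimately show ?thesis
    using assms(3) unfolding visc_sub_def usc_on_def 
    by (simp del: atLeastLessThan_iff greaterThanLessThan_iff cong: ball_cong imp_cong) (elim conjE, assumption)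
qed

lemma visc_super_cong:
  assumes "\<And>t x. t \<in> {0..<T} \<Longrightarrow> x \<in> J \<Longrightarrow> w t x = w' t x" "T > 0" "visc_super N e L T u0 w"
  shows "visc_super N e L T u0 w'"
proof -
  have "w' t x = w t x" if "t \<in> {0<..<T}" "x \<in> J" for t x using assms(1) that by auto
  moreover have "w' t x = w t x" if "t \<in> {0..<T}" "x \<in> J" for t x using assms(1) that by auto
  moreover have "w' 0 x = w 0 x" if "x \<in> J" for x using assms(1,2) that by auto
  ultimately show ?thesis
    using assms(3) unfolding visc_super_def lsc_on_def 
    by (simp del: atLeastLessThan_iff greaterThanLessThan_iff cong: ball_cong imp_cong) (elim conjE, assumption)
qed

lemma usc_env_upper:
  assumes "\<And>t x. t \<in> {0..<T} \<Longrightarrow> x \<in> J \<Longrightarrow> v t x \<le> u0 x + C" "x \<in> J"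
  shows "usc_env N e T v t x \<le> ereal (u0 x + K0 + C)"
  unfolding usc_env_def
proof (rule INF_lower2[of 1], simp, rule Sup_least, elim CollectE exE conjE, simp only:)
  fix s y assume sy: "s \<in> {0..<T}" "y \<in> J" "dJ x y < 1"
  have "K0 * dJ x y \<le> K0" using sy(3) K0_nonneg by (simp add: mult_left_le)
  then show "ereal (v s y) \<le> ereal (u0 x + K0 + C)"
    using assms(1)[OF sy(1,2)] u0_lipschitz[OF assms(2) sy(2)] by (simp add: abs_le_iff)
qed

lemma lsc_env_lower:
  assumes "\<And>t x. t \<in> {0..<T} \<Longrightarrow> x \<in> J \<Longrightarrow> u0 x - C \<le> v t x" "x \<in> J"
  shows "ereal (u0 x - K0 - C) \<le> lsc_env N e T v t x"
  unfolding lsc_env_def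
proof (rule SUP_upper2[of 1], simp, rule Inf_greatest, elim CollectE exE conjE, simp only:)
  fix s y assume sy: "s \<in> {0..<T}" "y \<in> J" "dJ x y < 1"
  have "K0 * dJ x y \<le> K0" using sy(3) K0_nonneg by (simp add: mult_left_le)
  then show "ereal (u0 x - K0 - C) \<le> ereal (v s y)"
    using assms(1)[OF sy(1,2)] u0_lipschitz[OF assms(2) sy(2)] by (simp add: abs_le_iff)
qed

text \<open>With z and w the lower and upper envelopes, z \<le> v \<le> w by definition, while
  comparison gives w \<le> \<open>val\<close> \<le> z. The assumed bound covers positive times only;
  at time 0 the envelopes force v = u0.\<close>

lemma visc_solution_unique:
  assumes sol: "visc_solution N e L T u0 v"
    and close: "\<And>t x. t \<in> {0<..<T} \<Longrightarrow> x \<in> J \<Longrightarrow> \<bar>v t x - u0 x\<bar> \<le> C" and C: "C > 0"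
    and t: "t \<in> {0..<T}" and x: "x \<in> J"
  shows "v t x = val t x"
proof -
  have T: "T > 0" using t by auto
  have sub: "visc_sub N e L T u0 (usc_env N e T v)" and super: "visc_super N e L T u0 (lsc_env N e T v)"
    using sol by (auto simp: visc_solution_def)
  have v0: "v 0 y = u0 y" if "y \<in> J" for y
  proof (rule antisym)
    have "ereal (v 0 y) \<le> usc_env N e T v 0 y" by (rule usc_env_ge) (use that T in auto)
    also have "\<dots> \<le> ereal (u0 y)" using sub that unfolding visc_sub_def by blast
    finally show "v 0 y \<le> u0 y" by simp
    have "ereal (u0 y) \<le> lsc_env N e T v 0 y" using super that unfolding visc_super_def by blast
    also have "\<dots> \<le> ereal (v 0 y)" by (rule lsc_env_le) (use that T in auto)
    finally show "u0 y \<le> v 0 y" by simp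
  qed
  have close': "v s y \<le> u0 y + C" "u0 y - C \<le> v s y" if "s \<in> {0..<T}" "y \<in> J" for s y
    using close[of s y] v0[OF that(2)] that C by (cases "s = 0"; force simp: abs_le_iff)+
  define w where "w s y = real_of_ereal (usc_env N e T v s y)" for s y
  define z where "z s y = real_of_ereal (lsc_env N e T v s y)" for s y
  have w: "usc_env N e T v s y = ereal (w s y)" if "s \<in> {0..<T}" "y \<in> J" for s y
    unfolding w_def using usc_env_ge[OF that, of v] usc_env_upper[of T v C y s] close' that
    by (cases "usc_env N e T v s y") auto
  have z: "lsc_env N e T v s y = ereal (z s y)" if "s \<in> {0..<T}" "y \<in> J" for s y
    unfolding z_def using lsc_env_le[OF that, of v] lsc_env_lower[of T C v y s] close' that
    by (cases "lsc_env N e T v s y") auto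
  have vw: "v s y \<le> w s y" "w s y \<le> u0 y + (K0 + C)" if "s \<in> {0..<T}" "y \<in> J" for s y
    using usc_env_ge[OF that, of v] usc_env_upper[of T v C y s] close' that w by auto
  have vz: "z s y \<le> v s y" "u0 y - (K0 + C) \<le> z s y" if "s \<in> {0..<T}" "y \<in> J" for s y
    using lsc_env_le[OF that, of v] lsc_env_lower[of T C v y s] close' that z by auto
  have subw: "visc_sub N e L T u0 (\<lambda>s y. ereal (w s y))"
    using visc_sub_cong[OF w T sub] .
  have superz: "visc_super N e L T u0 (\<lambda>s y. ereal (z s y))"
    using visc_super_cong[OF z T super] .
  have "w t x \<le> val t x"
  proof (rule dominated_le_val[OF sub_dominated[OF subw vw(2)] _ _ t x])
    show "w 0 y \<le> u0 y" if "y \<in> J" for y using subw that unfolding visc_sub_def by simp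
    show "u0 y - C \<le> w s y" if "s \<in> {0..<T}" "y \<in> J" for s y
      using vw(1)[OF that] close'(2)[OF that] by linarith
  qed
  moreover have "val t x \<le> z t x"
    by (rule super_ge_val[OF superz vz(2) t x])
  ultimately show ?thesis using vw(1)[OF t x] vz(1)[OF t x] by linarith
qed

end

section \<open>From uniform convexity to the locale assumptions\<close>

text \<open>After subtracting the tangent slope at 0 and the parabola, the derivative is
  nondecreasing and vanishes at 0, so 0 is a minimum.\<close>

lemma C2_unif_convex_quadratic_minorant:
  assumes "C2_unif_convex \<gamma> f"
  obtains d where "\<And>q. f 0 + d * q + \<gamma> / 2 * q\<^sup>2 \<le> f q"
proof -
  obtain f1 f2 where f: "\<And>q. (f has_real_derivative f1 q) (at q)" "\<And>q. (f1 has_real_derivative f2 q) (at q)"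
      "\<And>q. f2 q \<ge> \<gamma>"
    using assms unfolding C2_unif_convex_def by blast
  define g where "g q = f q - f1 0 * q - \<gamma> / 2 * q\<^sup>2" for q
  define g1 where "g1 q = f1 q - f1 0 - \<gamma> * q" for q
  have g: "(g has_real_derivative g1 q) (at q)" for q
    unfolding g_def g1_def by (auto intro!: derivative_eq_intros f)
  have "(g1 has_real_derivative (f2 q - \<gamma>)) (at q)" for q
    unfolding g1_def by (auto intro!: derivative_eq_intros f)
  then have mono: "g1 x \<le> g1 y" if "x \<le> y" for x y
    using DERIV_nonneg_imp_nondecreasing[OF that, of g1] f(3) by (metis diff_ge_0_iff_ge)
  have g10: "g1 0 = 0" by (simp add: g1_def)
  have "g 0 \<le> g q" for q
  proof (cases "q \<ge> 0")
    case True
    show ?thesis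
      by (rule DERIV_nonneg_imp_nondecreasing[OF True]) (use g mono[of 0] g10 in auto)
  next
    case False
    then have "q \<le> 0" by simp
    then show ?thesis
      by (rule DERIV_nonpos_imp_nonincreasing) (use g mono[of _ 0] g10 in auto)
  qed
  then show ?thesis
    using that[of "f1 0"] by (simp add: g_def algebra_simps)
qed

lemma quadratic_minorant_superlinear:
  fixes f :: "real \<Rightarrow> real"
  assumes "\<And>q. f 0 + d * q + \<gamma> / 2 * q\<^sup>2 \<le> f q" "\<gamma> > 0"
  shows "\<exists>C. \<forall>q. M * \<bar>q\<bar> - C \<le> f q"
proof (intro exI allI)
  fix q
  define A where "A = \<bar>M\<bar> + \<bar>d\<bar>"
  have "M * \<bar>q\<bar> \<le> \<bar>M\<bar> * \<bar>q\<bar>" "- (d * q) \<le> \<bar>d\<bar> * \<bar>q\<bar>"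
    by (simp_all add: mult_right_mono abs_mult[symmetric])
  moreover have "A * \<bar>q\<bar> \<le> \<gamma> / 2 * q\<^sup>2 + A\<^sup>2 / (2 * \<gamma>)"
  proof -
    \<comment> \<open>Young's inequality: the parabola absorbs any linear growth.\<close>
    have "0 \<le> (\<gamma> * \<bar>q\<bar> - A)\<^sup>2 / (2 * \<gamma>)" using assms(2) by simp
    also have "\<dots> = \<gamma> / 2 * q\<^sup>2 + A\<^sup>2 / (2 * \<gamma>) - A * \<bar>q\<bar>"
      using assms(2) by (simp add: field_simps power2_eq_square)
    finally show ?thesis by simp
  qed
  ultimately show "M * \<bar>q\<bar> - (A\<^sup>2 / (2 * \<gamma>) - f 0) \<le> f q"
    using assms(1)[of q] by (simp add: A_def distrib_right)
qed

theorem mainTheorem1: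
  fixes N :: nat and e :: "nat \<Rightarrow> real \<times> real" and \<gamma> :: real
    and L :: "nat \<Rightarrow> real \<Rightarrow> real" and u0 :: "real \<times> real \<Rightarrow> real" and T :: real
  assumes "N \<ge> 1"
    and "\<forall>i\<in>{1..N}. norm (e i) = 1"
    and "inj_on e {1..N}"
    and "lipschitz_J N e u0"
    and "\<gamma> > 0"
    and "\<forall>i\<in>{1..N}. C2_unif_convex \<gamma> (L i)"
    and "T > 0"
  shows "\<exists>u. visc_solution N e L T u0 u
           \<and> (\<exists>C>0. \<forall>t\<in>{0<..<T}. \<forall>x\<in>junction N e. \<bar>u t x - u0 x\<bar> \<le> C)
           \<and> (\<forall>v. visc_solution N e L T u0 v
                 \<and> (\<exists>C>0. \<forall>t\<in>{0<..<T}. \<forall>x\<in>junction N e. \<bar>v t x - u0 x\<bar> \<le> C)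
                 \<longrightarrow> (\<forall>t\<in>{0..<T}. \<forall>x\<in>junction N e. v t x = u t x))
           \<and> lipschitz_JT N e T u"
proof -
  obtain K where K: "\<And>x y. x \<in> junction N e \<Longrightarrow> y \<in> junction N e \<Longrightarrow> \<bar>u0 x - u0 y\<bar> \<le> K * jdist N e x y"
    using assms(4) unfolding lipschitz_J_def by blast
  \<comment> \<open>The Lipschitz constant is not assumed nonnegative, hence its absolute
    value.\<close>
  interpret hj_junction N e L u0 "\<bar>K\<bar>"
  proof
    fix i assume i: "i \<in> {1..N}"
    show "norm (e i) = 1" using assms(2) i by blast
    obtain d where d: "\<And>q. L i 0 + d * q + \<gamma> / 2 * q\<^sup>2 \<le> L i q"
      using C2_unif_convex_quadratic_minorant assms(6) i by metis
    show "\<exists>C. \<forall>q. M * \<bar>q\<bar> - C \<le> L i q" for M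
      by (rule quadratic_minorant_superlinear[OF d assms(5)])
    have "L i 0 + d * q \<le> L i q" for q
      using d[of q] assms(5) by (smt (verit) zero_le_power2 mult_nonneg_nonneg half_gt_zero)
    then show "\<exists>d. \<forall>q. L i 0 + d * q \<le> L i q" by blast
  next
    fix x y assume "x \<in> junction N e" "y \<in> junction N e"
    then have "\<bar>u0 x - u0 y\<bar> \<le> K * jdist N e x y" by (rule K)
    also have "\<dots> \<le> \<bar>K\<bar> * jdist N e x y"
      by (intro mult_right_mono) (auto simp: jdist_def)
    finally show "\<bar>u0 x - u0 y\<bar> \<le> \<bar>K\<bar> * jdist N e x y" .
  qed (use assms in auto)
  show ?thesis
  proof (intro exI[of _ val] conjI allI impI)
    show "visc_solution N e L T u0 val" by (rule visc_solution_val)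
    show "\<exists>C>0. \<forall>t\<in>{0<..<T}. \<forall>x\<in>junction N e. \<bar>val t x - u0 x\<bar> \<le> C"
    \<comment> \<open>The constant must be positive although \<open>rate\<close> may vanish, hence
      the summand 1.\<close>
    proof (intro exI[of _ "rate * T + 1"] conjI ballI)
      show "rate * T + 1 > 0" using rate_nonneg assms(7) by (simp add: add_nonneg_pos)
      fix t x assume t: "t \<in> {0<..<T}" and x: "x \<in> junction N e"
      have "rate * t \<le> rate * T" using t rate_nonneg by (intro mult_left_mono) auto
      then show "\<bar>val t x - u0 x\<bar> \<le> rate * T + 1"
        using val_bounds[of t x] t x by auto
    qed
    show "lipschitz_JT N e T val"
      unfolding lipschitz_JT_def using val_lipschitz by (intro exI[of _ lip]) auto
    fix v assume v: "visc_solution N e L T u0 v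
        \<and> (\<exists>C>0. \<forall>t\<in>{0<..<T}. \<forall>x\<in>junction N e. \<bar>v t x - u0 x\<bar> \<le> C)"
    then show "\<forall>t\<in>{0..<T}. \<forall>x\<in>junction N e. v t x = val t x"
      using visc_solution_unique by blast
  qed
qed

end
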